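(* Let $(\lambda^{(d)}\in\mathbb{Y}_d)_{d\ge1}$ be a sequence of random Young diagrams distributed by the Jack--Plancherel measures $\mathbb{P}^{(\alpha)}_d$. For $h>0$ let $\{l_1^{(h)}<l_2^{(h)}<\cdots\}=\{z\in\mathbb{R}:J_{-z\cdot h^{-1}}(2h^{-1})=0\}$. (1) Assume $g>0$. In the regime $\alpha,d\to\infty$, $\sqrt\alpha/\sqrt d\to g$, for every $i=1,2,\dots$, $\frac{(\lambda^{(d)})'_i}{-g\cdot d}\to l_i^{(g)}-ig$ in probability, and the limit shape is $$\omega_{\Lambda_\infty}(x)=\begin{cases} -x,&\text{if } x<l_1^{(g)}-g,\\ -2\big(l_i^{(g)}-ig\big)+x,&\text{if } x\in\big[l_i^{(g)}-g,\,l_i^{(g)}\big]\text{ for some }i\ge1,\\ -x+2ig,&\text{if } x\in\big[l_i^{(g)},\,l_{i+1}^{(g)}-g\big]\text{ for some }i\ge1.\end{cases}$$ (2) Assume $g<0$. In the regime $\alpha\to0$, $d\to\infty$, $\sqrt{\alpha d}\to-g^{-1}$, for every $i=1,2,\dots$, $\frac{\lambda^{(d)}_i}{-g\cdot d}\to-l_i^{(-g)}-ig$ in probability, and the limit shape is $$\omega_{\Lambda_\infty}(x)=\begin{cases} x,&\text{if } x>-l_1^{(-g)}-g,\\ -2\big(l_i^{(-g)}+ig\big)-x,&\text{if } x\in\big[-l_i^{(-g)},\,-l_i^{(-g)}-g\big]\text{ for some }i\ge1,\\ x-2ig,&\text{if } x\in\big[-l_{i+1}^{(-g)}-g,\,-l_i^{(-g)}\big]\text{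 for some }i\ge1.\end{cases}$$
   Context: $\mathbb{Y}_d$ is the set of partitions of $d$; $\lambda'$ is the conjugate partition; $\alpha=\alpha(d)>0$ is a sequence. Jack--Plancherel measure: $\mathbb{P}^{(\alpha)}_d(\lambda):=\dfrac{d!\,\alpha^d}{\prod_{(i,j)\in\lambda}(\alpha(\lambda_i-j)+(\lambda'_j-i)+1)(\alpha(\lambda_i-j)+(\lambda'_j-i)+\alpha)}$, $\lambda\in\mathbb{Y}_d$. Bessel function of the first kind: $J_\nu(x)=\sum_{m\ge0}\frac{(-1)^m}{m!\,\Gamma(m+\nu+1)}\big(\frac x2\big)^{2m+\nu}$ (with $1/\Gamma=0$ at the poles of $\Gamma$). Limit shape: $T_{w,h}\lambda$ is the diagram $\lambda$ (French convention, in $x,y\ge0$) with each $1\times1$ box replaced by a box of width $w$ and height $h$; its profile is the function whose graph in the coordinates $(x-y,x+y)$ is the boundary of $T_{w,h}\lambda$ extended by the coordinate half-axes. $\omega_{\Lambda_\infty}$ is the deterministic function which is the limit, in supremum norm in probability, of the profiles of $T_{\sqrt{\alpha/d},\,1/\sqrt{\alpha d}}\,\lambda^{(d)}$ in the regime considered. *)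

theory Defs
  imports "HOL-Probability.Probability"
begin

text \<open>A partition is the weakly decreasing list of its positive parts. Rows and columns of its
  diagram are numbered from 1; \<open>(i, j)\<close> is the box in row \<open>i\<close> and column \<open>j\<close>.\<close>

definition partitions :: "nat \<Rightarrow> nat list set" where
  "partitions d = {p. sorted_wrt (\<ge>) p \<and> 0 \<notin> set p \<and> sum_list p = d}"

definition nth_part :: "nat list \<Rightarrow> nat \<Rightarrow> nat" where
  "nth_part p i = (if 1 \<le> i \<and> i \<le> length p then p ! (i - 1) else 0)"

definition diagram :: "nat list \<Rightarrow> (nat \<times> nat) set" where
  "diagram p = {(i, j). 1 \<le> i \<and> 1 \<le> j \<and> j \<le> nth_part p i}"

text \<open>For \<open>j \<ge> 1\<close>, the \<open>j\<close>-th part of the conjugate partition, i.e. the length of the \<open>j\<close>-th column.\<close>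

definition conj_part :: "nat list \<Rightarrow> nat \<Rightarrow> nat" where
  "conj_part p j = card {i. (i, j) \<in> diagram p}"

definition jack_weight :: "real \<Rightarrow> nat \<Rightarrow> nat list \<Rightarrow> real" where
  "jack_weight \<alpha> d p = fact d * \<alpha> ^ d /
     (\<Prod>(i, j)\<in>diagram p.
        (\<alpha> * (real (nth_part p i) - real j) + (real (conj_part p j) - real i) + 1) *
        (\<alpha> * (real (nth_part p i) - real j) + (real (conj_part p j) - real i) + \<alpha>))"

definition jack_plancherel :: "real \<Rightarrow> nat \<Rightarrow> nat list measure" where
  "jack_plancherel \<alpha> d = point_measure (partitions d) (\<lambda>p. ennreal (jack_weight \<alpha> d p))"

text \<open>The Bessel function of the first kind for real order and \<open>x > 0\<close>; \<open>rGamma\<close> is \<open>1 / \<Gamma>\<close>,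
  with value \<open>0\<close> at the poles of \<open>\<Gamma>\<close>.\<close>

definition bessel_J :: "real \<Rightarrow> real \<Rightarrow> real" where
  "bessel_J \<nu> x =
     (\<Sum>m. (-1) ^ m / fact m * rGamma (real m + \<nu> + 1) * (x / 2) powr (2 * real m + \<nu>))"

text \<open>French convention: row \<open>1\<close> is at the bottom, rows extend in the \<open>x\<close>-direction.\<close>

definition scaled_diagram :: "real \<Rightarrow> real \<Rightarrow> nat list \<Rightarrow> (real \<times> real) set" where
  "scaled_diagram w h p =
     (\<Union>(i, j)\<in>diagram p. {(real j - 1) * w .. real j * w} \<times> {(real i - 1) * h .. real i * h})"

text \<open>The boundary of the scaled diagram extended by the half-axes: the staircase together with the
  parts of the half-axes \<open>x \<ge> 0\<close> and \<open>y \<ge> 0\<close> beyond it. It is the topological boundary after the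
  complement of the open first quadrant has been adjoined, which removes the sides of the
  diagram that lie along the axes.\<close>

definition extended_boundary :: "real \<Rightarrow> real \<Rightarrow> nat list \<Rightarrow> (real \<times> real) set" where
  "extended_boundary w h p = frontier (scaled_diagram w h p \<union> {(x, y). x \<le> 0 \<or> y \<le> 0})"

definition profile :: "real \<Rightarrow> real \<Rightarrow> nat list \<Rightarrow> real \<Rightarrow> real" where
  "profile w h p = (THE f. {(u, f u) | u. True} = (\<lambda>(x, y). (x - y, x + y)) ` extended_boundary w h p)"

lemma finite_diagram: "finite (diagram p)"
proof -
  have "diagram p \<subseteq> Sigma {1..length p} (\<lambda>i. {1..nth_part p i})"
    by (auto simp: diagram_def nth_part_def split: if_splits)
  then show ?thesis by (rule finite_subset) auto
qed

lemma nth_part_antimono: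
  assumes "p \<in> partitions d" "1 \<le> i" "i \<le> k"
  shows "nth_part p k \<le> nth_part p i"
  using assms sorted_wrt_nth_less[of "(\<ge>)" p "i - 1" "k - 1"]
  by (cases "i = k") (auto simp: partitions_def nth_part_def)

text \<open>The description in \<open>profile\<close> is satisfied: the extended boundary is a graph over the whole real line.\<close>

lemma profile_graph:
  assumes p: "p \<in> partitions d" and w: "w > 0" and h: "h > 0"
  shows "{(u, profile w h p u) | u. True} = (\<lambda>(x, y). (x - y, x + y)) ` extended_boundary w h p"
proof -
  define D where "D = scaled_diagram w h p"
  define S where "S = D \<union> {(x, y). x \<le> 0 \<or> y \<le> 0}"
  have quad: "{(x::real, y::real). x \<le> 0 \<or> y \<le> 0} = {..0} \<times> UNIV \<union> UNIV \<times> {..0}" by auto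
  have "compact D" unfolding D_def scaled_diagram_def
    by (rule compact_UN[OF finite_diagram]) (auto intro!: compact_Times)
  then have clS: "closed S" unfolding S_def quad
    by (intro closed_Un closed_Times compact_imp_closed[OF \<open>compact D\<close>]) auto
  obtain B where B: "\<And>x y. (x, y) \<in> D \<Longrightarrow> x < B"
  proof -
    obtain B where "\<And>z. z \<in> D \<Longrightarrow> norm z < B"
      using compact_imp_bounded[OF \<open>compact D\<close>] bounded_pos_less by metis
    then have "x < B" if "(x, y) \<in> D" for x y
      using that norm_fst_le[of x y] by (fastforce simp: abs_if split: if_splits)
    then show thesis using that by blast
  qed
  have down: "(x', y') \<in> S" if xy: "(x, y) \<in> S" and le: "x' \<le> x" "y' \<le> y" for x y x' y'
  proof (cases "x' \<le> 0 \<or> y' \<le> 0")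
    case True then show ?thesis by (auto simp: S_def)
  next
    case False
    then have pos: "0 < x'" "0 < y'" by auto
    with xy le have "(x, y) \<in> D" by (auto simp: S_def)
    then obtain i j where ij: "(i, j) \<in> diagram p" "x \<le> real j * w" "y \<le> real i * h"
      by (auto simp: D_def scaled_diagram_def)
    have box: "\<exists>k. 1 \<le> k \<and> k \<le> n \<and> (real k - 1) * c \<le> t \<and> t \<le> real k * c"
      if "0 < t" "t \<le> real n * c" "c > 0" for t c n
    proof (intro exI conjI)
      let ?k = "nat \<lceil>t / c\<rceil>"
      have tc: "0 < t / c" "t / c \<le> real n" using that by (auto simp: divide_simps)
      show "1 \<le> ?k" using tc(1) by linarith
      show "?k \<le> n" using tc by linarith
      have "real ?k - 1 \<le> t / c" "t / c \<le> real ?k" using tc by linarith+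
      then show "(real ?k - 1) * c \<le> t" "t \<le> real ?k * c"
        using \<open>c > 0\<close> pos_le_divide_eq[of c "real ?k - 1" t] pos_divide_le_eq[of c t "real ?k"] by blast+
    qed
    obtain j' where j': "1 \<le> j'" "j' \<le> j" "(real j' - 1) * w \<le> x'" "x' \<le> real j' * w"
      using box[of x' j w] pos ij le w by auto
    obtain i' where i': "1 \<le> i'" "i' \<le> i" "(real i' - 1) * h \<le> y'" "y' \<le> real i' * h"
      using box[of y' i h] pos ij le h by auto
    have "(i', j') \<in> diagram p"
      using ij i' j' nth_part_antimono[OF p, of i' i] by (auto simp: diagram_def)
    then have "(x', y') \<in> D" using i' j' by (fastforce simp: D_def scaled_diagram_def)
    then show ?thesis by (simp add: S_def)
  qed
  define pt where "pt u t = ((t + u) / 2, (t - u) / 2)" for u t :: real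
  have cont: "continuous_on UNIV (pt u)" for u unfolding pt_def by (intro continuous_intros) auto
  have "\<exists>!v. pt u v \<in> frontier S" for u
  proof -
    define T where "T = pt u -` S"
    have clT: "closed T" unfolding T_def using clS cont continuous_closed_vimage[of S "pt u"]
      by (simp add: continuous_on_eq_continuous_at)
    have ne: "- \<bar>u\<bar> \<in> T" by (auto simp: T_def pt_def S_def)
    have bd: "t \<le> 2 * \<bar>B\<bar> + \<bar>u\<bar>" if "t \<in> T" for t
    proof (rule ccontr)
      assume "\<not> ?thesis"
      then have "(t + u) / 2 > 0" "(t - u) / 2 > 0" "(t + u) / 2 > B"
        using abs_ge_self[of u] abs_ge_minus_self[of u] abs_ge_self[of B] abs_ge_zero[of B]
        by auto
      with that B[of "(t + u) / 2" "(t - u) / 2"] show False by (auto simp: T_def pt_def S_def)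
    qed
    then have bdd: "bdd_above T" by (rule bdd_aboveI)
    define v where "v = Sup T"
    have vT: "v \<in> T" unfolding v_def using closed_contains_Sup[OF _ bdd clT] ne by auto
    have gt: "pt u t \<notin> S" if "t > v" for t
      using cSup_upper[OF _ bdd, of t] that by (auto simp: v_def T_def)
    have lt: "pt u t \<in> interior S" if "t < v" for t
    proof -
      let ?U = "{..<(v + u) / 2} \<times> {..<(v - u) / 2}"
      have "open ?U" by (intro open_Times) auto
      moreover have "?U \<subseteq> S" using vT down[of "(v + u) / 2" "(v - u) / 2"]
        by (auto simp: T_def pt_def)
      moreover have "pt u t \<in> ?U" using that by (auto simp: pt_def)
      ultimately show ?thesis by (meson interiorI)
    qed
    have "pt u v \<notin> interior S"
    proof
      assume "pt u v \<in> interior S"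
      moreover have "open (pt u -` interior S)"
        using cont continuous_open_vimage[of "interior S" "pt u"]
        by (simp add: continuous_on_eq_continuous_at)
      ultimately obtain e where "e > 0" "\<And>t. dist t v < e \<Longrightarrow> pt u t \<in> interior S"
        unfolding open_dist by (metis vimageE vimageI)
      then have "pt u (v + e / 2) \<in> S" using interior_subset by (force simp: dist_real_def)
      with gt[of "v + e / 2"] \<open>e > 0\<close> show False by simp
    qed
    then have "pt u t \<in> frontier S \<longleftrightarrow> t = v" for t
      using vT gt[of t] lt[of t] closure_closed[OF clS]
      by (cases t v rule: linorder_cases) (auto simp: frontier_def T_def)
    then show ?thesis by auto
  qed
  then obtain f where f: "\<And>u v. pt u v \<in> frontier S \<longleftrightarrow> v = f u" by metis
  have fr: "extended_boundary w h p = frontier S"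
    by (simp add: extended_boundary_def S_def D_def)
  have eq: "{(u, f u) | u. True} = (\<lambda>(x, y). (x - y, x + y)) ` extended_boundary w h p" (is "?L = ?R")
  proof (intro equalityI subsetI)
    fix z assume "z \<in> ?L"
    then obtain u where z: "z = (u, f u)" by auto
    have "pt u (f u) \<in> frontier S" using f by blast
    then show "z \<in> ?R" unfolding fr z
      by (rule rev_image_eqI) (simp add: pt_def diff_divide_distrib add_divide_distrib)
  next
    fix z assume "z \<in> ?R"
    then obtain x y where xy: "(x, y) \<in> frontier S" "z = (x - y, x + y)" unfolding fr by auto
    have "pt (x - y) (x + y) = (x, y)" by (simp add: pt_def)
    with xy f[of "x - y" "x + y"] show "z \<in> ?L" by auto
  qed
  show ?thesis unfolding profile_def
  proof (rule theI[where a = f])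
    show "{(u, f u) | u. True} = (\<lambda>(x, y). (x - y, x + y)) ` extended_boundary w h p" by (rule eq)
  next
    fix k assume "{(u, k u) | u. True} = (\<lambda>(x, y). (x - y, x + y)) ` extended_boundary w h p"
    then have "{(u, k u) | u. True} = {(u, f u) | u. True}" using eq by simp
    then show "k = f" by (auto simp: set_eq_iff fun_eq_iff)
  qed
qed

text \<open>Convergence in probability to a constant, and to a deterministic function in supremum norm.
  The variables may live on a different probability space for each index.\<close>

definition tendsto_in_prob ::
  "(nat \<Rightarrow> 'a measure) \<Rightarrow> (nat \<Rightarrow> 'a \<Rightarrow> real) \<Rightarrow> real \<Rightarrow> bool" where
  "tendsto_in_prob M X c \<longleftrightarrow>
     (\<forall>\<epsilon>>0. (\<lambda>d. measure (M d) {s \<in> space (M d). \<bar>X d s - c\<bar> > \<epsilon>}) \<longlonglongrightarrow> 0)"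

definition tendsto_sup_in_prob ::
  "(nat \<Rightarrow> 'a measure) \<Rightarrow> (nat \<Rightarrow> 'a \<Rightarrow> real \<Rightarrow> real) \<Rightarrow> (real \<Rightarrow> real) \<Rightarrow> bool" where
  "tendsto_sup_in_prob M F f \<longleftrightarrow>
     (\<forall>\<epsilon>>0. (\<lambda>d. measure (M d)
        {s \<in> space (M d). (SUP x. ennreal \<bar>F d s x - f x\<bar>) > ennreal \<epsilon>}) \<longlonglongrightarrow> 0)"

text \<open>The deterministic function that the profiles of the diagrams \<open>\<Lambda> d\<close>, scaled by
  \<open>\<surd>(\<alpha> / d)\<close> horizontally and \<open>1 / \<surd>(\<alpha> d)\<close> vertically, approach.\<close>

definition is_limit_shape ::
  "(nat \<Rightarrow> 'a measure) \<Rightarrow> (nat \<Rightarrow> 'a \<Rightarrow> nat list) \<Rightarrow> (nat \<Rightarrow> real) \<Rightarrow> (real \<Rightarrow> real) \<Rightarrow> bool" where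
  "is_limit_shape M \<Lambda> \<alpha> \<omega> \<longleftrightarrow>
     tendsto_sup_in_prob M
       (\<lambda>d s. profile (sqrt (\<alpha> d / real d)) (1 / sqrt (\<alpha> d * real d)) (\<Lambda> d s)) \<omega>"

end

theory Submission
  imports Defs "HOL-Complex_Analysis.Great_Picard"
begin

text \<open>
  Let \<open>1 / Y\<close> be the Cauchy transform of the Jack transition measure of a diagram, i.e. of the law of
  the anisotropic content of a random added box. Then \<open>Y\<close> itself is, up to its polynomial part, the
  transform of the law of a random removed box, and adding and removing boxes are reversible with
  respect to the Jack--Plancherel measures. As one more box changes \<open>Y\<close> only by a relative error
  of order \<open>1 / d\<close>, Stein's method gives \<open>Y (z) + 1 / Y (z - g) - z \<rightarrow> 0\<close> in probability, in rescaled
  coordinates, for suitable \<open>z\<close> on the left of the diagram.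

  The column lengths are compact, so it suffices to identify the limit points of diagrams
  satisfying this relation asymptotically. In such a limit the transition and cotransition
  measures coincide; if \<open>S\<close> is their common resolvent, with poles at \<open>l 0 < l 1 < \<dots>\<close>, then
  \<open>(- z - S z) * S (z + g) = 1\<close>. The function \<open>\<phi> z = J\<^bsub>- z / g\<^esub> (2 / g)\<close> satisfies
  \<open>\<phi> (z + g) + \<phi> (z - g) = - z * \<phi> z\<close>, so that \<open>D z = \<phi> z * S z - \<phi> (z - g)\<close> satisfies
  \<open>D z = S z * D (z - g)\<close>. Since \<open>S\<close> tends to \<open>0\<close> on the left, \<open>D = 0\<close>, and the zeros of \<open>\<phi>\<close> are
  the poles of \<open>S\<close>. The regime \<open>\<alpha> \<rightarrow> 0\<close> is reduced to \<open>\<alpha> \<rightarrow> \<infinity>\<close> by conjugation.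
\<close>

section \<open>Partial fractions\<close>

text \<open>Two unknown measures survive in the limit. Inverting \<open>Y\<close> exactly gives one
  equation between them for free; Stein's method is needed only for the second one, that they agree.
  This is tested only on the left of the diagram, where the kernels are bounded whatever the diagram
  looks like, and analyticity then recovers every single weight. Mass may escape to infinity in the
  limit, so all limits are treated as weights of total mass at most 1; this does no harm because the
  kernels decay. The real obstacle is a limit in which neighbouring columns coincide or a pole
  carries no mass: such a candidate point need not be a zero of \<open>phi\<close>. It is excluded
  by moving alternately between the two measures: mass removed at column \<open>j\<close> forces a
  strict drop after it, a strict drop forces mass added at column \<open>j + 1\<close>, and the two
  masses are equal. Nothing is assumed about the zeros of the Bessel function in its order: that
  they form an increasing sequence is itself read off from the limiting diagrams.\<close>

text \<open>Residues of \<open>\<Prod>k<n. 1 + a / (z - t k)\<close> at \<open>z = t k\<close>.\<close>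

definition pf_residue :: "real \<Rightarrow> (nat \<Rightarrow> real) \<Rightarrow> nat \<Rightarrow> nat \<Rightarrow> real" where
  "pf_residue a t n k = a * (\<Prod>j\<in>{..<n} - {k}. 1 + a / (t k - t j))"

lemma pf_residue_Suc:
  assumes "k < n"
  shows "pf_residue a t (Suc n) k = pf_residue a t n k * (1 + a / (t k - t n))"
proof -
  have "{..<Suc n} - {k} = insert n ({..<n} - {k})" using assms by auto
  then show ?thesis by (simp add: pf_residue_def)
qed

lemma pf_residue_last: "pf_residue a t (Suc n) n = a * (\<Prod>j<n. 1 + a / (t n - t j))"
proof -
  have "{..<Suc n} - {n} = {..<n}" by auto
  then show ?thesis by (simp add: pf_residue_def)
qed

text \<open>Induction on the number of factors. The residue at the new pole is \<open>a\<close>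
  times the old product evaluated there, which the induction hypothesis itself expands; what remains
  is the two-pole identity \<open>split\<close>.\<close>

lemma prod_partial_fractions:
  assumes "inj_on t {..<n}" "\<And>k. k < n \<Longrightarrow> z \<noteq> t k"
  shows "(\<Prod>k<n. 1 + a / (z - t k)) = 1 + (\<Sum>k<n. pf_residue a t n k / (z - t k))"
  using assms
proof (induction n arbitrary: z)
  case 0
  then show ?case by simp
next
  case (Suc n)
  have inj: "inj_on t {..<n}" using Suc.prems(1) by (rule inj_on_subset) auto
  have ne: "t k \<noteq> t n" if "k < n" for k
    using inj_onD[OF Suc.prems(1), of k n] that by auto
  let ?\<rho> = "pf_residue a t n"
  have zn: "z - t n \<noteq> 0" using Suc.prems(2)[of n] by simp
  have last: "pf_residue a t (Suc n) n = a * (1 + (\<Sum>k<n. ?\<rho> k / (t n - t k)))"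
    using Suc.IH[OF inj, of "t n"] ne by (metis pf_residue_last)
  have split: "?\<rho> k * (1 + a / (t k - t n)) / (z - t k) + a * (?\<rho> k / (t n - t k)) / (z - t n)
      = ?\<rho> k / (z - t k) * (1 + a / (z - t n))" if "k < n" for k
  proof -
    have "z - t k \<noteq> 0" "t k - t n \<noteq> 0" "t n - t k \<noteq> 0"
      using that Suc.prems(2)[of k] ne[of k] by auto
    then show ?thesis using zn by (simp add: divide_simps) (simp add: algebra_simps)
  qed
  have "(\<Sum>k<Suc n. pf_residue a t (Suc n) k / (z - t k))
      = (\<Sum>k<n. ?\<rho> k * (1 + a / (t k - t n)) / (z - t k)) + a * (1 + (\<Sum>k<n. ?\<rho> k / (t n - t k))) / (z - t n)"
    by (simp add: pf_residue_Suc last)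
  also have "\<dots> = (\<Sum>k<n. ?\<rho> k * (1 + a / (t k - t n)) / (z - t k) + a * (?\<rho> k / (t n - t k)) / (z - t n)) + a / (z - t n)"
    by (simp add: sum.distrib sum_divide_distrib sum_distrib_left distrib_left add_divide_distrib)
  also have "\<dots> = (\<Sum>k<n. ?\<rho> k / (z - t k)) * (1 + a / (z - t n)) + a / (z - t n)"
    using split by (simp add: sum_distrib_right)
  finally have *: "(\<Sum>k<Suc n. pf_residue a t (Suc n) k / (z - t k)) = \<dots>" .
  have "(\<Prod>k<Suc n. 1 + a / (z - t k)) = (1 + (\<Sum>k<n. ?\<rho> k / (z - t k))) * (1 + a / (z - t n))"
    using Suc.IH[OF inj, of z] Suc.prems(2) by simp
  then show ?case unfolding * by (simp add: algebra_simps)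
qed

text \<open>This is the coefficient of \<open>1 / z\<close> in the expansion of the product at
  infinity, obtained by the same induction instead of a limit.\<close>

lemma sum_pf_residue:
  assumes "inj_on t {..<n}"
  shows "(\<Sum>k<n. pf_residue a t n k) = a * n"
  using assms
proof (induction n)
  case 0
  then show ?case by simp
next
  case (Suc n)
  have inj: "inj_on t {..<n}" using Suc.prems(1) by (rule inj_on_subset) auto
  have ne: "t n \<noteq> t k" if "k < n" for k
    using inj_onD[OF Suc.prems(1), of k n] that by auto
  let ?\<rho> = "pf_residue a t n"
  have last: "pf_residue a t (Suc n) n = a + (\<Sum>k<n. a * ?\<rho> k / (t n - t k))"
    using prod_partial_fractions[OF inj, of "t n" a] ne
    by (simp add: pf_residue_last distrib_left sum_distrib_left)
  have "?\<rho> k * (1 + a / (t k - t n)) + a * ?\<rho> k / (t n - t k) = ?\<rho> k" if "k < n" for k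
  proof -
    have "t k - t n \<noteq> 0" "t n - t k \<noteq> 0" using ne[OF that] by auto
    then show ?thesis by (simp add: divide_simps) (simp add: algebra_simps)
  qed
  then have "(\<Sum>k<n. ?\<rho> k * (1 + a / (t k - t n))) + (\<Sum>k<n. a * ?\<rho> k / (t n - t k)) = (\<Sum>k<n. ?\<rho> k)"
    by (simp flip: sum.distrib)
  then show ?case using Suc.IH[OF inj] by (simp add: pf_residue_Suc last algebra_simps)
qed

text \<open>This is the coefficient of \<open>1 / z^2\<close> at infinity: \<open>a * t k\<close>
  from each factor and \<open>a^2\<close> from each pair of factors.\<close>

lemma sum_pf_residue_moment:
  assumes "inj_on t {..<n}"
  shows "(\<Sum>k<n. pf_residue a t n k * t k) = a * (\<Sum>k<n. t k) + a\<^sup>2 * n * (real n - 1) / 2"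
  using assms
proof (induction n)
  case 0
  then show ?case by simp
next
  case (Suc n)
  have inj: "inj_on t {..<n}" using Suc.prems(1) by (rule inj_on_subset) auto
  have ne: "t n \<noteq> t k" if "k < n" for k
    using inj_onD[OF Suc.prems(1), of k n] that by auto
  let ?\<rho> = "pf_residue a t n"
  have last: "pf_residue a t (Suc n) n * t n = a * t n + (\<Sum>k<n. a * ?\<rho> k / (t n - t k) * t n)"
    using prod_partial_fractions[OF inj, of "t n" a] ne
    by (simp add: pf_residue_last distrib_left distrib_right sum_distrib_left sum_distrib_right)
  have "?\<rho> k * (1 + a / (t k - t n)) * t k + a * ?\<rho> k / (t n - t k) * t n = ?\<rho> k * t k + a * ?\<rho> k" if "k < n" for k
  proof -
    have "t k - t n \<noteq> 0" "t n - t k \<noteq> 0" using ne[OF that] by auto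
    then show ?thesis by (simp add: divide_simps) (simp add: algebra_simps)
  qed
  then have "(\<Sum>k<n. ?\<rho> k * (1 + a / (t k - t n)) * t k) + (\<Sum>k<n. a * ?\<rho> k / (t n - t k) * t n)
    = (\<Sum>k<n. ?\<rho> k * t k) + a * (\<Sum>k<n. ?\<rho> k)"
    by (simp add: sum_distrib_left flip: sum.distrib)
  then show ?case using Suc.IH[OF inj] sum_pf_residue[OF inj, of a]
    by (simp add: pf_residue_Suc last power2_eq_square) (simp add: field_simps)
qed

section \<open>Transition and cotransition probabilities\<close>

text \<open>Column lengths are padded with zeros to functions on all of \<open>nat\<close>, so that
  adding a box is a pointwise update and each single column can be followed to a limit.\<close>

definition columns :: "nat \<Rightarrow> (nat \<Rightarrow> nat) set" where
  "columns d = {c. (\<forall>j. c (Suc j) \<le> c j) \<and> (\<forall>j\<ge>d. c j = 0) \<and> (\<Sum>j<d. c j) = d}"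

text \<open>Column \<open>j\<close> (counted from 0) is split into the groups of rows \<open>i \<in> {c (k + 1)..<c k}\<close>,
  whose boxes all have arm length \<open>k - j\<close>.\<close>

definition column_hook_prod :: "real \<Rightarrow> (nat \<Rightarrow> nat) \<Rightarrow> nat \<Rightarrow> nat \<Rightarrow> real" where
  "column_hook_prod \<alpha> c n j = (\<Prod>k\<in>{j..<n}. \<Prod>i\<in>{c (Suc k)..<c k}.
     (\<alpha> * (real k - real j) + (real (c j) - real i)) *
     (\<alpha> * (real k - real j) + (real (c j) - real i - 1) + \<alpha>))"

definition hook_prod :: "real \<Rightarrow> nat \<Rightarrow> (nat \<Rightarrow> nat) \<Rightarrow> real" where
  "hook_prod \<alpha> n c = (\<Prod>j<n. column_hook_prod \<alpha> c n j)"

definition col_weight :: "real \<Rightarrow> nat \<Rightarrow> (nat \<Rightarrow> nat) \<Rightarrow> real" where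
  "col_weight \<alpha> d c = fact d * \<alpha> ^ d / hook_prod \<alpha> d c"

text \<open>The anisotropic content of the first free box of column \<open>j\<close>.\<close>

definition content :: "real \<Rightarrow> (nat \<Rightarrow> nat) \<Rightarrow> nat \<Rightarrow> real" where
  "content \<alpha> c j = \<alpha> * real j - real (c j)"

text \<open>The residue at \<open>content \<alpha> c k\<close> of the product of the
  \<open>1 - \<alpha> / (z - content \<alpha> c j)\<close>, divided by
  \<open>z - \<alpha> * n\<close>. That quotient is the Cauchy transform of the transition measure
  when column \<open>n - 1\<close> is empty.\<close>

definition up_prob :: "real \<Rightarrow> nat \<Rightarrow> (nat \<Rightarrow> nat) \<Rightarrow> nat \<Rightarrow> real" where
  "up_prob \<alpha> n c k = pf_residue (- \<alpha>) (content \<alpha> c) n k / (content \<alpha> c k - \<alpha> * n)"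

text \<open>Minus the residue of \<open>Ytrans\<close> at
  \<open>content \<alpha> c k + \<alpha>\<close>, divided by \<open>\<alpha>\<close> times the
  number of boxes, which normalises the total to 1.\<close>

definition down_prob :: "real \<Rightarrow> nat \<Rightarrow> (nat \<Rightarrow> nat) \<Rightarrow> nat \<Rightarrow> real" where
  "down_prob \<alpha> n c k =
     pf_residue \<alpha> (content \<alpha> c) n k * (\<alpha> * n - content \<alpha> c k - \<alpha>) / (\<alpha> * real (\<Sum>j<n. c j))"

text \<open>The reciprocal of the Cauchy transform of the transition measure \<open>up_prob\<close>.\<close>

definition Ytrans :: "real \<Rightarrow> nat \<Rightarrow> (nat \<Rightarrow> nat) \<Rightarrow> real \<Rightarrow> real" where
  "Ytrans \<alpha> n c z = (z - \<alpha> * n) * (\<Prod>k<n. 1 + \<alpha> / (z - (content \<alpha> c k + \<alpha>)))"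

lemma columns_antimono:
  assumes "c \<in> columns d" "i \<le> j"
  shows "c j \<le> c i"
proof (rule lift_Suc_antimono_le[of c, OF _ assms(2)])
  show "c (Suc n) \<le> c n" for n using assms(1) by (auto simp: columns_def)
qed

lemma columns_zero: "c \<in> columns d \<Longrightarrow> d \<le> j \<Longrightarrow> c j = 0"
  by (auto simp: columns_def)

lemma columns_sum:
  assumes "c \<in> columns d" "d \<le> n"
  shows "(\<Sum>j<n. c j) = d"
proof -
  have "(\<Sum>j<n. c j) = (\<Sum>j<d. c j)"
    using assms by (intro sum.mono_neutral_right) (auto simp: columns_zero)
  then show ?thesis using assms(1) by (simp add: columns_def)
qed

text \<open>The rectangle of width \<open>j + 1\<close> and height \<open>c j\<close> fits into the
  diagram. This is the source of all uniform bounds on far columns.\<close>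

lemma columns_area:
  assumes "c \<in> columns d"
  shows "Suc j * c j \<le> d"
proof -
  have "Suc j * c j = (\<Sum>i<Suc j. c j)" by simp
  also have "\<dots> \<le> (\<Sum>i<Suc j. c i)" using columns_antimono[OF assms] by (intro sum_mono) auto
  also have "\<dots> \<le> (\<Sum>i<d + Suc j. c i)" by (intro sum_mono2) auto
  finally show ?thesis using columns_sum[OF assms, of "d + Suc j"] by simp
qed

lemma finite_columns: "finite (columns d)"
proof (rule finite_subset)
  have "c j \<le> d" if "c \<in> columns d" for c j
    using columns_area[OF that, of j] by simp
  then show "columns d \<subseteq> {c. \<forall>j. (j \<in> {..<d} \<longrightarrow> c j \<in> {..d}) \<and> (j \<notin> {..<d} \<longrightarrow> c j = 0)}"
    using columns_zero by auto
qed (intro finite_set_of_finite_funs, auto)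

text \<open>Empty columns contribute only empty products. Hence one common \<open>n\<close> can
  serve diagrams with \<open>d\<close> and with \<open>d + 1\<close> boxes.\<close>

lemma hook_prod_extend:
  assumes c: "c \<in> columns d" and "d \<le> n"
  shows "hook_prod \<alpha> n c = hook_prod \<alpha> d c"
  using \<open>d \<le> n\<close>
proof (induction n rule: dec_induct)
  case (step n)
  have z: "c n = 0" "c (Suc n) = 0" using columns_zero[OF c] step by auto
  have "column_hook_prod \<alpha> c (Suc n) j = column_hook_prod \<alpha> c n j" if "j \<le> n" for j
  proof -
    have "{j..<Suc n} = insert n {j..<n}" using that by auto
    then show ?thesis using z by (simp add: column_hook_prod_def)
  qed
  moreover have "column_hook_prod \<alpha> c n n = 1" by (simp add: column_hook_prod_def)
  ultimately show ?case using step.IH by (simp add: hook_prod_def)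
qed simp

section \<open>The transition and cotransition measures of a single diagram\<close>

locale column_shape =
  fixes \<alpha> :: real and n :: nat and c :: "nat \<Rightarrow> nat"
  assumes alpha: "\<alpha> > 0" and anti: "\<And>j. c (Suc j) \<le> c j"
begin

abbreviation "x \<equiv> content \<alpha> c"

lemma antimono: "i \<le> j \<Longrightarrow> c j \<le> c i"
  using lift_Suc_antimono_le[of c, OF anti] by blast

lemma content_gap: "i < j \<Longrightarrow> x i + \<alpha> \<le> x j"
proof -
  assume ij: "i < j"
  have "\<alpha> * (real i + 1) \<le> \<alpha> * real j" using alpha ij by (intro mult_left_mono) auto
  then show ?thesis using antimono[of i j] ij by (simp add: content_def algebra_simps)
qed

lemma content_less: "i < j \<Longrightarrow> x i < x j"
  using content_gap[of i j] alpha by auto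

lemma inj_content: "inj_on x A"
  by (rule inj_onI) (metis content_less linorder_neqE_nat order_less_irrefl)

lemma inj_content_shift: "inj_on (\<lambda>k. x k + a) A"
  using inj_content[of A] by (auto simp: inj_on_def)

lemma pf_residue_shift: "pf_residue a (\<lambda>k. x k + b) m k = pf_residue a x m k"
  by (simp add: pf_residue_def)

lemma content_le: "x k \<le> \<alpha> * k"
  by (simp add: content_def)

lemma content_less_end: "k < n \<Longrightarrow> x k + \<alpha> \<le> \<alpha> * n"
proof -
  assume "k < n"
  then have "\<alpha> * (real k + 1) \<le> \<alpha> * n" using alpha by (intro mult_left_mono) auto
  then show ?thesis using content_le[of k] by (simp add: algebra_simps)
qed

lemma hook_prod_pos: "hook_prod \<alpha> n c > 0"
  unfolding hook_prod_def column_hook_prod_def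
proof (intro prod_pos mult_pos_pos ballI)
  fix j k i assume "j \<in> {..<n}" "k \<in> {j..<n}" "i \<in> {c (Suc k)..<c k}"
  then have jk: "j \<le> k" and i: "real i + 1 \<le> real (c j)" using antimono[of j k] by auto
  have "\<alpha> * (real k - real j) \<ge> 0" using jk alpha by auto
  then show "0 < \<alpha> * (real k - real j) + (real (c j) - real i)"
    "0 < \<alpha> * (real k - real j) + (real (c j) - real i - 1) + \<alpha>" using i alpha by auto
qed

text \<open>To the left of \<open>k\<close> the gap \<open>\<alpha>\<close> between contents makes
  \<open>1 - \<alpha> / (x k - x j)\<close> nonnegative; to the right the denominator is negative.
  The remaining factor \<open>- \<alpha> / (x k - \<alpha> * n)\<close> is positive.\<close>

lemma up_prob_nonneg:
  assumes "k < n"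
  shows "up_prob \<alpha> n c k \<ge> 0"
proof -
  have "1 + - \<alpha> / (x k - x j) \<ge> 0" if "j \<noteq> k" for j
  proof (cases "j < k")
    case True
    then have "x k - x j \<ge> \<alpha>" using content_gap[of j k] by auto
    then show ?thesis using alpha by (simp add: divide_simps)
  next
    case False
    then have "x k - x j < 0" using content_less[of k j] that by auto
    then show ?thesis using alpha by (simp add: divide_simps)
  qed
  then have "(\<Prod>j\<in>{..<n} - {k}. 1 + - \<alpha> / (x k - x j)) \<ge> 0" by (intro prod_nonneg) auto
  moreover have "x k - \<alpha> * n < 0" using content_less_end[OF assms] alpha by auto
  ultimately show ?thesis unfolding up_prob_def pf_residue_def
    using alpha by (intro divide_nonpos_neg) (auto simp: mult_nonneg_nonneg)
qed

text \<open>Mirror image of the transition case: here the columns to the right need the gap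
  \<open>\<alpha>\<close>, those to the left only the order of the contents.\<close>

lemma down_prob_nonneg:
  assumes "k < n"
  shows "down_prob \<alpha> n c k \<ge> 0"
proof -
  have "1 + \<alpha> / (x k - x j) \<ge> 0" if "j \<noteq> k" for j
  proof (cases "j < k")
    case True
    then have "x k - x j > 0" using content_less[of j k] by auto
    then show ?thesis using alpha by (simp add: divide_simps)
  next
    case False
    then have "x k - x j \<le> - \<alpha>" using content_gap[of k j] that by auto
    then show ?thesis using alpha by (simp add: divide_simps)
  qed
  then have "(\<Prod>j\<in>{..<n} - {k}. 1 + \<alpha> / (x k - x j)) \<ge> 0" by (intro prod_nonneg) auto
  then show ?thesis unfolding down_prob_def pf_residue_def
    using content_less_end[OF assms] alpha
    by (intro divide_nonneg_nonneg mult_nonneg_nonneg) (auto simp: sum_nonneg)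
qed

text \<open>The zeroth and first moments of the residues combine; the terms quadratic in
  \<open>n\<close> cancel and only the number of boxes is left.\<close>

lemma sum_down_raw:
  "(\<Sum>k<n. pf_residue \<alpha> x n k * (\<alpha> * n - x k - \<alpha>)) = \<alpha> * real (\<Sum>j<n. c j)"
proof -
  have "(\<Sum>k<n. pf_residue \<alpha> x n k * (\<alpha> * n - x k - \<alpha>))
    = (\<Sum>k<n. pf_residue \<alpha> x n k) * (\<alpha> * n - \<alpha>) - (\<Sum>k<n. pf_residue \<alpha> x n k * x k)"
    unfolding sum_distrib_right sum_subtractf[symmetric] by (intro sum.cong) (auto simp: algebra_simps)
  also have "\<dots> = \<alpha> * n * (\<alpha> * n - \<alpha>) - (\<alpha> * (\<Sum>k<n. x k) + \<alpha>\<^sup>2 * n * (real n - 1) / 2)"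
    by (simp add: sum_pf_residue[OF inj_content] sum_pf_residue_moment[OF inj_content])
  also have "(\<Sum>k<n. x k) = \<alpha> * (\<Sum>k<n. real k) - real (\<Sum>j<n. c j)"
    by (simp add: content_def sum_subtractf sum_distrib_left)
  also have "(\<Sum>k<n. real k) = real n * (real n - 1) / 2"
    by (induction n) (auto simp: field_simps)
  finally show ?thesis by (simp add: algebra_simps power2_eq_square)
qed

lemma sum_down_prob:
  assumes "(\<Sum>j<n. c j) > 0"
  shows "(\<Sum>k<n. down_prob \<alpha> n c k) = 1"
proof -
  have "\<alpha> * real (\<Sum>j<n. c j) \<noteq> 0" using alpha assms by (simp del: of_nat_sum sum_eq_0_iff)
  then show ?thesis unfolding down_prob_def sum_divide_distrib[symmetric] sum_down_raw by (rule divide_self)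
qed

text \<open>Writing \<open>z - \<alpha> * n\<close> as
  \<open>(z - x k - \<alpha>) - (\<alpha> * n - x k - \<alpha>)\<close> in each partial fraction
  leaves the polynomial part \<open>z\<close>, because the residues sum to
  \<open>\<alpha> * n\<close>.\<close>

lemma Ytrans_down:
  assumes ne: "\<And>k. k < n \<Longrightarrow> z \<noteq> x k + \<alpha>"
  shows "Ytrans \<alpha> n c z = z - \<alpha> * real (\<Sum>j<n. c j) * (\<Sum>k<n. down_prob \<alpha> n c k / (z - (x k + \<alpha>)))"
proof -
  let ?\<rho> = "pf_residue \<alpha> x n"
  have "Ytrans \<alpha> n c z = (z - \<alpha> * n) * (1 + (\<Sum>k<n. ?\<rho> k / (z - (x k + \<alpha>))))"
    unfolding Ytrans_def
    using prod_partial_fractions[OF inj_content_shift, of n z \<alpha>] ne by (simp add: pf_residue_shift)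
  also have "\<dots> = z - \<alpha> * n + (\<Sum>k<n. ?\<rho> k * (z - \<alpha> * n) / (z - (x k + \<alpha>)))"
    by (simp add: distrib_left sum_distrib_left mult.commute)
  also have "(\<Sum>k<n. ?\<rho> k * (z - \<alpha> * n) / (z - (x k + \<alpha>)))
      = (\<Sum>k<n. ?\<rho> k - ?\<rho> k * (\<alpha> * n - x k - \<alpha>) / (z - (x k + \<alpha>)))"
  proof (rule sum.cong)
    fix k assume "k \<in> {..<n}"
    then have "z - (x k + \<alpha>) \<noteq> 0" using ne[of k] by auto
    then show "?\<rho> k * (z - \<alpha> * n) / (z - (x k + \<alpha>)) = ?\<rho> k - ?\<rho> k * (\<alpha> * n - x k - \<alpha>) / (z - (x k + \<alpha>))"
      by (simp add: field_simps)
  qed simp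
  also have "\<dots> = \<alpha> * n - (\<Sum>k<n. ?\<rho> k * (\<alpha> * n - x k - \<alpha>) / (z - (x k + \<alpha>)))"
    by (simp add: sum_subtractf sum_pf_residue[OF inj_content])
  also have "(\<Sum>k<n. ?\<rho> k * (\<alpha> * n - x k - \<alpha>) / (z - (x k + \<alpha>)))
     = \<alpha> * real (\<Sum>j<n. c j) * (\<Sum>k<n. down_prob \<alpha> n c k / (z - (x k + \<alpha>)))"
  \<comment> \<open>For the empty diagram the normalising denominator is 0, so the numerators must
    be seen to vanish directly: two adjacent empty columns kill the product for
    \<open>k < n - 1\<close>, and the last factor is 0 for \<open>k = n - 1\<close>.\<close>
  proof (cases "(\<Sum>j<n. c j) = 0")
    case True
    then have c0: "c k = 0" if "k < n" for k using that by auto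
    have "?\<rho> k * (\<alpha> * n - x k - \<alpha>) = 0" if "k < n" for k
    proof (cases "k = n - 1")
      case True
      then show ?thesis using that c0[OF that] by (simp add: content_def of_nat_diff algebra_simps)
    next
      case False
      then have "Suc k < n" using that by auto
      then have "1 + \<alpha> / (x k - x (Suc k)) = 0"
        using c0[of k] c0[of "Suc k"] that alpha by (simp add: content_def field_simps)
      then have "(\<Prod>j\<in>{..<n} - {k}. 1 + \<alpha> / (x k - x j)) = 0"
        using \<open>Suc k < n\<close> by (auto intro!: prod_zero)
      then show ?thesis by (simp add: pf_residue_def)
    qed
    then have "(\<Sum>k<n. ?\<rho> k * (\<alpha> * n - x k - \<alpha>) / (z - (x k + \<alpha>))) = 0" by (intro sum.neutral) auto
    then show ?thesis using True by simp
  next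
    case False
    then have "\<alpha> * real (\<Sum>j<n. c j) \<noteq> 0" using alpha by (auto simp del: of_nat_sum)
    then show ?thesis unfolding down_prob_def sum_distrib_left by (intro sum.cong) auto
  qed
  finally show ?thesis by simp
qed

text \<open>Since column \<open>n - 1\<close> is empty, its factor vanishes at
  \<open>z = \<alpha> * n\<close>. The partial fraction expansion evaluated at this point is the
  claim.\<close>

lemma sum_up_prob:
  assumes "n > 0" "c (n - 1) = 0"
  shows "(\<Sum>k<n. up_prob \<alpha> n c k) = 1"
proof -
  have "(\<Prod>k<n. 1 + - \<alpha> / (\<alpha> * n - x k)) = 0"
  proof (rule prod_zero)
    have "1 + - \<alpha> / (\<alpha> * n - x (n - 1)) = 0"
      using assms alpha by (simp add: content_def of_nat_diff algebra_simps)
    then show "\<exists>k\<in>{..<n}. 1 + - \<alpha> / (\<alpha> * n - x k) = 0" using assms by (intro bexI[of _ "n - 1"]) auto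
  qed simp
  moreover have "\<alpha> * n \<noteq> x k" if "k < n" for k using content_less_end[OF that] alpha by auto
  ultimately have "1 + (\<Sum>k<n. pf_residue (- \<alpha>) x n k / (\<alpha> * n - x k)) = 0"
    using prod_partial_fractions[OF inj_content, of n "\<alpha> * n" "- \<alpha>"] by metis
  moreover have "pf_residue (- \<alpha>) x n k / (\<alpha> * n - x k) = - up_prob \<alpha> n c k" for k
    unfolding up_prob_def by (metis minus_diff_eq minus_divide_right)
  ultimately show ?thesis by (simp add: sum_negf)
qed

text \<open>Dividing the expansion by \<open>z - \<alpha> * n\<close> creates a pole there, whose
  coefficient is 1 minus the total transition probability and so cancels.\<close>

lemma up_transform:
  assumes "n > 0" "c (n - 1) = 0" and ne: "\<And>k. k < n \<Longrightarrow> z \<noteq> x k" and zn: "z \<noteq> \<alpha> * n"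
  shows "(\<Prod>k<n. 1 + - \<alpha> / (z - x k)) / (z - \<alpha> * n) = (\<Sum>k<n. up_prob \<alpha> n c k / (z - x k))"
proof -
  have "(\<Prod>k<n. 1 + - \<alpha> / (z - x k)) / (z - \<alpha> * n)
     = (1 + (\<Sum>k<n. pf_residue (- \<alpha>) x n k / (z - x k))) / (z - \<alpha> * n)"
    using prod_partial_fractions[OF inj_content, of n z "- \<alpha>"] ne by simp
  also have "\<dots> = 1 / (z - \<alpha> * n) + (\<Sum>k<n. pf_residue (- \<alpha>) x n k / (z - x k) / (z - \<alpha> * n))"
    by (simp add: add_divide_distrib sum_divide_distrib)
  also have "(\<Sum>k<n. pf_residue (- \<alpha>) x n k / (z - x k) / (z - \<alpha> * n))
     = (\<Sum>k<n. up_prob \<alpha> n c k / (z - x k) - up_prob \<alpha> n c k / (z - \<alpha> * n))"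
  proof (rule sum.cong)
    fix k assume k: "k \<in> {..<n}"
    have "z - x k \<noteq> 0" "z - \<alpha> * n \<noteq> 0" "x k - \<alpha> * n \<noteq> 0"
      using ne[of k] zn content_less_end[of k] k alpha by auto
    then show "pf_residue (- \<alpha>) x n k / (z - x k) / (z - \<alpha> * n) =
         up_prob \<alpha> n c k / (z - x k) - up_prob \<alpha> n c k / (z - \<alpha> * n)"
      unfolding up_prob_def by (simp add: divide_simps) (simp add: algebra_simps)
  qed simp
  also have "\<dots> = (\<Sum>k<n. up_prob \<alpha> n c k / (z - x k)) - 1 / (z - \<alpha> * n)"
    using sum_up_prob[OF assms(1,2)] by (simp add: sum_subtractf flip: sum_divide_distrib)
  finally show ?thesis by simp
qed

text \<open>The factors \<open>1 + \<alpha> / (z - (x k + \<alpha>))\<close> and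
  \<open>1 - \<alpha> / (z - x k)\<close> are reciprocal to each other.\<close>

lemma Ytrans_up:
  assumes "n > 0" "c (n - 1) = 0" and ne: "\<And>k. k < n \<Longrightarrow> z \<noteq> x k"
    and ne': "\<And>k. k < n \<Longrightarrow> z \<noteq> x k + \<alpha>"
  shows "Ytrans \<alpha> n c z * (\<Sum>k<n. up_prob \<alpha> n c k / (z - x k)) = 1"
proof -
  have zn: "z \<noteq> \<alpha> * n"
    using assms(1,2) ne'[of "n - 1"] by (auto simp: content_def of_nat_diff algebra_simps)
  have "(1 + \<alpha> / (z - (x k + \<alpha>))) * (1 + - \<alpha> / (z - x k)) = 1" if "k < n" for k
  proof -
    have "z - x k \<noteq> 0" "z - (x k + \<alpha>) \<noteq> 0" using ne ne' that by auto
    then show ?thesis by (simp add: divide_simps)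
  qed
  then have "(\<Prod>k<n. 1 + \<alpha> / (z - (x k + \<alpha>))) * (\<Prod>k<n. 1 + - \<alpha> / (z - x k)) = 1"
    by (simp flip: prod.distrib)
  then have *: "((z - \<alpha> * n) * P) * (Q / (z - \<alpha> * n)) = 1"
    if "P = (\<Prod>k<n. 1 + \<alpha> / (z - (x k + \<alpha>)))" "Q = (\<Prod>k<n. 1 + - \<alpha> / (z - x k))" for P Q
    using zn that by simp
  have t: "(\<Sum>k<n. up_prob \<alpha> n c k / (z - x k)) = (\<Prod>k<n. 1 + - \<alpha> / (z - x k)) / (z - \<alpha> * n)"
    by (rule up_transform[OF assms(1-3) zn, symmetric])
  show ?thesis unfolding Ytrans_def t by (rule *[OF refl refl])
qed

text \<open>The factor of column \<open>k\<close> vanishes at \<open>x k\<close>. Combined with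
  \<open>Ytrans_down\<close> this is a linear relation between the cotransition probabilities, which
  is what later controls single weights.\<close>

lemma Ytrans_zero:
  assumes "k < n" "\<And>j. j < n \<Longrightarrow> x k \<noteq> x j + \<alpha>"
  shows "Ytrans \<alpha> n c (x k) = 0"
proof -
  have "1 + \<alpha> / (x k - (x k + \<alpha>)) = 0" using alpha by simp
  then have "(\<Prod>j<n. 1 + \<alpha> / (x k - (x j + \<alpha>))) = 0" using assms(1)
    by (intro prod_zero) blast+
  then show ?thesis by (simp add: Ytrans_def)
qed

text \<open>No box fits on a column as long as its left neighbour; the contents then differ by
  exactly \<open>\<alpha>\<close>, so one factor is 0.\<close>

lemma up_prob_zero:
  assumes "0 < k" "k < n" "c (k - 1) = c k"
  shows "up_prob \<alpha> n c k = 0"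
proof -
  have "1 + - \<alpha> / (x k - x (k - 1)) = 0"
    using assms alpha by (simp add: content_def of_nat_diff algebra_simps)
  then have "(\<Prod>j\<in>{..<n} - {k}. 1 + - \<alpha> / (x k - x j)) = 0"
    using assms by (intro prod_zero) (auto intro!: bexI[of _ "k - 1"])
  then show ?thesis by (simp add: up_prob_def pf_residue_def)
qed

text \<open>No box can be taken from a column as long as its right neighbour. The last column has no
  neighbour in the product; there the extra factor \<open>\<alpha> * n - x k - \<alpha>\<close>
  takes over.\<close>

lemma down_prob_zero:
  assumes "k < n" "c n = 0" "c (Suc k) = c k"
  shows "down_prob \<alpha> n c k = 0"
proof (cases "Suc k = n")
  case True
  then have "\<alpha> * n - x k - \<alpha> = 0" using assms by (auto simp: content_def algebra_simps)
  then show ?thesis by (simp add: down_prob_def)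
next
  case False
  then have "Suc k < n" using assms by auto
  have "1 + \<alpha> / (x k - x (Suc k)) = 0"
    using assms alpha by (simp add: content_def field_simps)
  then have "(\<Prod>j\<in>{..<n} - {k}. 1 + \<alpha> / (x k - x j)) = 0"
    using \<open>Suc k < n\<close> by (intro prod_zero) (auto intro!: bexI[of _ "Suc k"])
  then show ?thesis by (simp add: down_prob_def pf_residue_def)
qed

end

section \<open>The change of the hook product under adding one box\<close>

lemma prod_telescope_shift:
  fixes B :: real
  assumes "a \<le> b"
  shows "(\<Prod>i\<in>{a..<b}. B + 1 - real i) * (B + 1 - real b) = (\<Prod>i\<in>{a..<b}. B - real i) * (B + 1 - real a)"
  using assms
proof (induction b rule: dec_induct)
  case (step m)
  have "(\<Prod>i\<in>{a..<Suc m}. B + 1 - real i) * (B + 1 - real (Suc m))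
      = ((\<Prod>i\<in>{a..<m}. B + 1 - real i) * (B + 1 - real m)) * (B - real m)"
    using step by simp
  also have "\<dots> = (\<Prod>i\<in>{a..<Suc m}. B - real i) * (B + 1 - real a)"
    unfolding step.IH using step by simp
  finally show ?case .
qed simp

text \<open>Adding a box to column \<open>m\<close> multiplies the hook product by the factors \<open>box_ratio \<alpha> (x m - x j)\<close>
  of the other columns, up to a boundary term.\<close>

definition box_ratio :: "real \<Rightarrow> real \<Rightarrow> real" where
  "box_ratio \<alpha> D = (D - 1 + \<alpha>) * D / ((D - 1) * (D - \<alpha>))"

context column_shape
begin

context
  fixes m :: nat
  assumes mn: "m < n" and cn: "c n = 0" and addable: "m = 0 \<or> c m < c (m - 1)"
begin

abbreviation "c' \<equiv> c(m := Suc (c m))"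

lemma addable_gap: "j < m \<Longrightarrow> x m - x j \<ge> \<alpha> + 1"
proof -
  assume jm: "j < m"
  have "\<alpha> * (real j + 1) \<le> \<alpha> * real m" using alpha jm by (intro mult_left_mono) auto
  moreover have "c m < c j" using antimono[of j "m - 1"] addable jm by fastforce
  ultimately show "x m - x j \<ge> \<alpha> + 1" by (simp add: content_def algebra_simps)
qed

lemma column_hook_prod_right: "m < j \<Longrightarrow> column_hook_prod \<alpha> c' n j = column_hook_prod \<alpha> c n j"
  unfolding column_hook_prod_def by (intro prod.cong) auto

text \<open>In column \<open>j\<close> only the box in row \<open>c m\<close> is affected. Its arm
  grows by one, which moves it from the group \<open>k = m - 1\<close> to the group
  \<open>k = m\<close>; \<open>box_ratio\<close> is the quotient of its two factors.\<close>

lemma column_hook_prod_left: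
  assumes jm: "j < m"
  shows "column_hook_prod \<alpha> c' n j = column_hook_prod \<alpha> c n j * box_ratio \<alpha> (x m - x j)"
proof -
  define h where "h k i = (\<alpha> * (real k - real j) + (real (c j) - real i)) *
     (\<alpha> * (real k - real j) + (real (c j) - real i - 1) + \<alpha>)" for k i :: nat
  define D where "D = x m - x j"
  have D: "D \<ge> \<alpha> + 1" unfolding D_def by (rule addable_gap[OF jm])
  have cm: "c m < c (m - 1)" using addable jm by auto
  have split: "{j..<n} = {j..<m - 1} \<union> {m - 1, m} \<union> {m<..<n}" using jm mn by auto
  have prodsplit: "(\<Prod>k\<in>{j..<n}. f k) = (\<Prod>k\<in>{j..<m - 1}. f k) * (f (m - 1) * f m) * (\<Prod>k\<in>{m<..<n}. f k)"
    for f :: "nat \<Rightarrow> real"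
    unfolding split using jm by (subst prod.union_disjoint, simp, simp, force)+ simp
  have "column_hook_prod \<alpha> c' n j = (\<Prod>k\<in>{j..<n}. \<Prod>i\<in>{c' (Suc k)..<c' k}. h k i)"
    unfolding column_hook_prod_def h_def using jm by simp
  also have "\<dots> = (\<Prod>k\<in>{j..<m - 1}. \<Prod>i\<in>{c (Suc k)..<c k}. h k i) *
      ((\<Prod>i\<in>{Suc (c m)..<c (m - 1)}. h (m - 1) i) * (\<Prod>i\<in>{c (Suc m)..<Suc (c m)}. h m i)) *
      (\<Prod>k\<in>{m<..<n}. \<Prod>i\<in>{c (Suc k)..<c k}. h k i)"
    unfolding prodsplit using jm by (intro arg_cong2[of _ _ _ _ "(*)"] prod.cong) auto
  finally have new: "column_hook_prod \<alpha> c' n j = \<dots>" .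
  have old: "column_hook_prod \<alpha> c n j = (\<Prod>k\<in>{j..<m - 1}. \<Prod>i\<in>{c (Suc k)..<c k}. h k i) *
      ((\<Prod>i\<in>{c m..<c (m - 1)}. h (m - 1) i) * (\<Prod>i\<in>{c (Suc m)..<c m}. h m i)) *
      (\<Prod>k\<in>{m<..<n}. \<Prod>i\<in>{c (Suc k)..<c k}. h k i)"
    unfolding column_hook_prod_def h_def[symmetric] prodsplit using jm by simp
  have A: "(\<Prod>i\<in>{c m..<c (m - 1)}. h (m - 1) i) = h (m - 1) (c m) * (\<Prod>i\<in>{Suc (c m)..<c (m - 1)}. h (m - 1) i)"
    using cm by (rule prod.atLeast_Suc_lessThan)
  have B: "(\<Prod>i\<in>{c (Suc m)..<Suc (c m)}. h m i) = (\<Prod>i\<in>{c (Suc m)..<c m}. h m i) * h m (c m)"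
    using anti[of m] by simp
  have h1: "h (m - 1) (c m) = (D - \<alpha>) * (D - 1)"
    using jm by (simp add: h_def D_def content_def of_nat_diff algebra_simps)
  have h2: "h m (c m) = D * (D - 1 + \<alpha>)"
    using jm by (simp add: h_def D_def content_def algebra_simps)
  have r: "D * (D - 1 + \<alpha>) = (D - \<alpha>) * (D - 1) * box_ratio \<alpha> D"
    using D alpha by (simp add: box_ratio_def)
  show ?thesis unfolding new old D_def[symmetric] A B h1 h2 r by (simp only: mult_ac)
qed

text \<open>In column \<open>m\<close> every leg grows by one. Within a group of constant arm length
  the change telescopes to its two ends, and the ends of neighbouring groups combine to a
  \<open>box_ratio\<close>. Truncating the column at \<open>N\<close> keeps exactly one open end,
  which makes the induction possible.\<close>

lemma column_hook_prod_self_upto: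
  assumes "Suc m \<le> N"
  shows "column_hook_prod \<alpha> c' N m = column_hook_prod \<alpha> c N m *
    (\<Prod>k\<in>{m<..<N}. box_ratio \<alpha> (x m - x k)) * ((x N - x m) * (x N - x m - \<alpha> + 1))"
  using assms
proof (induction N rule: dec_induct)
  case base
  let ?a = "c (Suc m)" and ?b = "c m"
  have ab: "?a \<le> ?b" by (rule anti)
  have one: "{m..<Suc m} = {m}" by auto
  have "column_hook_prod \<alpha> c' (Suc m) m
    = (\<Prod>i\<in>{?a..<Suc ?b}. real ?b + 1 - real i) * (\<Prod>i\<in>{?a..<Suc ?b}. (real ?b + \<alpha> - 1) + 1 - real i)"
    unfolding column_hook_prod_def prod.distrib[symmetric] one
    by (auto intro!: prod.cong) (simp add: algebra_simps)
  also have "\<dots> = (\<Prod>i\<in>{?a..<?b}. real ?b - real i) * (real ?b + 1 - real ?a) *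
      ((\<Prod>i\<in>{?a..<?b}. (real ?b + \<alpha> - 1) - real i) * ((real ?b + \<alpha> - 1) + 1 - real ?a))"
    unfolding prod_telescope_shift[OF ab, symmetric] using ab by simp
  also have "\<dots> = column_hook_prod \<alpha> c (Suc m) m * ((x (Suc m) - x m) * (x (Suc m) - x m - \<alpha> + 1))"
  proof -
    have "column_hook_prod \<alpha> c (Suc m) m
      = (\<Prod>i\<in>{?a..<?b}. real ?b - real i) * (\<Prod>i\<in>{?a..<?b}. (real ?b + \<alpha> - 1) - real i)"
      unfolding column_hook_prod_def prod.distrib[symmetric] one by (auto intro!: prod.cong)
    moreover have "real ?b + 1 - real ?a = x (Suc m) - x m - \<alpha> + 1"
      "(real ?b + \<alpha> - 1) + 1 - real ?a = x (Suc m) - x m" by (auto simp: content_def algebra_simps)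
    ultimately show ?thesis by (simp only: mult_ac)
  qed
  finally have *: "column_hook_prod \<alpha> c' (Suc m) m =
      column_hook_prod \<alpha> c (Suc m) m * ((x (Suc m) - x m) * (x (Suc m) - x m - \<alpha> + 1))" .
  have "{m<..<Suc m} = {}" by auto
  then show ?case unfolding * by (simp only: prod.empty mult_1_right)
next
  case (step N)
  let ?a = "c (Suc N)" and ?b = "c N"
  define B where "B = \<alpha> * (real N - real m) + real (c m)"
  define E where "E = x N - x m"
  have E: "E \<ge> \<alpha>" using content_gap[of m N] step by (auto simp: E_def)
  have ab: "?a \<le> ?b" by (rule anti)
  have EB: "E + 1 = B + 1 - real ?b" "E + \<alpha> = (B + \<alpha> - 1) + 1 - real ?b"
    "x (Suc N) - x m - \<alpha> + 1 = B + 1 - real ?a" "x (Suc N) - x m = (B + \<alpha> - 1) + 1 - real ?a"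
    by (simp_all add: E_def B_def content_def algebra_simps)
  define P where "P = (\<Prod>i\<in>{?a..<?b}. B - real i) * (\<Prod>i\<in>{?a..<?b}. (B + \<alpha> - 1) - real i)"
  define P' where "P' = (\<Prod>i\<in>{?a..<?b}. B + 1 - real i) * (\<Prod>i\<in>{?a..<?b}. (B + \<alpha> - 1) + 1 - real i)"
  have ins: "{m..<Suc N} = insert N {m..<N}" using step by auto
  have new: "column_hook_prod \<alpha> c' (Suc N) m = P' * column_hook_prod \<alpha> c' N m"
    unfolding column_hook_prod_def ins P'_def B_def using step
    by (simp add: prod.distrib[symmetric] algebra_simps)
  have old: "column_hook_prod \<alpha> c (Suc N) m = P * column_hook_prod \<alpha> c N m"
    unfolding column_hook_prod_def ins P_def B_def using step
    by (simp add: prod.distrib[symmetric] algebra_simps)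
  have tel: "P' * ((E + 1) * (E + \<alpha>)) = P * ((x (Suc N) - x m) * (x (Suc N) - x m - \<alpha> + 1))"
  proof -
    have *: "a * u = b * v \<Longrightarrow> a' * u' = b' * v' \<Longrightarrow> (a * a') * (u * u') = (b * b') * (v' * v)"
      for a a' b b' u u' v v' :: real
      by (simp only: mult_ac) (metis mult.assoc mult.left_commute)
    show ?thesis unfolding P_def P'_def EB(3) unfolding EB(1,2,4)
      by (rule *[OF prod_telescope_shift[OF ab, of B] prod_telescope_shift[OF ab, of "B + \<alpha> - 1"]])
  qed
  have ins2: "{m<..<Suc N} = insert N {m<..<N}" using step by auto
  \<comment> \<open>This trades the open end at \<open>N\<close> for a \<open>box_ratio\<close> and
    the end term that the group \<open>k = N\<close> telescopes against. The argument
    \<open>- E\<close> is negative because column \<open>N\<close> lies to the right of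
    \<open>m\<close>.\<close>
  have br: "box_ratio \<alpha> (x m - x N) * ((E + 1) * (E + \<alpha>)) = E * (E - \<alpha> + 1)"
  proof -
    have xm: "x m - x N = - E" by (simp add: E_def)
    have "(- E - 1) * (- E - \<alpha>) = (E + 1) * (E + \<alpha>)" "(- E - 1 + \<alpha>) * - E = E * (E - \<alpha> + 1)"
      by (simp_all add: algebra_simps)
    moreover have "(E + 1) * (E + \<alpha>) \<noteq> 0" using E alpha by auto
    ultimately show ?thesis unfolding xm box_ratio_def by simp
  qed
  have nz: "(E + 1) * (E + \<alpha>) \<noteq> 0" using E alpha by auto
  define C where "C = column_hook_prod \<alpha> c N m"
  define R where "R = (\<Prod>k\<in>{m<..<N}. box_ratio \<alpha> (x m - x k))"
  define F where "F = (x (Suc N) - x m) * (x (Suc N) - x m - \<alpha> + 1)"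
  have IH: "column_hook_prod \<alpha> c' N m = C * R * (E * (E - \<alpha> + 1))"
    unfolding C_def R_def E_def by (rule step.IH)
  define Z where "Z = box_ratio \<alpha> (x m - x N)"
  have "P' * (C * R * (E * (E - \<alpha> + 1))) = P' * ((E + 1) * (E + \<alpha>)) * (C * R * Z)"
    unfolding br[symmetric] Z_def[symmetric] by (simp only: mult_ac)
  also have "\<dots> = (P * C) * (Z * R) * F"
    unfolding tel F_def[symmetric] by (simp only: mult_ac)
  finally have "P' * (C * R * (E * (E - \<alpha> + 1))) = (P * C) * (box_ratio \<alpha> (x m - x N) * R) * F"
    unfolding Z_def .
  moreover have "(\<Prod>k\<in>insert N {m<..<N}. box_ratio \<alpha> (x m - x k)) = box_ratio \<alpha> (x m - x N) * R"
    by (simp add: R_def)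
  ultimately show ?case unfolding new old IH C_def[symmetric] F_def[symmetric] ins2 by metis
qed

lemma hook_prod_add_box:
  "hook_prod \<alpha> n c' = hook_prod \<alpha> n c * (\<Prod>j\<in>{..<n} - {m}. box_ratio \<alpha> (x m - x j)) *
     ((\<alpha> * n - x m) * (\<alpha> * n - x m - \<alpha> + 1))"
proof -
  have split: "{..<n} - {m} = {..<m} \<union> {m<..<n}" "{..<n} = insert m ({..<m} \<union> {m<..<n})" using mn by auto
  have dis: "{..<m} \<inter> {m<..<n} = {}" by auto
  have xn: "x n = \<alpha> * n" using cn by (simp add: content_def)
  have ps: "(\<Prod>j<n. f j) = f m * ((\<Prod>j<m. f j) * (\<Prod>j\<in>{m<..<n}. f j))"
    "(\<Prod>j\<in>{..<n} - {m}. f j) = (\<Prod>j<m. f j) * (\<Prod>j\<in>{m<..<n}. f j)" for f :: "nat \<Rightarrow> real"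
    unfolding split using dis by (simp_all add: prod.union_disjoint)
  have l: "(\<Prod>j<m. column_hook_prod \<alpha> c' n j) =
      (\<Prod>j<m. column_hook_prod \<alpha> c n j) * (\<Prod>j<m. box_ratio \<alpha> (x m - x j))"
    unfolding prod.distrib[symmetric] by (intro prod.cong) (auto intro: column_hook_prod_left)
  have r: "(\<Prod>j\<in>{m<..<n}. column_hook_prod \<alpha> c' n j) = (\<Prod>j\<in>{m<..<n}. column_hook_prod \<alpha> c n j)"
    by (intro prod.cong) (auto intro: column_hook_prod_right)
  show ?thesis
    unfolding hook_prod_def ps l r column_hook_prod_self_upto[of n, OF Suc_leI[OF mn]] xn
    by (simp only: mult_ac)
qed

lemma content_add_box: "content \<alpha> c' = x(m := x m - 1)"
  by (auto simp: content_def fun_eq_iff)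

lemma sum_add_box: "(\<Sum>j<n. c' j) = Suc (\<Sum>j<n. c j)"
proof -
  have "(\<Sum>j<n. f j) = f m + (\<Sum>j\<in>{..<n} - {m}. f j)" for f :: "nat \<Rightarrow> nat"
    using sum.remove[of "{..<n}" m f] mn by simp
  then show ?thesis by simp
qed

text \<open>With \<open>D = x m - x j\<close>, removal from the larger diagram has the factor
  \<open>1 + \<alpha> / (D - 1)\<close>, addition to the smaller one
  \<open>1 - \<alpha> / D\<close>, and their quotient is precisely
  \<open>box_ratio \<alpha> D\<close>. So the residues change in the same proportion as the hook
  product, and the end terms at \<open>n\<close> match.\<close>

lemma detailed_balance_raw:
  "hook_prod \<alpha> n c' * up_prob \<alpha> n c m =
     hook_prod \<alpha> n c * (\<alpha> * real (\<Sum>j<n. c' j) * down_prob \<alpha> n c' m)"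
proof -
  define R where "R = (\<Prod>j\<in>{..<n} - {m}. box_ratio \<alpha> (x m - x j))"
  define Q where "Q = (\<Prod>j\<in>{..<n} - {m}. 1 + - \<alpha> / (x m - x j))"
  define E where "E = \<alpha> * n - x m"
  have E: "E \<noteq> 0" using content_less_end[OF mn] alpha by (auto simp: E_def)
  have "1 + \<alpha> / (content \<alpha> c' m - content \<alpha> c' j) = (1 + - \<alpha> / (x m - x j)) * box_ratio \<alpha> (x m - x j)"
    if "j \<in> {..<n} - {m}" for j
  proof -
    define D where "D = x m - x j"
    \<comment> \<open>To the left addability gives \<open>D \<ge> \<alpha> + 1\<close>, to the right
      \<open>D < 0\<close>; so no denominator vanishes.\<close>
    have "D \<noteq> 0 \<and> D \<noteq> 1 \<and> D \<noteq> \<alpha>"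
    proof (cases "j < m")
      case True
      then show ?thesis using addable_gap[of j] alpha by (auto simp: D_def)
    next
      case False
      then have "D < 0" using that content_less[of m j] by (auto simp: D_def)
      then show ?thesis using alpha by auto
    qed
    moreover have "content \<alpha> c' m - content \<alpha> c' j = D - 1"
      using that unfolding content_add_box D_def by auto
    ultimately show ?thesis unfolding D_def[symmetric] box_ratio_def by (simp add: divide_simps)
  qed
  then have "(\<Prod>j\<in>{..<n} - {m}. 1 + \<alpha> / (content \<alpha> c' m - content \<alpha> c' j)) = Q * R"
    unfolding Q_def R_def prod.distrib[symmetric] by (intro prod.cong) auto
  then have pf: "pf_residue \<alpha> (content \<alpha> c') n m = \<alpha> * (Q * R)" by (simp add: pf_residue_def)
  have "content \<alpha> c' m = x m - 1" by (simp add: content_add_box)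
  then have e: "\<alpha> * n - content \<alpha> c' m - \<alpha> = E - \<alpha> + 1" by (simp add: E_def)
  have "\<alpha> * real (\<Sum>j<n. c' j) \<noteq> 0" unfolding sum_add_box using alpha by (simp del: of_nat_sum)
  then have down: "\<alpha> * real (\<Sum>j<n. c' j) * down_prob \<alpha> n c' m = \<alpha> * (Q * R) * (E - \<alpha> + 1)"
    unfolding down_prob_def pf e by simp
  have "x m - \<alpha> * n = - E" by (simp add: E_def)
  then have up: "up_prob \<alpha> n c m = \<alpha> * Q / E" unfolding up_prob_def pf_residue_def Q_def by simp
  show ?thesis unfolding down up hook_prod_add_box R_def[symmetric] E_def[symmetric] using E by simp
qed

end

end

section \<open>Concentration\<close>

text \<open>Any bound \<open>n\<close> on the support may be used; the area estimate then moves it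
  down to \<open>d\<close>.\<close>

lemma columnsI:
  assumes "\<And>j. c (Suc j) \<le> c j" "\<And>j. n \<le> j \<Longrightarrow> c j = 0" "(\<Sum>j<n. c j) = d"
  shows "c \<in> columns d"
proof -
  have mono: "i \<le> j \<Longrightarrow> c j \<le> c i" for i j
    using lift_Suc_antimono_le[of c, OF assms(1)] by blast
  have z: "c j = 0" if "d \<le> j" for j
  proof -
    have "Suc j * c j = (\<Sum>i<Suc j. c j)" by simp
    also have "\<dots> \<le> (\<Sum>i<Suc j. c i)" using mono by (intro sum_mono) auto
    also have "\<dots> \<le> (\<Sum>i<n + Suc j. c i)" by (intro sum_mono2) auto
    also have "\<dots> = (\<Sum>i<n. c i)" using assms(2) by (intro sum.mono_neutral_right) auto
    finally have "Suc j * c j \<le> d" using assms(3) by simp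
    then show ?thesis using that by (cases "c j") auto
  qed
  have "(\<Sum>j<d. c j) = (\<Sum>j<n + d. c j)" using z by (intro sum.mono_neutral_left) auto
  also have "\<dots> = (\<Sum>j<n. c j)" using assms(2) by (intro sum.mono_neutral_right) auto
  finally show ?thesis using assms z by (auto simp: columns_def)
qed

lemma columns_column_shape: "c \<in> columns d \<Longrightarrow> \<alpha> > 0 \<Longrightarrow> column_shape \<alpha> c"
  by unfold_locales (auto simp: columns_def)

lemma columns_add_box:
  assumes c: "c \<in> columns d" and m: "m = 0 \<or> c m < c (m - 1)"
  shows "c(m := Suc (c m)) \<in> columns (Suc d)"
proof (rule columnsI[where n = "d + m + 1"])
  show "(c(m := Suc (c m))) (Suc j) \<le> (c(m := Suc (c m))) j" for j
    using c m by (auto simp: columns_def le_Suc_eq)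
  show "(c(m := Suc (c m))) j = 0" if "d + m + 1 \<le> j" for j
    using that columns_zero[OF c] by auto
  have "(\<Sum>j<d + m + 1. f j) = f m + (\<Sum>j\<in>{..<d + m + 1} - {m}. f j)" for f :: "nat \<Rightarrow> nat"
    by (rule sum.remove) auto
  then have "(\<Sum>j<d + m + 1. (c(m := Suc (c m))) j) = Suc (\<Sum>j<d + m + 1. c j)"
    by (simp del: sum.lessThan_Suc)
  then show "(\<Sum>j<d + m + 1. (c(m := Suc (c m))) j) = Suc d"
    using columns_sum[OF c, of "d + m + 1"] by simp
qed

lemma columns_remove_box:
  assumes c: "c \<in> columns (Suc d)" and m: "c (Suc m) < c m"
  shows "c(m := c m - 1) \<in> columns d"
proof (rule columnsI[where n = "Suc d + m + 1"])
  show "(c(m := c m - 1)) (Suc j) \<le> (c(m := c m - 1)) j" for j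
  proof -
    have "c (Suc j) \<le> c j" using c by (auto simp: columns_def)
    then show ?thesis using m by auto
  qed
  show "(c(m := c m - 1)) j = 0" if "Suc d + m + 1 \<le> j" for j
    using that columns_zero[OF c] by auto
  have "(\<Sum>j<Suc d + m + 1. f j) = f m + (\<Sum>j\<in>{..<Suc d + m + 1} - {m}. f j)" for f :: "nat \<Rightarrow> nat"
    by (rule sum.remove) auto
  then have "Suc (\<Sum>j<Suc d + m + 1. (c(m := c m - 1)) j) = (\<Sum>j<Suc d + m + 1. c j)"
    using m by (simp del: sum.lessThan_Suc)
  then show "(\<Sum>j<Suc d + m + 1. (c(m := c m - 1)) j) = d"
    using columns_sum[OF c, of "Suc d + m + 1"] by simp
qed

text \<open>The factor \<open>\<alpha> * (d + 1)\<close> by which \<open>down_prob\<close> is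
  normalised equals the quotient of the numerators of the two weights.\<close>

lemma detailed_balance:
  assumes "\<alpha> > 0" and c: "c \<in> columns d" and m: "m = 0 \<or> c m < c (m - 1)" "m < n" and n: "Suc d \<le> n"
  shows "col_weight \<alpha> d c * up_prob \<alpha> n c m =
    col_weight \<alpha> (Suc d) (c(m := Suc (c m))) * down_prob \<alpha> n (c(m := Suc (c m))) m"
proof -
  interpret column_shape \<alpha> n c using columns_column_shape[OF c \<open>\<alpha> > 0\<close>] .
  let ?c = "c(m := Suc (c m))"
  have c': "?c \<in> columns (Suc d)" using columns_add_box[OF c m(1)] .
  interpret c': column_shape \<alpha> n ?c using columns_column_shape[OF c' \<open>\<alpha> > 0\<close>] .
  have cn: "c n = 0" using columns_zero[OF c] n by auto
  have bal: "hook_prod \<alpha> n ?c * up_prob \<alpha> n c m = hook_prod \<alpha> n c * (\<alpha> * real (Suc d) * down_prob \<alpha> n ?c m)"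
    using detailed_balance_raw[OF m(2) cn m(1)] columns_sum[OF c' n] by (simp del: of_nat_sum)
  have eq: "hook_prod \<alpha> d c = hook_prod \<alpha> n c" "hook_prod \<alpha> (Suc d) ?c = hook_prod \<alpha> n ?c"
    using hook_prod_extend[OF c, of n] hook_prod_extend[OF c' n] n by auto
  show ?thesis unfolding col_weight_def eq
    using bal hook_prod_pos c'.hook_prod_pos by (simp add: field_simps)
qed

text \<open>Both sides sum over pairs of a diagram and the same diagram with one more box, with
  equal weights by detailed balance. The choice \<open>n = d + 2\<close> leaves an empty last column
  in diagrams of either size.\<close>

lemma exchange:
  fixes f :: "(nat \<Rightarrow> nat) \<Rightarrow> (nat \<Rightarrow> nat) \<Rightarrow> nat \<Rightarrow> real"
  assumes alpha: "\<alpha> > 0" and n: "n = d + 2"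
  shows "(\<Sum>c\<in>columns d. col_weight \<alpha> d c * (\<Sum>k<n. up_prob \<alpha> n c k * f c (c(k := Suc (c k))) k))
    = (\<Sum>c\<in>columns (Suc d). col_weight \<alpha> (Suc d) c * (\<Sum>k<n. down_prob \<alpha> n c k * f (c(k := c k - 1)) c k))"
proof -
  \<comment> \<open>\<open>A\<close> and \<open>B\<close> drop the pairs of probability 0, where the
    modified function need not be a diagram; on the rest, adding and removing the box are inverse
    bijections.\<close>
  define A where "A = {(c, k). c \<in> columns d \<and> k < n \<and> (k = 0 \<or> c k < c (k - 1))}"
  define B where "B = {(c, k). c \<in> columns (Suc d) \<and> k < n \<and> c (Suc k) < c k}"
  have "(\<Sum>c\<in>columns d. col_weight \<alpha> d c * (\<Sum>k<n. up_prob \<alpha> n c k * f c (c(k := Suc (c k))) k))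
    = (\<Sum>(c, k)\<in>columns d \<times> {..<n}. col_weight \<alpha> d c * up_prob \<alpha> n c k * f c (c(k := Suc (c k))) k)"
    by (simp add: sum_distrib_left sum.cartesian_product mult.assoc)
  also have "\<dots> = (\<Sum>(c, k)\<in>A. col_weight \<alpha> d c * up_prob \<alpha> n c k * f c (c(k := Suc (c k))) k)"
  proof (rule sum.mono_neutral_right)
    show "\<forall>ck\<in>columns d \<times> {..<n} - A. (case ck of (c, k) \<Rightarrow> col_weight \<alpha> d c * up_prob \<alpha> n c k * f c (c(k := Suc (c k))) k) = 0"
    proof (rule ballI)
      fix ck assume "ck \<in> columns d \<times> {..<n} - A"
      then obtain c k where c: "c \<in> columns d" and k: "k \<in> {..<n}" and nA: "(c, k) \<notin> A" and ck: "ck = (c, k)" by blast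
      interpret column_shape \<alpha> n c using columns_column_shape[OF c alpha] .
      have "0 < k" "c (k - 1) \<le> c k" using c k nA by (auto simp: A_def)
      then have "up_prob \<alpha> n c k = 0" using antimono[of "k - 1" k] k by (intro up_prob_zero) auto
      then show "(case ck of (c, k) \<Rightarrow> col_weight \<alpha> d c * up_prob \<alpha> n c k * f c (c(k := Suc (c k))) k) = 0"
        by (simp add: ck)
    qed
  qed (auto simp: A_def finite_columns)
  also have "\<dots> = (\<Sum>(c, k)\<in>B. col_weight \<alpha> (Suc d) c * down_prob \<alpha> n c k * f (c(k := c k - 1)) c k)"
  proof (rule sum.reindex_bij_witness[where j = "\<lambda>(c, k). (c(k := Suc (c k)), k)" and i = "\<lambda>(c, k). (c(k := c k - 1), k)"])
    fix a assume a: "a \<in> A"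
    obtain c k where ck: "a = (c, k)" by force
    have c: "c \<in> columns d" "k < n" "k = 0 \<or> c k < c (k - 1)" using a by (auto simp: ck A_def)
    have "c (Suc k) \<le> c k" using c by (auto simp: columns_def)
    then show "(case a of (c, k) \<Rightarrow> (c(k := Suc (c k)), k)) \<in> B"
      using columns_add_box[OF c(1,3)] c by (auto simp: ck B_def)
    show "(case case a of (c, k) \<Rightarrow> (c(k := Suc (c k)), k) of (c, k) \<Rightarrow> (c(k := c k - 1), k)) = a"
      by (simp add: ck)
    show "(case case a of (c, k) \<Rightarrow> (c(k := Suc (c k)), k) of (c, k) \<Rightarrow> col_weight \<alpha> (Suc d) c * down_prob \<alpha> n c k * f (c(k := c k - 1)) c k)
      = (case a of (c, k) \<Rightarrow> col_weight \<alpha> d c * up_prob \<alpha> n c k * f c (c(k := Suc (c k))) k)"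
      using detailed_balance[OF alpha c(1,3,2)] n by (simp add: ck)
  next
    fix b assume b: "b \<in> B"
    obtain c k where ck: "b = (c, k)" by force
    have c: "c \<in> columns (Suc d)" "k < n" "c (Suc k) < c k" using b by (auto simp: ck B_def)
    have "k > 0 \<Longrightarrow> c k \<le> c (k - 1)" using columns_antimono[OF c(1), of "k - 1" k] by auto
    then show "(case b of (c, k) \<Rightarrow> (c(k := c k - 1), k)) \<in> A"
      using columns_remove_box[OF c(1,3)] c by (fastforce simp: ck A_def)
    show "(case case b of (c, k) \<Rightarrow> (c(k := c k - 1), k) of (c, k) \<Rightarrow> (c(k := Suc (c k)), k)) = b"
      using c(3) by (simp add: ck)
  qed
  also have "\<dots> = (\<Sum>(c, k)\<in>columns (Suc d) \<times> {..<n}. col_weight \<alpha> (Suc d) c * down_prob \<alpha> n c k * f (c(k := c k - 1)) c k)"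
  proof (rule sum.mono_neutral_left)
    show "\<forall>ck\<in>columns (Suc d) \<times> {..<n} - B. (case ck of (c, k) \<Rightarrow> col_weight \<alpha> (Suc d) c * down_prob \<alpha> n c k * f (c(k := c k - 1)) c k) = 0"
    proof (rule ballI)
      fix ck assume "ck \<in> columns (Suc d) \<times> {..<n} - B"
      then obtain c k where c: "c \<in> columns (Suc d)" and k: "k \<in> {..<n}" and nB: "(c, k) \<notin> B" and ck: "ck = (c, k)" by blast
      interpret column_shape \<alpha> n c using columns_column_shape[OF c alpha] .
      have "c k \<le> c (Suc k)" using c k nB by (auto simp: B_def)
      then have "down_prob \<alpha> n c k = 0"
        using anti[of k] k columns_zero[OF c, of n] n by (intro down_prob_zero) auto
      then show "(case ck of (c, k) \<Rightarrow> col_weight \<alpha> (Suc d) c * down_prob \<alpha> n c k * f (c(k := c k - 1)) c k) = 0"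
        by (simp add: ck)
    qed
  qed (auto simp: B_def finite_columns)
  also have "\<dots> = (\<Sum>c\<in>columns (Suc d). col_weight \<alpha> (Suc d) c * (\<Sum>k<n. down_prob \<alpha> n c k * f (c(k := c k - 1)) c k))"
    by (simp add: sum_distrib_left sum.cartesian_product mult.assoc)
  finally show ?thesis .
qed

lemma col_weight_nonneg:
  assumes "\<alpha> > 0" "c \<in> columns d"
  shows "col_weight \<alpha> d c \<ge> 0"
  using column_shape.hook_prod_pos[OF columns_column_shape[OF assms(2,1)], of d] assms(1)
  by (simp add: col_weight_def)

lemma sum_up_columns:
  assumes "\<alpha> > 0" "c \<in> columns d" "d < n"
  shows "(\<Sum>k<n. up_prob \<alpha> n c k) = 1"
  using column_shape.sum_up_prob[OF columns_column_shape[OF assms(2,1)], of n]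
    columns_zero[OF assms(2), of "n - 1"] assms(3) by simp

lemma sum_down_columns:
  assumes "\<alpha> > 0" "c \<in> columns (Suc d)" "d < n"
  shows "(\<Sum>k<n. down_prob \<alpha> n c k) = 1"
  using column_shape.sum_down_prob[OF columns_column_shape[OF assms(2,1)], of n]
    columns_sum[OF assms(2), of n] assms(3) by simp

text \<open>The exchange relation for the constant function 1 carries total mass 1 from
  \<open>d\<close> to \<open>d + 1\<close> boxes.\<close>

lemma sum_col_weight:
  assumes "\<alpha> > 0"
  shows "(\<Sum>c\<in>columns d. col_weight \<alpha> d c) = 1"
proof (induction d)
  case 0
  have "columns 0 = {\<lambda>_. 0}" by (auto simp: columns_def)
  then show ?case by (simp add: col_weight_def hook_prod_def)
next
  case (Suc d)
  show ?case using exchange[OF assms, of "d + 2" d "\<lambda>_ _ _. 1"] Suc.IH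
    by (simp add: sum_up_columns[OF assms] sum_down_columns[OF assms] del: sum.lessThan_Suc)
qed

text \<open>The scaled error in the relation \<open>Y (z) + \<alpha> d / Y (z - \<alpha> + 1) = z\<close>, where \<open>s\<^sup>2 = \<alpha> d\<close>.\<close>

definition defect :: "real \<Rightarrow> nat \<Rightarrow> real \<Rightarrow> real \<Rightarrow> (nat \<Rightarrow> nat) \<Rightarrow> real" where
  "defect \<alpha> n s z c = (Ytrans \<alpha> n c z - z) / s + s / Ytrans \<alpha> n c (z - \<alpha> + 1)"

section \<open>Stein's method for the defect\<close>

lemma average_le:
  fixes p b :: "nat \<Rightarrow> real"
  assumes "\<And>k. k < n \<Longrightarrow> 0 \<le> p k" "(\<Sum>k<n. p k) = 1" "\<And>k. k < n \<Longrightarrow> b k \<le> C"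
  shows "(\<Sum>k<n. p k * b k) \<le> C"
proof -
  have "(\<Sum>k<n. p k * b k) \<le> (\<Sum>k<n. p k * C)"
    using assms by (intro sum_mono mult_left_mono) auto
  then show ?thesis using assms(2) by (simp flip: sum_distrib_right)
qed

text \<open>The point \<open>z\<close>, and by \<open>\<alpha> \<ge> 1\<close> also
  \<open>z - \<alpha> + 1\<close>, stays at least one length scale \<open>s\<close> to the left of
  all contents, so the kernels \<open>s / (x k - z)\<close> lie between 0 and 1. The inequality in
  \<open>area\<close> allows the same \<open>s\<close> for \<open>d\<close> and \<open>d + 1\<close>
  boxes.\<close>

locale left_point =
  fixes \<alpha> s z :: real and n d :: nat and c :: "nat \<Rightarrow> nat"
  assumes alpha1: "\<alpha> \<ge> 1" and spos: "s > 0" and c: "c \<in> columns d" and dn: "d < n"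
    and far: "\<And>k. content \<alpha> c k - z \<ge> s" and area: "\<alpha> * d \<le> s\<^sup>2"
begin

sublocale column_shape \<alpha> n c
  using columns_column_shape[OF c] alpha1 by auto

definition v :: real where "v = s / Ytrans \<alpha> n c (z - \<alpha> + 1)"

lemma v_eq: "v = - (\<Sum>k<n. up_prob \<alpha> n c k * (s / (x k - (z - \<alpha> + 1))))"
proof -
  have ne: "z - \<alpha> + 1 \<noteq> x k" "z - \<alpha> + 1 \<noteq> x k + \<alpha>" for k using far[of k] spos alpha1 by auto
  have "Ytrans \<alpha> n c (z - \<alpha> + 1) * (\<Sum>k<n. up_prob \<alpha> n c k / (z - \<alpha> + 1 - x k)) = 1"
    using ne dn columns_zero[OF c, of "n - 1"] by (intro Ytrans_up) auto
  then have "1 / Ytrans \<alpha> n c (z - \<alpha> + 1) = (\<Sum>k<n. up_prob \<alpha> n c k / (z - \<alpha> + 1 - x k))"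
    by (metis divide_inverse inverse_unique mult_1)
  then have "v = s * (\<Sum>k<n. up_prob \<alpha> n c k / (z - \<alpha> + 1 - x k))"
    by (simp add: v_def divide_inverse)
  also have "\<dots> = (\<Sum>k<n. - (up_prob \<alpha> n c k * (s / (x k - (z - \<alpha> + 1)))))"
    unfolding sum_distrib_left
  proof (rule sum.cong)
    fix k
    have "z - \<alpha> + 1 - x k = - (x k - (z - \<alpha> + 1))" by simp
    then show "s * (up_prob \<alpha> n c k / (z - \<alpha> + 1 - x k)) = - (up_prob \<alpha> n c k * (s / (x k - (z - \<alpha> + 1))))"
      by (metis mult.commute mult_minus_right minus_divide_right times_divide_eq_left times_divide_eq_right)
  qed simp
  finally show ?thesis by (simp add: sum_negf)
qed

lemma kernel_bounds: "0 \<le> s / (x k - (z - \<alpha> + 1))" "s / (x k - (z - \<alpha> + 1)) \<le> 1"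
  using far[of k] spos alpha1 by (auto simp: divide_simps)

lemma v_bounds: "- 1 \<le> v" "v \<le> 0"
proof -
  show "- 1 \<le> v" unfolding v_eq
    using average_le[of n "up_prob \<alpha> n c" "\<lambda>k. s / (x k - (z - \<alpha> + 1))" 1] up_prob_nonneg
      sum_up_columns[OF alpha c dn] kernel_bounds by auto
  have "0 \<le> (\<Sum>k<n. up_prob \<alpha> n c k * (s / (x k - (z - \<alpha> + 1))))"
    by (intro sum_nonneg mult_nonneg_nonneg up_prob_nonneg kernel_bounds(1)) auto
  then show "v \<le> 0" unfolding v_eq by simp
qed

text \<open>Makes it legitimate to divide by \<open>Y (z - \<alpha> + 1)\<close> when a box is
  added.\<close>

lemma v_nonzero: "v \<noteq> 0"
proof -
  have ne: "z - \<alpha> + 1 \<noteq> x k" "z - \<alpha> + 1 \<noteq> x k + \<alpha>" for k using far[of k] spos alpha1 by auto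
  have "Ytrans \<alpha> n c (z - \<alpha> + 1) * (\<Sum>k<n. up_prob \<alpha> n c k / (z - \<alpha> + 1 - x k)) = 1"
    using ne dn columns_zero[OF c, of "n - 1"] by (intro Ytrans_up) auto
  then show ?thesis using spos by (auto simp: v_def)
qed

lemma Y_eq: "Ytrans \<alpha> n c z - z = \<alpha> * d * (\<Sum>k<n. down_prob \<alpha> n c k * (1 / (x k + \<alpha> - z)))"
proof -
  have ne: "z \<noteq> x k + \<alpha>" for k using far[of k] spos alpha1 by auto
  have "1 / (x k + \<alpha> - z) = - (1 / (z - (x k + \<alpha>)))" for k
    by (metis minus_diff_eq minus_divide_right)
  then show ?thesis using Ytrans_down[OF ne] columns_sum[OF c, of n] dn
    by (simp add: sum_negf del: of_nat_sum)
qed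

lemma Y_bounds: "0 \<le> (Ytrans \<alpha> n c z - z) / s" "(Ytrans \<alpha> n c z - z) / s \<le> 1"
proof -
  have k: "0 \<le> 1 / (x k + \<alpha> - z)" "1 / (x k + \<alpha> - z) \<le> 1 / s" for k
    using far[of k] spos alpha1 by (auto simp: divide_simps)
  have nn: "0 \<le> Ytrans \<alpha> n c z - z" unfolding Y_eq
    using k(1) down_prob_nonneg alpha by (auto intro!: mult_nonneg_nonneg sum_nonneg)
  then show "0 \<le> (Ytrans \<alpha> n c z - z) / s" using spos by simp
  show "(Ytrans \<alpha> n c z - z) / s \<le> 1"
  proof (cases d)
    case 0
    then show ?thesis unfolding Y_eq by simp
  next
    case (Suc d')
    have "(\<Sum>k<n. down_prob \<alpha> n c k * (1 / (x k + \<alpha> - z))) \<le> 1 / s"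
      using k down_prob_nonneg sum_down_columns[OF alpha, of c d' n] c dn Suc
      by (intro average_le) auto
    then have "Ytrans \<alpha> n c z - z \<le> s\<^sup>2 * (1 / s)" unfolding Y_eq
      by (intro mult_mono area sum_nonneg mult_nonneg_nonneg down_prob_nonneg k(1)) auto
    then show ?thesis using spos by (simp add: power2_eq_square field_simps)
  qed
qed

lemma defect_eq: "defect \<alpha> n s z c = (Ytrans \<alpha> n c z - z) / s + v"
  by (simp add: defect_def v_def)

lemma defect_bound: "\<bar>defect \<alpha> n s z c\<bar> \<le> 1"
  unfolding defect_eq using Y_bounds v_bounds by auto

lemma Y_abs: "\<bar>Ytrans \<alpha> n c z\<bar> \<le> \<bar>z\<bar> + s"
  using Y_bounds spos by (auto simp: divide_simps split: if_splits)

end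

text \<open>Only the factor of column \<open>m\<close> changes, its content falling by 1. With
  \<open>a\<close> the distance to \<open>z\<close>, the new factor is the old one times
  \<open>1 - \<alpha> / (a * (a + \<alpha> - 1))\<close>. For
  \<open>s^2 = \<alpha> * (d + 1)\<close> the bound on \<open>\<delta>\<close> is
  \<open>1 / (d + 1)\<close>.\<close>

lemma Ytrans_add_box:
  fixes c :: "nat \<Rightarrow> nat"
  assumes "\<alpha> \<ge> 1" "m < n" and a: "content \<alpha> c m - z \<ge> s" and s: "s > 1"
  shows "\<exists>\<delta>. 0 \<le> \<delta> \<and> \<delta> \<le> \<alpha> / s\<^sup>2 \<and> Ytrans \<alpha> n (c(m := Suc (c m))) z = Ytrans \<alpha> n c z * (1 - \<delta>)"
proof -
  define a where "a = content \<alpha> c m - z"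
  have a: "a \<ge> s" "a > 1" using assms by (auto simp: a_def)
  define \<delta> where "\<delta> = \<alpha> / (a * (a + \<alpha> - 1))"
  have "s\<^sup>2 \<le> a * (a + \<alpha> - 1)" unfolding power2_eq_square using a s assms(1) by (intro mult_mono) auto
  then have \<delta>: "0 \<le> \<delta>" "\<delta> \<le> \<alpha> / s\<^sup>2" using assms(1) s a by (auto simp: \<delta>_def intro!: divide_left_mono)
  let ?c = "c(m := Suc (c m))"
  have split: "{..<n} = insert m ({..<n} - {m})" using assms(2) by auto
  have f: "1 + \<alpha> / (z - (content \<alpha> ?c m + \<alpha>)) = (1 + \<alpha> / (z - (content \<alpha> c m + \<alpha>))) * (1 - \<delta>)"
  proof -
    have e: "z - (content \<alpha> ?c m + \<alpha>) = - (a + \<alpha> - 1)" "z - (content \<alpha> c m + \<alpha>) = - (a + \<alpha>)"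
      by (simp_all add: a_def content_def)
    have "a \<noteq> 0" "a + \<alpha> - 1 \<noteq> 0" "a + \<alpha> \<noteq> 0" using a assms(1) by auto
    then show ?thesis unfolding e \<delta>_def
      by (simp add: divide_simps) (simp add: algebra_simps)
  qed
  have "(\<Prod>k<n. 1 + \<alpha> / (z - (content \<alpha> ?c k + \<alpha>)))
     = (1 + \<alpha> / (z - (content \<alpha> ?c m + \<alpha>))) * (\<Prod>k\<in>{..<n} - {m}. 1 + \<alpha> / (z - (content \<alpha> ?c k + \<alpha>)))"
    using assms(2) by (simp add: prod.remove)
  also have "(\<Prod>k\<in>{..<n} - {m}. 1 + \<alpha> / (z - (content \<alpha> ?c k + \<alpha>))) = (\<Prod>k\<in>{..<n} - {m}. 1 + \<alpha> / (z - (content \<alpha> c k + \<alpha>)))"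
    by (intro prod.cong) (auto simp: content_def)
  finally have "(\<Prod>k<n. 1 + \<alpha> / (z - (content \<alpha> ?c k + \<alpha>))) =
      (1 + \<alpha> / (z - (content \<alpha> c m + \<alpha>))) * (1 - \<delta>) * (\<Prod>k\<in>{..<n} - {m}. 1 + \<alpha> / (z - (content \<alpha> c k + \<alpha>)))"
    unfolding f .
  also have "\<dots> = (\<Prod>k<n. 1 + \<alpha> / (z - (content \<alpha> c k + \<alpha>))) * (1 - \<delta>)"
    using assms(2) prod.remove[of "{..<n}" m "\<lambda>k. 1 + \<alpha> / (z - (content \<alpha> c k + \<alpha>))"] by simp
  finally have "(\<Prod>k<n. 1 + \<alpha> / (z - (content \<alpha> ?c k + \<alpha>))) = (\<Prod>k<n. 1 + \<alpha> / (z - (content \<alpha> c k + \<alpha>))) * (1 - \<delta>)" .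
  then show ?thesis using \<delta> by (intro exI[of _ \<delta>]) (simp add: Ytrans_def)
qed

lemma content_far:
  assumes "c \<in> columns d" "d \<le> N" "\<alpha> > 0" "z \<le> - real N - s"
  shows "content \<alpha> c k - z \<ge> s"
proof -
  have "c 0 \<le> d" using columns_area[OF assms(1), of 0] by simp
  then have "c k \<le> N" using columns_antimono[OF assms(1), of 0 k] assms(2) by simp
  moreover have "\<alpha> * real k \<ge> 0" using assms(3) by simp
  ultimately show ?thesis using assms(4) by (simp add: content_def)
qed

text \<open>Stein's method: a test function that hardly changes when one box is added cannot
  distinguish the two sides of the exchange relation; the test function used here is the
  defect itself.\<close>

lemma defect_second_moment:
  fixes \<alpha> s z :: real
  assumes alpha1: "\<alpha> \<ge> 1" and z: "z \<le> - real (Suc d) - sqrt (\<alpha> * Suc d)" and s: "s = sqrt (\<alpha> * Suc d)" "s > 1"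
    and n: "n = d + 2"
  shows "(\<Sum>c\<in>columns (Suc d). col_weight \<alpha> (Suc d) c * (defect \<alpha> n s z c)\<^sup>2) \<le> (2 * \<bar>z\<bar> / s + 5) / Suc d"
proof -
  have alpha: "\<alpha> > 0" using alpha1 by simp
  have s2: "s\<^sup>2 = \<alpha> * Suc d" using alpha s by simp
  define N where "N = real (Suc d)"
  have N: "N > 0" by (simp add: N_def)
  have inv: "\<alpha> / s\<^sup>2 = 1 / N" using alpha by (simp add: s2 N_def)
  define \<Psi> where "\<Psi> = defect \<alpha> n s z"
  define V where "V c = s / Ytrans \<alpha> n c (z - \<alpha> + 1)" for c
  \<comment> \<open>One kernel serves both measures. Removing a box raises the content by 1, so
    \<open>T\<close> of the smaller diagram has denominator
    \<open>content \<alpha> c k + \<alpha> - z\<close> in terms of the larger one, as in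
    \<open>Ytrans_down\<close>. This is the origin of the shift \<open>- \<alpha> + 1\<close> in the
    defect.\<close>
  define T where "T c k = s / (content \<alpha> c k - (z - \<alpha> + 1))" for c k
  have loc: "left_point \<alpha> s z n m c" if "c \<in> columns m" "m \<le> Suc d" for c m
  proof
    show "\<alpha> * real m \<le> s\<^sup>2" unfolding s2 using that alpha by (intro mult_left_mono) auto
  qed (use that alpha1 s n z content_far[OF that alpha, of z s] in auto)
  \<comment> \<open>A bound for the change of the defect: \<open>(\<bar>z\<bar> / s + 1) / N\<close>
    comes from \<open>Y\<close>, because \<open>\<bar>Y\<bar> \<le> \<bar>z\<bar> + s\<close>, and
    \<open>1 / N\<close> from \<open>V\<close>.\<close>
  define D where "D = (\<bar>z\<bar> / s + 2) / N"
  have step: "(\<Psi> c' - \<Psi> c) * T c k + (\<Psi> c' * V c' - \<Psi> c * V c) \<le> 2 * D + 1 / N"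
    if c: "c \<in> columns d" and k: "k < n" "k = 0 \<or> c k < c (k - 1)" and c'_def: "c' = c(k := Suc (c k))" for c c' k
  proof -
    have c': "c' \<in> columns (Suc d)" using columns_add_box[OF c k(2)] by (simp add: c'_def)
    interpret l: left_point \<alpha> s z n d c using loc[OF c] by simp
    interpret l': left_point \<alpha> s z n "Suc d" c' using loc[OF c'] by simp
    obtain \<delta> where \<delta>: "0 \<le> \<delta>" "\<delta> \<le> 1 / N" "Ytrans \<alpha> n c' z = Ytrans \<alpha> n c z * (1 - \<delta>)"
      using Ytrans_add_box[OF alpha1 k(1) l.far s(2)] unfolding c'_def inv by blast
    have far': "content \<alpha> c k - (z - \<alpha> + 1) \<ge> s" using l.far[of k] alpha1 by simp
    obtain \<delta>' where \<delta>': "0 \<le> \<delta>'" "\<delta>' \<le> 1 / N"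
      "Ytrans \<alpha> n c' (z - \<alpha> + 1) = Ytrans \<alpha> n c (z - \<alpha> + 1) * (1 - \<delta>')"
      using Ytrans_add_box[OF alpha1 k(1) far' s(2)] unfolding c'_def inv by blast
    have V: "V c = l.v" "V c' = l'.v" by (simp_all add: V_def l.v_def l'.v_def)
    have "1 - \<delta>' \<noteq> 0" using l'.v_nonzero \<delta>'(3) by (auto simp: l'.v_def)
    then have "V c = V c' * (1 - \<delta>')" unfolding V_def \<delta>'(3) by simp
    then have "V c' - V c = V c' * \<delta>'" by (simp add: algebra_simps)
    then have dV: "\<bar>V c' - V c\<bar> \<le> 1 / N"
      using mult_mono[of "\<bar>V c'\<bar>" 1 "\<delta>'" "1 / N"] l'.v_bounds \<delta>' by (simp add: abs_mult V)
    have "Ytrans \<alpha> n c' z - Ytrans \<alpha> n c z = - (Ytrans \<alpha> n c z * \<delta>)"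
      unfolding \<delta>(3) by (simp add: algebra_simps)
    then have "\<bar>Ytrans \<alpha> n c' z - Ytrans \<alpha> n c z\<bar> = \<bar>Ytrans \<alpha> n c z\<bar> * \<delta>"
      using \<delta>(1) by (simp add: abs_mult)
    also have "\<dots> \<le> (\<bar>z\<bar> + s) * (1 / N)" using l.Y_abs \<delta> N by (intro mult_mono) auto
    finally have "\<bar>Ytrans \<alpha> n c' z - Ytrans \<alpha> n c z\<bar> / s \<le> (\<bar>z\<bar> + s) * (1 / N) / s"
      using s(2) by (intro divide_right_mono) auto
    also have "\<dots> = (\<bar>z\<bar> / s + 1) / N" using s(2) by (simp add: field_simps)
    finally have dY: "\<bar>Ytrans \<alpha> n c' z - Ytrans \<alpha> n c z\<bar> / s \<le> (\<bar>z\<bar> / s + 1) / N" .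
    have "\<Psi> c' - \<Psi> c = (Ytrans \<alpha> n c' z - Ytrans \<alpha> n c z) / s + (V c' - V c)"
      unfolding \<Psi>_def l.defect_eq l'.defect_eq V by (simp add: diff_divide_distrib)
    then have "\<bar>\<Psi> c' - \<Psi> c\<bar> \<le> \<bar>Ytrans \<alpha> n c' z - Ytrans \<alpha> n c z\<bar> / s + \<bar>V c' - V c\<bar>"
      using s(2) by (metis abs_divide abs_of_pos abs_triangle_ineq l.spos)
    also have "\<dots> \<le> (\<bar>z\<bar> / s + 1) / N + 1 / N" using dY dV by (rule add_mono)
    finally have d\<Psi>: "\<bar>\<Psi> c' - \<Psi> c\<bar> \<le> D" by (simp add: D_def add_divide_distrib)
    have T: "\<bar>T c k\<bar> \<le> 1" unfolding T_def using l.kernel_bounds[of k] by (simp only: abs_of_nonneg)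
    have "(\<Psi> c' - \<Psi> c) * T c k \<le> \<bar>\<Psi> c' - \<Psi> c\<bar> * \<bar>T c k\<bar>" by (metis abs_ge_self abs_mult)
    also have "\<dots> \<le> D * 1" using d\<Psi> T by (intro mult_mono) auto
    finally have 1: "(\<Psi> c' - \<Psi> c) * T c k \<le> D" by simp
    have "(\<Psi> c' - \<Psi> c) * V c' \<le> \<bar>\<Psi> c' - \<Psi> c\<bar> * \<bar>V c'\<bar>" by (metis abs_ge_self abs_mult)
    also have "\<dots> \<le> D * 1" using d\<Psi> l'.v_bounds by (intro mult_mono) (auto simp: V)
    finally have 2: "(\<Psi> c' - \<Psi> c) * V c' \<le> D" by simp
    have "\<Psi> c * (V c' - V c) \<le> \<bar>\<Psi> c\<bar> * \<bar>V c' - V c\<bar>" by (metis abs_ge_self abs_mult)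
    also have "\<dots> \<le> 1 * (1 / N)" using dV l.defect_bound by (intro mult_mono) (auto simp: \<Psi>_def)
    finally have 3: "\<Psi> c * (V c' - V c) \<le> 1 / N" by simp
    show ?thesis using 1 2 3 by (simp add: algebra_simps)
  qed
  \<comment> \<open>On the larger diagram the defect is the cotransition average of \<open>T\<close>
    plus \<open>V\<close>. One of the two factors of its square is replaced by this average, after
    which the exchange relation applies.\<close>
  have part1: "(\<Sum>c\<in>columns (Suc d). col_weight \<alpha> (Suc d) c * (\<Psi> c)\<^sup>2)
    = (\<Sum>c\<in>columns (Suc d). col_weight \<alpha> (Suc d) c * (\<Sum>k<n. down_prob \<alpha> n c k * (\<Psi> c * (T (c(k := c k - 1)) k + V c))))"
  proof (rule sum.cong)
    fix c assume c: "c \<in> columns (Suc d)"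
    interpret l: left_point \<alpha> s z n "Suc d" c using loc[OF c] by simp
    have "down_prob \<alpha> n c k * T (c(k := c k - 1)) k = down_prob \<alpha> n c k * (s / (content \<alpha> c k + \<alpha> - z))" if "k < n" for k
    proof (cases "c (Suc k) < c k")
      case True
      then have "content \<alpha> (c(k := c k - 1)) k = content \<alpha> c k + 1" by (simp add: content_def of_nat_diff)
      then show ?thesis unfolding T_def by (simp add: algebra_simps)
    next
      case False
      then have "down_prob \<alpha> n c k = 0"
        using l.anti[of k] that columns_zero[OF c, of n] n by (intro l.down_prob_zero) auto
      then show ?thesis by simp
    qed
    then have "(\<Sum>k<n. down_prob \<alpha> n c k * T (c(k := c k - 1)) k) = s * (\<Sum>k<n. down_prob \<alpha> n c k * (1 / (content \<alpha> c k + \<alpha> - z)))"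
      by (simp add: sum_distrib_left mult.commute)
    also have "\<dots> = (Ytrans \<alpha> n c z - z) / s" unfolding l.Y_eq s2[symmetric]
      using l.spos by (simp add: power2_eq_square)
    finally have "(\<Sum>k<n. down_prob \<alpha> n c k * T (c(k := c k - 1)) k) = (Ytrans \<alpha> n c z - z) / s" .
    moreover have "(\<Sum>k<n. down_prob \<alpha> n c k * (T (c(k := c k - 1)) k + V c)) =
        (\<Sum>k<n. down_prob \<alpha> n c k * T (c(k := c k - 1)) k) + (\<Sum>k<n. down_prob \<alpha> n c k) * V c"
      unfolding sum_distrib_right sum.distrib[symmetric] by (simp only: distrib_left)
    moreover have "(\<Sum>k<n. down_prob \<alpha> n c k) = 1" using n by (intro sum_down_columns[OF alpha c]) auto
    moreover have "\<Psi> c = (Ytrans \<alpha> n c z - z) / s + V c"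
      by (simp add: \<Psi>_def l.defect_eq V_def l.v_def)
    ultimately have "(\<Sum>k<n. down_prob \<alpha> n c k * (T (c(k := c k - 1)) k + V c)) = \<Psi> c"
      by simp
    moreover have "(\<Sum>k<n. down_prob \<alpha> n c k * (\<Psi> c * (T (c(k := c k - 1)) k + V c)))
       = \<Psi> c * (\<Sum>k<n. down_prob \<alpha> n c k * (T (c(k := c k - 1)) k + V c))"
      unfolding sum_distrib_left by (intro sum.cong) (auto simp: mult_ac)
    ultimately show "col_weight \<alpha> (Suc d) c * (\<Psi> c)\<^sup>2 =
       col_weight \<alpha> (Suc d) c * (\<Sum>k<n. down_prob \<alpha> n c k * (\<Psi> c * (T (c(k := c k - 1)) k + V c)))"
      by (simp add: power2_eq_square)
  qed simp
  also have "\<dots> = (\<Sum>c\<in>columns d. col_weight \<alpha> d c * (\<Sum>k<n. up_prob \<alpha> n c k * (\<Psi> (c(k := Suc (c k))) * (T c k + V (c(k := Suc (c k)))))))"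
    by (rule exchange[OF alpha n, of "\<lambda>c c' k. \<Psi> c' * (T c k + V c')", symmetric])
  also have "\<dots> \<le> (\<Sum>c\<in>columns d. col_weight \<alpha> d c * (2 * D + 1 / N))"
  proof (intro sum_mono mult_left_mono)
    fix c assume c: "c \<in> columns d"
    interpret l: left_point \<alpha> s z n d c using loc[OF c] by simp
    \<comment> \<open>With \<open>\<Psi>\<close> and \<open>V\<close> frozen at the smaller diagram
      the average over the added box is 0, since \<open>V\<close> is minus the transition average of
      \<open>T\<close>. So only increments contribute.\<close>
    have "(\<Sum>k<n. up_prob \<alpha> n c k * (\<Psi> c * (T c k + V c))) = \<Psi> c * ((\<Sum>k<n. up_prob \<alpha> n c k * T c k) + (\<Sum>k<n. up_prob \<alpha> n c k) * V c)"
      unfolding distrib_left sum_distrib_left sum_distrib_right sum.distrib[symmetric]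
      by (intro sum.cong) (auto simp: mult_ac)
    also have "\<dots> = 0"
    proof -
      have "(\<Sum>k<n. up_prob \<alpha> n c k) = 1" using n by (intro sum_up_columns[OF alpha c]) auto
      moreover have "V c = - (\<Sum>k<n. up_prob \<alpha> n c k * T c k)"
        unfolding T_def l.v_eq[symmetric] by (simp add: V_def l.v_def)
      ultimately show ?thesis by simp
    qed
    finally have zero: "(\<Sum>k<n. up_prob \<alpha> n c k * (\<Psi> c * (T c k + V c))) = 0" .
    have "(\<Sum>k<n. up_prob \<alpha> n c k * (\<Psi> (c(k := Suc (c k))) * (T c k + V (c(k := Suc (c k))))))
      = (\<Sum>k<n. up_prob \<alpha> n c k * ((\<Psi> (c(k := Suc (c k))) - \<Psi> c) * T c k + (\<Psi> (c(k := Suc (c k))) * V (c(k := Suc (c k))) - \<Psi> c * V c)))"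
      (is "?L = ?R")
    proof -
      have "?L - (\<Sum>k<n. up_prob \<alpha> n c k * (\<Psi> c * (T c k + V c))) = ?R"
        unfolding sum_subtractf[symmetric] by (intro sum.cong) (auto simp: algebra_simps)
      then show ?thesis using zero by simp
    qed
    also have "\<dots> \<le> (\<Sum>k<n. up_prob \<alpha> n c k * (2 * D + 1 / N))"
    proof (rule sum_mono)
      fix k assume k: "k \<in> {..<n}"
      show "up_prob \<alpha> n c k * ((\<Psi> (c(k := Suc (c k))) - \<Psi> c) * T c k + (\<Psi> (c(k := Suc (c k))) * V (c(k := Suc (c k))) - \<Psi> c * V c))
         \<le> up_prob \<alpha> n c k * (2 * D + 1 / N)"
      proof (cases "k = 0 \<or> c k < c (k - 1)")
        case True
        then show ?thesis using step[OF c _ True refl] k l.up_prob_nonneg[of k] by (intro mult_left_mono) auto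
      next
        case False
        then have "up_prob \<alpha> n c k = 0" using l.antimono[of "k - 1" k] k by (intro l.up_prob_zero) auto
        then show ?thesis by simp
      qed
    qed
    also have "\<dots> = 2 * D + 1 / N"
      using sum_up_columns[OF alpha c l.dn] by (simp only: sum_distrib_right[symmetric] mult_1_left)
    finally show "(\<Sum>k<n. up_prob \<alpha> n c k * (\<Psi> (c(k := Suc (c k))) * (T c k + V (c(k := Suc (c k)))))) \<le> 2 * D + 1 / N" .
  qed (simp add: col_weight_nonneg alpha)
  also have "\<dots> = 2 * D + 1 / N" using sum_col_weight[OF alpha, of d] by (simp flip: sum_distrib_right)
  \<comment> \<open>The constant 5 is twice the 2 in \<open>D\<close> plus 1 from the increment of
    \<open>V\<close>.\<close>
  also have "\<dots> = (2 * \<bar>z\<bar> / s + 5) / Suc d" by (simp add: D_def N_def field_simps)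
  finally show ?thesis by (simp add: \<Psi>_def)
qed

section \<open>The Bessel function as a function of its order\<close>

text \<open>The terms of \<open>t powr (- \<nu>)\<close> times the Bessel function at
  \<open>2 * t\<close>. Without the power of \<open>t\<close> the recurrence in the order has
  polynomial coefficients.\<close>

definition bes_term :: "real \<Rightarrow> real \<Rightarrow> nat \<Rightarrow> real" where
  "bes_term t \<nu> m = (-1) ^ m / fact m * rGamma (real m + \<nu> + 1) * (t\<^sup>2) ^ m"

lemma bessel_J_eq:
  assumes "t > 0" and sm: "summable (bes_term t \<nu>)"
  shows "bessel_J \<nu> (2 * t) = t powr \<nu> * (\<Sum>m. bes_term t \<nu> m)"
proof -
  have "(-1) ^ m / fact m * rGamma (real m + \<nu> + 1) * (2 * t / 2) powr (2 * real m + \<nu>) = t powr \<nu> * bes_term t \<nu> m" for m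
  proof -
    have "t powr (2 * real m + \<nu>) = (t\<^sup>2) ^ m * t powr \<nu>"
      using assms powr_realpow[of t "2 * m"] by (simp add: powr_add power_mult)
    then show ?thesis by (simp add: bes_term_def)
  qed
  then show ?thesis unfolding bessel_J_def using suminf_mult[OF sm, of "t powr \<nu>"] by simp
qed

text \<open>Continuity gives a bound on a compact interval. It propagates to the right in unit
  steps, because \<open>x * rGamma (x + 1) = rGamma x\<close> shrinks the absolute value once
  \<open>x \<ge> 1\<close>.\<close>

lemma rGamma_bounded:
  fixes a :: real
  shows "\<exists>C>0. \<forall>x\<ge>a. \<bar>rGamma x\<bar> \<le> C"
proof -
  define b where "b = max a 1 + 1"
  have "compact (rGamma ` {a..b})"
    by (intro compact_continuous_image continuous_intros) auto
  then obtain C where C: "C > 0" "\<And>x. x \<in> {a..b} \<Longrightarrow> \<bar>rGamma x\<bar> \<le> C"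
    using compact_imp_bounded bounded_pos by (metis imageI real_norm_def)
  have "\<bar>rGamma x\<bar> \<le> C" if "a \<le> x" "x \<le> b + real k" for x k
    using that
  proof (induction k arbitrary: x)
    case 0
    then show ?case using C(2) by simp
  next
    case (Suc k)
    show ?case
    proof (cases "x \<le> b + real k")
      case True
      then show ?thesis using Suc by simp
    next
      case False
      then have y: "x - 1 \<ge> 1" "x - 1 \<ge> a" by (auto simp: b_def)
      have "\<bar>rGamma (x - 1)\<bar> \<le> C" using Suc y by simp
      moreover have "(x - 1) * rGamma x = rGamma (x - 1)" using rGamma_plus1[of "x - 1"] by simp
      moreover have "1 * \<bar>rGamma x\<bar> \<le> (x - 1) * \<bar>rGamma x\<bar>" using y by (intro mult_right_mono) auto
      ultimately show ?thesis using y by (metis abs_mult abs_of_nonneg mult_1 order_trans zero_le_one)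
    qed
  qed
  moreover have "\<exists>k. x \<le> b + real k" for x
    using real_arch_simple[of "x - b"] by (auto simp: algebra_simps)
  ultimately show ?thesis using C(1) by blast
qed

lemma bes_term_bound:
  assumes "\<And>x. x \<ge> a + 1 \<Longrightarrow> \<bar>rGamma x\<bar> \<le> C" "\<nu> \<ge> a"
  shows "\<bar>bes_term t \<nu> m\<bar> \<le> C * ((t\<^sup>2) ^ m / fact m)"
proof -
  have "\<bar>rGamma (real m + \<nu> + 1)\<bar> \<le> C" using assms by auto
  then have "\<bar>rGamma (real m + \<nu> + 1)\<bar> * ((t\<^sup>2) ^ m / fact m) \<le> C * ((t\<^sup>2) ^ m / fact m)"
    by (intro mult_right_mono) auto
  then show ?thesis by (simp add: bes_term_def abs_mult power_abs)
qed

lemma exp_series_summable: "summable (\<lambda>m. C * ((t::real) ^ m / fact m))"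
  using summable_exp[of t] by (intro summable_mult) (simp add: divide_inverse mult.commute)

lemma summable_bes_term: "summable (bes_term t \<nu>)"
proof -
  obtain C where C: "\<And>x. x \<ge> \<nu> + 1 \<Longrightarrow> \<bar>rGamma x\<bar> \<le> C" using rGamma_bounded[of "\<nu> + 1"] by blast
  show ?thesis
  proof (rule summable_comparison_test'[OF exp_series_summable[of C "t\<^sup>2"]])
    show "norm (bes_term t \<nu> m) \<le> C * ((t\<^sup>2) ^ m / fact m)" for m
      using bes_term_bound[of \<nu> C \<nu> t m] C by simp
  qed
qed

lemma abs_suminf_le:
  fixes f :: "nat \<Rightarrow> real"
  assumes "summable h" "\<And>m. \<bar>f m\<bar> \<le> h m"
  shows "\<bar>\<Sum>m. f m\<bar> \<le> (\<Sum>m. h m)"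
proof -
  have s: "summable (\<lambda>m. \<bar>f m\<bar>)" by (rule summable_comparison_test'[OF assms(1)]) (use assms in auto)
  have "\<bar>\<Sum>m. f m\<bar> \<le> (\<Sum>m. \<bar>f m\<bar>)" by (rule summable_rabs[OF s])
  also have "\<dots> \<le> (\<Sum>m. h m)" by (rule suminf_le[OF assms(2) s assms(1)])
  finally show ?thesis .
qed

definition bes :: "real \<Rightarrow> real \<Rightarrow> real" where
  "bes t \<nu> = (\<Sum>m. bes_term t \<nu> m)"

text \<open>The functional equation of \<open>rGamma\<close> splits the term of order
  \<open>\<nu> - 1\<close> into \<open>(m + \<nu>)\<close> times that of order \<open>\<nu>\<close>;
  the part with the factor \<open>m\<close>, shifted by one index, is minus \<open>t^2\<close> times
  the series of order \<open>\<nu> + 1\<close>.\<close>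

lemma bes_recurrence: "bes t (\<nu> - 1) + t\<^sup>2 * bes t (\<nu> + 1) = \<nu> * bes t \<nu>"
proof -
  let ?f = "\<lambda>m. real m * bes_term t \<nu> m"
  have 1: "bes_term t (\<nu> - 1) m = ?f m + \<nu> * bes_term t \<nu> m" for m
  proof -
    have "bes_term t (\<nu> - 1) m = (-1) ^ m / fact m * ((real m + \<nu>) * rGamma (real m + \<nu> + 1)) * (t\<^sup>2) ^ m"
      unfolding rGamma_plus1 by (simp add: bes_term_def)
    also have "\<dots> = ?f m + \<nu> * bes_term t \<nu> m"
      unfolding bes_term_def by (simp only: ring_distribs mult_ac)
    finally show ?thesis .
  qed
  have 2: "t\<^sup>2 * bes_term t (\<nu> + 1) m = - ?f (Suc m)" for m
    by (simp add: bes_term_def divide_simps)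
  \<comment> \<open>Summability with the extra factor \<open>m\<close> comes for free, as a
    difference of two series already known to converge.\<close>
  have sf: "summable ?f"
    using summable_diff[OF summable_bes_term[of t "\<nu> - 1"] summable_mult[OF summable_bes_term[of t \<nu>], of \<nu>]]
    by (simp add: 1)
  have "bes t (\<nu> - 1) = (\<Sum>m. ?f m) + \<nu> * bes t \<nu>"
    unfolding bes_def 1 using suminf_add[OF sf summable_mult[OF summable_bes_term[of t \<nu>], of \<nu>]]
      suminf_mult[OF summable_bes_term[of t \<nu>], of \<nu>] by simp
  moreover have "t\<^sup>2 * bes t (\<nu> + 1) = (\<Sum>m. - ?f (Suc m))"
    unfolding bes_def 2[symmetric] by (rule suminf_mult[OF summable_bes_term, symmetric])
  moreover have "(\<Sum>m. - ?f (Suc m)) = - (\<Sum>m. ?f (Suc m))"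
    using sf summable_Suc_iff[of ?f] by (intro suminf_minus) auto
  moreover have "(\<Sum>m. ?f (Suc m)) = (\<Sum>m. ?f m)" using suminf_split_head[OF sf] by simp
  ultimately show ?thesis by simp
qed

lemma isCont_bes: "isCont (bes t) \<nu>"
proof -
  obtain C where C: "\<And>x. x \<ge> (\<nu> - 1) + 1 \<Longrightarrow> \<bar>rGamma x\<bar> \<le> C" using rGamma_bounded[of "\<nu> - 1 + 1"] by blast
  have "uniform_limit {\<nu> - 1..\<nu> + 1} (\<lambda>n x. \<Sum>m<n. bes_term t x m) (\<lambda>x. \<Sum>m. bes_term t x m) sequentially"
  proof (rule Weierstrass_m_test[OF _ exp_series_summable[of C "t\<^sup>2"]])
    show "norm (bes_term t x m) \<le> C * ((t\<^sup>2) ^ m / fact m)" if "x \<in> {\<nu> - 1..\<nu> + 1}" for m x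
      using bes_term_bound[of "\<nu> - 1" C x t m] C that by simp
  qed
  then have "continuous_on {\<nu> - 1..\<nu> + 1} (\<lambda>x. \<Sum>m. bes_term t x m)"
    by (rule uniform_limit_theorem[rotated]) (auto intro!: always_eventually continuous_intros continuous_on_compose2[OF continuous_on_rGamma[of UNIV]]
        simp: bes_term_def)
  then have "continuous_on {\<nu> - 1..\<nu> + 1} (bes t)" by (simp add: bes_def)
  then show ?thesis by (rule continuous_on_interior) (simp add: interior_atLeastAtMost_real)
qed

lemma bes_bounded: "\<exists>C. \<forall>\<nu>\<ge>a. \<bar>bes t \<nu>\<bar> \<le> C"
proof -
  obtain C where C: "\<And>x. x \<ge> a + 1 \<Longrightarrow> \<bar>rGamma x\<bar> \<le> C" using rGamma_bounded[of "a + 1"] by blast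
  have "\<bar>bes t \<nu>\<bar> \<le> (\<Sum>m. C * ((t\<^sup>2) ^ m / fact m))" if "\<nu> \<ge> a" for \<nu>
    unfolding bes_def by (rule abs_suminf_le[OF exp_series_summable bes_term_bound[OF C that]])
  then show ?thesis by blast
qed

text \<open>For large order the first term dominates: the ratio
  \<open>t^2 / (\<nu> + 1) \<le> 1 / 2\<close> bounds the remaining terms by
  \<open>rGamma (\<nu> + 1) * (exp (1 / 2) - 1)\<close>, and \<open>exp (1 / 2) < 2\<close>.\<close>

lemma bes_pos:
  assumes "\<nu> \<ge> 0" "\<nu> + 1 \<ge> 2 * t\<^sup>2"
  shows "bes t \<nu> > 0"
proof -
  have G: "rGamma (\<nu> + 1) > 0" using assms by (simp add: rGamma_inverse_Gamma Gamma_real_pos)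
  have le: "\<bar>rGamma (real m + \<nu> + 1)\<bar> \<le> rGamma (\<nu> + 1) / (\<nu> + 1) ^ m" for m
  proof (induction m)
    case 0
    then show ?case using G by simp
  next
    case (Suc m)
    define y where "y = real m + \<nu> + 1"
    have y: "y \<ge> \<nu> + 1" "y > 0" using assms by (auto simp: y_def)
    have e: "rGamma y = y * rGamma (y + 1)" using rGamma_plus1[of y] by simp
    have "\<bar>rGamma (y + 1)\<bar> = \<bar>rGamma y\<bar> / y" unfolding e using y by (simp add: abs_mult)
    also have "\<dots> \<le> rGamma (\<nu> + 1) / (\<nu> + 1) ^ m / (\<nu> + 1)"
      using Suc y assms G unfolding y_def by (intro frac_le) auto
    finally show ?case by (simp add: y_def add_ac mult.commute)
  qed
  have "\<bar>bes_term t \<nu> (Suc m)\<bar> \<le> rGamma (\<nu> + 1) * (1 / 2) ^ Suc m / fact (Suc m)" for m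
  proof -
    have "\<bar>bes_term t \<nu> (Suc m)\<bar> = \<bar>rGamma (real (Suc m) + \<nu> + 1)\<bar> * ((t\<^sup>2) ^ Suc m / fact (Suc m))"
      by (simp add: bes_term_def abs_mult power_abs del: power_Suc fact_Suc)
    also have "\<dots> \<le> rGamma (\<nu> + 1) / (\<nu> + 1) ^ Suc m * ((t\<^sup>2) ^ Suc m / fact (Suc m))"
      by (intro mult_right_mono le) auto
    also have "\<dots> = rGamma (\<nu> + 1) * (t\<^sup>2 / (\<nu> + 1)) ^ Suc m / fact (Suc m)"
      by (simp add: power_divide del: power_Suc fact_Suc)
    also have "\<dots> \<le> rGamma (\<nu> + 1) * (1 / 2) ^ Suc m / fact (Suc m)"
      using assms G by (intro divide_right_mono mult_left_mono power_mono) (auto simp: field_simps)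
    finally show ?thesis .
  qed
  moreover have s: "(\<lambda>m. rGamma (\<nu> + 1) * (1 / 2) ^ Suc m / fact (Suc m)) sums (rGamma (\<nu> + 1) * (exp (1 / 2) - 1))"
  proof -
    have "(\<lambda>m. y ^ m / fact m) sums exp y" for y :: real
      using exp_converges[of y] by (simp add: divide_inverse mult.commute)
    from this[of "1 / 2"] have "(\<lambda>m. (1 / 2 :: real) ^ Suc m / fact (Suc m)) sums (exp (1 / 2) - 1)"
      by (subst sums_Suc_iff) (simp only: power_0 fact_0 div_by_1 diff_add_cancel)
    from sums_mult[OF this, of "rGamma (\<nu> + 1)"] show ?thesis
      by (simp only: times_divide_eq_right)
  qed
  ultimately have "\<bar>\<Sum>m. bes_term t \<nu> (Suc m)\<bar> \<le> rGamma (\<nu> + 1) * (exp (1 / 2) - 1)"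
    using abs_suminf_le[OF sums_summable[OF s], of "\<lambda>m. bes_term t \<nu> (Suc m)"] unfolding sums_unique[OF s, symmetric] by blast
  also have "\<dots> < rGamma (\<nu> + 1) * 1"
  proof -
    have "exp (1 / 2 :: real) < 2"
    proof (rule power2_less_imp_less)
      have "(exp (1 / 2 :: real))\<^sup>2 = exp 1" by (simp add: power2_eq_square exp_add[symmetric])
      then show "(exp (1 / 2 :: real))\<^sup>2 < 2\<^sup>2" using exp_le by simp
    qed simp
    then show ?thesis using G by (intro mult_strict_left_mono) auto
  qed
  finally have "\<bar>\<Sum>m. bes_term t \<nu> (Suc m)\<bar> < rGamma (\<nu> + 1)" by simp
  moreover have "bes t \<nu> = rGamma (\<nu> + 1) + (\<Sum>m. bes_term t \<nu> (Suc m))"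
    unfolding bes_def using suminf_split_head[OF summable_bes_term[of t \<nu>]] by (simp add: bes_term_def)
  ultimately show ?thesis by linarith
qed

section \<open>The Bessel function as a solution of a difference equation\<close>

definition phi :: "real \<Rightarrow> real \<Rightarrow> real" where
  "phi g z = bessel_J (- z * inverse g) (2 * inverse g)"

lemma phi_eq:
  assumes "g > 0"
  shows "phi g z = inverse g powr (- z / g) * bes (inverse g) (- z / g)"
  unfolding phi_def using bessel_J_eq[OF _ summable_bes_term, of "inverse g"] assms
  by (simp add: bes_def divide_inverse)

text \<open>The classical three-term recurrence in the order \<open>\<nu> = - z / g\<close> at
  argument \<open>2 / g\<close>, where the coefficient \<open>\<nu> * g\<close> is
  \<open>- z\<close>.\<close>

lemma phi_recurrence:
  assumes "g > 0"
  shows "phi g (z + g) + phi g (z - g) = - z * phi g z"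
proof -
  define t \<nu> where "t = inverse g" and "\<nu> = - z / g"
  have t: "t > 0" using assms by (simp add: t_def)
  have nt: "\<nu> / t = - z" using assms by (simp add: t_def \<nu>_def)
  have p: "phi g z = t powr \<nu> * bes t \<nu>" by (simp only: phi_eq[OF assms] t_def \<nu>_def)
  have "- (z + g) / g = \<nu> - 1" "- (z - g) / g = \<nu> + 1" using assms by (auto simp: \<nu>_def field_simps)
  then have "phi g (z + g) + phi g (z - g) = t powr (\<nu> - 1) * bes t (\<nu> - 1) + t powr (\<nu> + 1) * bes t (\<nu> + 1)"
    by (simp add: phi_eq[OF assms] t_def)
  also have "\<dots> = t powr \<nu> / t * (bes t (\<nu> - 1) + t\<^sup>2 * bes t (\<nu> + 1))"
    using t by (simp add: powr_add powr_diff field_simps power2_eq_square)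
  also have "\<dots> = - z * phi g z"
    unfolding bes_recurrence p nt[symmetric] by simp
  finally show ?thesis .
qed

lemma isCont_phi:
  assumes "g > 0"
  shows "isCont (phi g) z"
proof -
  have "isCont (\<lambda>z. inverse g powr (- z / g) * bes (inverse g) (- z / g)) z"
    using assms by (intro continuous_intros isCont_o2[OF _ isCont_bes]) auto
  then show ?thesis using phi_eq[OF assms] by presburger
qed

text \<open>Moving left raises the order, on which \<open>bes\<close> stays bounded; only the power
  of \<open>inverse g\<close> can grow, and it does so geometrically. This separates
  \<open>phi\<close> from the faster growing solutions of the recurrence.\<close>

lemma phi_growth:
  assumes "g > 0"
  shows "\<exists>C. \<forall>n. \<bar>phi g (z - real n * g)\<bar> \<le> C * inverse g ^ n"
proof -
  obtain C where C: "\<And>\<nu>. \<nu> \<ge> - z / g \<Longrightarrow> \<bar>bes (inverse g) \<nu>\<bar> \<le> C" using bes_bounded by blast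
  have "\<bar>phi g (z - real n * g)\<bar> \<le> (inverse g powr (- z / g) * C) * inverse g ^ n" for n
  proof -
    have e: "- (z - real n * g) / g = - z / g + real n" using assms by (simp add: field_simps)
    have "\<bar>phi g (z - real n * g)\<bar> = inverse g powr (- z / g) * inverse g ^ n * \<bar>bes (inverse g) (- z / g + real n)\<bar>"
      unfolding phi_eq[OF assms] e powr_add using assms by (simp add: abs_mult powr_realpow)
    also have "\<dots> \<le> inverse g powr (- z / g) * inverse g ^ n * C"
      using assms by (intro mult_left_mono C) auto
    finally show ?thesis by (simp add: mult_ac)
  qed
  then show ?thesis by blast
qed

text \<open>Far enough to the left the order is large and \<open>bes_pos\<close> applies. It
  prevents \<open>phi\<close> from vanishing along a whole progression.\<close>

lemma phi_nonzero:
  assumes "g > 0"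
  shows "\<exists>n. phi g (z - real n * g) \<noteq> 0"
proof -
  define t where "t = inverse g"
  obtain n :: nat where n: "real n \<ge> \<bar>z / g\<bar> + 2 * t\<^sup>2" using real_arch_simple by blast
  have e: "- (z - real n * g) / g = - z / g + real n" using assms by (simp add: field_simps)
  have "bes t (- z / g + real n) > 0"
  proof (rule bes_pos)
    have "- z / g = - (z / g)" by simp
    then show "0 \<le> - z / g + real n" "2 * t\<^sup>2 \<le> - z / g + real n + 1"
      using n abs_ge_self[of "z / g"] zero_le_power2[of t] by linarith+
  qed
  then have "phi g (z - real n * g) \<noteq> 0"
    unfolding phi_eq[OF assms] e using assms by (simp add: t_def)
  then show ?thesis by blast
qed

section \<open>Resolvents and the difference equation\<close>

text \<open>The total mass at most 1 bounds the tail by its largest kernel, uniformly in the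
  weights. With \<open>J = 0\<close> it serves as a bound for the whole series.\<close>

lemma weighted_tail:
  fixes a t :: "nat \<Rightarrow> real"
  assumes a: "\<And>j. a j \<ge> 0" "\<And>m. (\<Sum>j<m. a j) \<le> 1" and t: "\<And>j. j \<ge> J \<Longrightarrow> \<bar>t j\<bar> \<le> e"
  shows "summable (\<lambda>j. a j * t j)" "\<bar>(\<Sum>j. a j * t j) - (\<Sum>j<J. a j * t j)\<bar> \<le> e"
proof -
  have sa: "summable a" using a by (intro summableI_nonneg_bounded[where x = 1]) auto
  then have sJ: "summable (\<lambda>j. a (j + J))" by (simp add: summable_iff_shift)
  have b: "\<bar>a (j + J) * t (j + J)\<bar> \<le> e * a (j + J)" for j
    using mult_left_mono[OF t[of "j + J"] a(1)[of "j + J"]] a(1)[of "j + J"] by (simp add: abs_mult mult.commute)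
  have sr: "summable (\<lambda>j. \<bar>a (j + J) * t (j + J)\<bar>)"
    by (rule summable_comparison_test'[OF summable_mult[OF sJ, of e]]) (use b in auto)
  then have s: "summable (\<lambda>j. a (j + J) * t (j + J))" by (rule summable_rabs_cancel)
  then show sm: "summable (\<lambda>j. a j * t j)" by (subst (asm) summable_iff_shift)
  have e0: "e \<ge> 0" using t[of J] abs_ge_zero[of "t J"] by linarith
  have "(\<Sum>j. a (j + J)) \<le> suminf a"
    using suminf_split_initial_segment[OF sa, of J] a(1) by (simp add: sum_nonneg)
  also have "\<dots> \<le> 1" using a by (intro suminf_le_const[OF sa]) auto
  finally have le1: "(\<Sum>j. a (j + J)) \<le> 1" .
  have "\<bar>\<Sum>j. a (j + J) * t (j + J)\<bar> \<le> (\<Sum>j. \<bar>a (j + J) * t (j + J)\<bar>)" by (rule summable_rabs[OF sr])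
  also have "\<dots> \<le> (\<Sum>j. e * a (j + J))" by (rule suminf_le[OF b sr summable_mult[OF sJ]])
  also have "\<dots> = e * (\<Sum>j. a (j + J))" by (rule suminf_mult[OF sJ])
  also have "\<dots> \<le> e" using le1 e0 mult_left_mono by fastforce
  finally show "\<bar>(\<Sum>j. a j * t j) - (\<Sum>j<J. a j * t j)\<bar> \<le> e"
    using suminf_split_initial_segment[OF sm, of J] by simp
qed

text \<open>Weights may escape to infinity, so mere convergence of each weight would not do; but
  escaping mass meets only small kernels. The limit weights may have total mass below 1.\<close>

lemma weighted_limit:
  fixes a t :: "nat \<Rightarrow> nat \<Rightarrow> real"
  assumes a: "\<And>k j. a k j \<ge> 0" "\<And>k m. (\<Sum>j<m. a k j) \<le> 1"
    and A: "\<And>j. (\<lambda>k. a k j) \<longlonglongrightarrow> A j" and T: "\<And>j. (\<lambda>k. t k j) \<longlonglongrightarrow> T j"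
    and tail: "\<And>e. e > 0 \<Longrightarrow> \<exists>J. \<forall>\<^sub>F k in sequentially. \<forall>j\<ge>J. \<bar>t k j\<bar> \<le> e"
  shows "(\<lambda>k. \<Sum>j. a k j * t k j) \<longlonglongrightarrow> (\<Sum>j. A j * T j)"
proof (rule LIMSEQ_I)
  fix r :: real assume r: "r > 0"
  define e where "e = r / 4"
  have e: "e > 0" using r by (simp add: e_def)
  obtain J where J: "\<forall>\<^sub>F k in sequentially. \<forall>j\<ge>J. \<bar>t k j\<bar> \<le> e" using tail[OF e] by blast
  have A0: "A j \<ge> 0" for j using LIMSEQ_le_const[OF A] a(1) by blast
  have A1: "(\<Sum>j<m. A j) \<le> 1" for m
    using LIMSEQ_le_const2[OF tendsto_sum[of "{..<m}" "\<lambda>j k. a k j", OF A]] a(2) by blast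
  have TJ: "\<bar>T j\<bar> \<le> e" if "j \<ge> J" for j
    by (rule tendsto_upperbound[OF tendsto_rabs[OF T]]) (use J that in \<open>auto elim: eventually_mono\<close>)
  have "(\<lambda>k. \<Sum>j<J. a k j * t k j) \<longlonglongrightarrow> (\<Sum>j<J. A j * T j)"
    by (intro tendsto_intros A T)
  then have "\<forall>\<^sub>F k in sequentially. dist (\<Sum>j<J. a k j * t k j) (\<Sum>j<J. A j * T j) < e"
    using e by (rule tendstoD)
  with J have "\<forall>\<^sub>F k in sequentially. norm ((\<Sum>j. a k j * t k j) - (\<Sum>j. A j * T j)) < r"
  proof eventually_elim
    case (elim k)
    have "\<bar>(\<Sum>j. a k j * t k j) - (\<Sum>j<J. a k j * t k j)\<bar> \<le> e"
      by (rule weighted_tail(2)) (use a elim in auto)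
    moreover have "\<bar>(\<Sum>j. A j * T j) - (\<Sum>j<J. A j * T j)\<bar> \<le> e"
      by (rule weighted_tail(2)) (use A0 A1 TJ in auto)
    ultimately show ?case using elim(2) e unfolding e_def dist_real_def real_norm_def by linarith
  qed
  then show "\<exists>no. \<forall>n\<ge>no. norm ((\<Sum>j. a n j * t n j) - (\<Sum>j. A j * T j)) < r"
    by (simp add: eventually_sequentially)
qed

text \<open>Linear growth of the poles makes \<open>1 / (l k j - z k)\<close> small for large
  \<open>j\<close>, uniformly in the eventual \<open>k\<close>; this is the tail condition of
  \<open>weighted_limit\<close>.\<close>

lemma resolvent_tail:
  fixes l :: "nat \<Rightarrow> nat \<Rightarrow> real"
  assumes g: "g > 0" and l: "\<forall>\<^sub>F k in sequentially. \<forall>j. l k j \<ge> g * real j - C"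
    and z: "z \<longlonglongrightarrow> \<zeta>" and e: "e > 0"
  shows "\<exists>J. \<forall>\<^sub>F k in sequentially. \<forall>j\<ge>J. \<bar>1 / (l k j - z k)\<bar> \<le> e"
proof -
  obtain J :: nat where J: "real J \<ge> (1 / e + C + \<zeta> + 1) / g" using real_arch_simple by blast
  have "\<forall>\<^sub>F k in sequentially. z k < \<zeta> + 1" using z by (rule order_tendstoD) simp
  with l have "\<forall>\<^sub>F k in sequentially. \<forall>j\<ge>J. \<bar>1 / (l k j - z k)\<bar> \<le> e"
  proof eventually_elim
    case (elim k)
    show ?case
    proof (intro allI impI)
      fix j assume "j \<ge> J"
      then have "(1 / e + C + \<zeta> + 1) / g \<le> real j" using J by linarith
      then have "1 / e + C + \<zeta> + 1 \<le> g * real j" using g by (simp only: pos_divide_le_eq mult.commute)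
      then have "l k j - z k \<ge> 1 / e" using elim(1)[rule_format, of j] elim(2) by linarith
      moreover have e': "1 / e > 0" using e by simp
      ultimately have pos: "0 < l k j - z k" by linarith
      have "1 / (l k j - z k) \<le> 1 / (1 / e)"
        by (rule divide_left_mono[OF _ zero_le_one mult_pos_pos[OF pos e']]) fact
      then show "\<bar>1 / (l k j - z k)\<bar> \<le> e" using pos by simp
    qed
  qed
  then show ?thesis by blast
qed

lemma avoiding_sequence:
  fixes \<zeta> :: real
  assumes "countable B"
  obtains z where "z \<longlonglongrightarrow> \<zeta>" "\<And>k. z k \<notin> B" "\<And>k. z k > \<zeta>"
proof -
  have "\<exists>w. w \<in> {\<zeta><..<\<zeta> + 1 / real (Suc k)} - B" for k
  proof -
    have "uncountable {\<zeta><..<\<zeta> + 1 / real (Suc k)}" by (simp add: uncountable_open_interval)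
    then have "uncountable ({\<zeta><..<\<zeta> + 1 / real (Suc k)} - B)" using assms uncountable_minus_countable by blast
    then show ?thesis by (metis ex_in_conv countable_empty)
  qed
  then obtain z where z: "\<And>k. z k \<in> {\<zeta><..<\<zeta> + 1 / real (Suc k)} - B" by metis
  have "z \<longlonglongrightarrow> \<zeta>"
  proof (rule tendsto_sandwich[of "\<lambda>_. \<zeta>" _ _ "\<lambda>k. \<zeta> + 1 / real (Suc k)"])
    show "(\<lambda>k. \<zeta> + 1 / real (Suc k)) \<longlonglongrightarrow> \<zeta>"
      using tendsto_add[OF tendsto_const LIMSEQ_Suc[OF lim_1_over_n], of \<zeta>] by simp
    show "\<forall>\<^sub>F k in sequentially. \<zeta> \<le> z k" "\<forall>\<^sub>F k in sequentially. z k \<le> \<zeta> + 1 / real (Suc k)"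
      using z by (auto intro!: always_eventually less_imp_le)
  qed simp
  then show thesis using that[of z] z by (simp add: greaterThanLessThan_iff)
qed

section \<open>Resolvents of discrete measures with separated atoms\<close>

locale spectrum =
  fixes g :: real and l q :: "nat \<Rightarrow> real"
  assumes g: "g > 0" and gap: "\<And>j. l j + g \<le> l (Suc j)"
    and q_nonneg: "\<And>j. q j \<ge> 0" and q_sum: "\<And>m. (\<Sum>j<m. q j) \<le> 1"
begin

text \<open>The sign is opposite to that of the Cauchy transform, so that \<open>S\<close> is
  nonnegative to the left of all atoms.\<close>

definition S :: "real \<Rightarrow> real" where
  "S z = (\<Sum>j. q j * (1 / (l j - z)))"

lemma l_lower: "l 0 + g * real j \<le> l j"
proof (induction j)
  case (Suc j)
  then show ?case using gap[of j] by (simp add: algebra_simps)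
qed simp

lemma l_gap: "i < j \<Longrightarrow> l i + g \<le> l j"
proof (induction j)
  case (Suc j)
  then show ?case using gap[of j] g by (cases "i = j") auto
qed simp

lemma l_strict: "i < j \<Longrightarrow> l i < l j"
  using l_gap[of i j] g by auto

lemma resolvent_tail_const:
  assumes "z \<longlonglongrightarrow> \<zeta>" "e > 0"
  shows "\<exists>J. \<forall>\<^sub>F k in sequentially. \<forall>j\<ge>J. \<bar>1 / (l j - z k)\<bar> \<le> e"
proof (rule resolvent_tail[OF g _ assms])
  show "\<forall>\<^sub>F k in sequentially. \<forall>j. l j \<ge> g * real j - (- l 0)"
    using l_lower by (intro always_eventually allI) (simp add: add.commute)
qed

lemma S_summable: "summable (\<lambda>j. q j * (1 / (l j - z)))"
proof -
  obtain J where "\<forall>\<^sub>F k in sequentially. \<forall>j\<ge>J. \<bar>1 / (l j - z)\<bar> \<le> 1"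
    using resolvent_tail_const[of "\<lambda>_. z" z 1] by auto
  then have J: "\<And>j. j \<ge> J \<Longrightarrow> \<bar>1 / (l j - z)\<bar> \<le> 1" by (auto simp: eventually_sequentially)
  show ?thesis
    by (rule weighted_tail(1)[of q J _ 1]) (use q_nonneg q_sum J in auto)
qed

lemma S_tendsto:
  assumes "z \<longlonglongrightarrow> \<zeta>" "\<zeta> \<notin> range l"
  shows "(\<lambda>k. S (z k)) \<longlonglongrightarrow> S \<zeta>"
  unfolding S_def
proof (rule weighted_limit)
  show "q j \<ge> 0" for j by (rule q_nonneg)
  show "(\<lambda>k. 1 / (l j - z k)) \<longlonglongrightarrow> 1 / (l j - \<zeta>)" for j
    using assms by (intro tendsto_intros) auto
qed (use q_sum resolvent_tail_const[OF assms(1)] in auto)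

lemma S_le:
  assumes "z < l 0"
  shows "0 \<le> S z" "S z \<le> 1 / (l 0 - z)"
proof -
  have le: "l 0 \<le> l j" for j using l_strict[of 0 j] by (cases j) auto
  have b: "0 \<le> 1 / (l j - z)" "1 / (l j - z) \<le> 1 / (l 0 - z)" for j
    using assms le[of j] by (auto intro!: divide_left_mono mult_pos_pos)
  show "0 \<le> S z" unfolding S_def
    using b(1) q_nonneg by (intro suminf_nonneg S_summable mult_nonneg_nonneg) auto
  have "\<bar>S z - (\<Sum>j<0. q j * (1 / (l j - z)))\<bar> \<le> 1 / (l 0 - z)" unfolding S_def
    by (rule weighted_tail(2)) (use q_nonneg q_sum b in auto)
  then show "S z \<le> 1 / (l 0 - z)" by simp
qed

text \<open>By the gap \<open>g\<close> every other atom is at distance at least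
  \<open>g / 2\<close> from \<open>z\<close>. For \<open>q i = 0\<close> the lemma says that
  \<open>S\<close> stays bounded near \<open>l i\<close>.\<close>

lemma S_pole_split:
  assumes "\<bar>z - l i\<bar> \<le> g / 2"
  shows "\<bar>S z - q i * (1 / (l i - z))\<bar> \<le> 2 / g"
proof -
  define q' where "q' j = (if j = i then 0 else q j)" for j
  have eqj: "q j * (1 / (l j - z)) = q' j * (1 / (l j - z)) + (if j = i then q i * (1 / (l i - z)) else 0)" for j
    by (cases "j = i") (auto simp: q'_def)
  have eq: "S z = (\<Sum>j. q' j * (1 / (l j - z)) + (if j = i then q i * (1 / (l i - z)) else 0))"
    unfolding S_def by (rule suminf_cong[OF eqj])
  have q': "q' j \<ge> 0" "(\<Sum>j<m. q' j) \<le> 1" for j m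
  proof -
    show "q' j \<ge> 0" using q_nonneg[of j] by (simp add: q'_def)
    have "(\<Sum>j<m. q' j) \<le> (\<Sum>j<m. q j)" using q_nonneg by (intro sum_mono) (auto simp: q'_def)
    then show "(\<Sum>j<m. q' j) \<le> 1" using q_sum[of m] by simp
  qed
  define t where "t j = (if j = i then 0 else 1 / (l j - z))" for j
  have t: "\<bar>t j\<bar> \<le> 2 / g" for j
  proof (cases "j = i")
    case False
    moreover have "l i - g / 2 \<le> z" "z \<le> l i + g / 2" using assms unfolding abs_diff_le_iff by auto
    ultimately have "g / 2 \<le> l j - z \<or> g / 2 \<le> - (l j - z)"
      using l_gap[of i j] l_gap[of j i] by (cases "i < j") auto
    then have ge: "g / 2 \<le> \<bar>l j - z\<bar>" using abs_ge_self[of "l j - z"] abs_ge_minus_self[of "l j - z"] by linarith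
    have g2: "0 < g / 2" using g by simp
    have "1 / \<bar>l j - z\<bar> \<le> 1 / (g / 2)"
      by (rule divide_left_mono[OF ge zero_le_one mult_pos_pos[OF less_le_trans[OF g2 ge] g2]])
    then show ?thesis using False by (simp add: t_def)
  qed (use g in \<open>simp add: t_def\<close>)
  have tq: "q' j * (1 / (l j - z)) = q' j * t j" for j by (simp add: q'_def t_def)
  have s: "summable (\<lambda>j. q' j * (1 / (l j - z)))" unfolding tq
    by (rule weighted_tail(1)[OF q', of 0 t "2 / g"]) (use t in auto)
  have "\<bar>(\<Sum>j. q' j * t j) - (\<Sum>j<0. q' j * t j)\<bar> \<le> 2 / g"
    by (rule weighted_tail(2)[OF q']) (use t in auto)
  then have b: "\<bar>\<Sum>j. q' j * (1 / (l j - z))\<bar> \<le> 2 / g" unfolding tq by simp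
  have "(\<lambda>j. if j = i then q i * (1 / (l i - z)) else 0) sums (q i * (1 / (l i - z)))"
    by (rule sums_single)
  from sums_unique[OF sums_add[OF summable_sums[OF s] this], symmetric]
  have "S z = (\<Sum>j. q' j * (1 / (l j - z))) + q i * (1 / (l i - z))"
    unfolding eq .
  then show ?thesis using b by simp
qed

end

section \<open>The poles as zeros of a solution of the recurrence\<close>

locale spectrum_equation = spectrum +
  fixes \<phi> :: "real \<Rightarrow> real"
  assumes q_pos: "\<And>j. q j > 0"
    and S_eq: "\<And>z. z \<notin> range l \<Longrightarrow> z + g \<notin> range l \<Longrightarrow> (- z - S z) * S (z + g) = 1"
    and rec: "\<And>z. \<phi> (z + g) + \<phi> (z - g) = - z * \<phi> z"
    and cont: "\<And>z. isCont \<phi> z"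
    and growth: "\<And>z. \<exists>C T. T \<ge> 0 \<and> (\<forall>n. \<bar>\<phi> (z - real n * g)\<bar> \<le> C * T ^ n)"
    and nonzero: "\<And>z. \<exists>n. \<phi> (z - real n * g) \<noteq> 0"
begin

definition D :: "real \<Rightarrow> real" where
  "D z = \<phi> z * S z - \<phi> (z - g)"

lemma D_step:
  assumes "z \<notin> range l" "z - g \<notin> range l"
  shows "D z = S z * D (z - g)"
proof -
  have e: "(- (z - g) - S (z - g)) * S z = 1" using S_eq[of "z - g"] assms by simp
  have r: "\<phi> z + \<phi> (z - g - g) = - (z - g) * \<phi> (z - g)" using rec[of "z - g"] by simp
  have "S z * D (z - g) = S z * (\<phi> (z - g) * S (z - g) + \<phi> z - (\<phi> z + \<phi> (z - g - g)))"
    by (simp add: D_def algebra_simps)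
  also have "\<dots> = \<phi> z * S z - ((- (z - g) - S (z - g)) * S z) * \<phi> (z - g)"
    unfolding r by (simp add: algebra_simps)
  finally show ?thesis unfolding e by (simp add: D_def)
qed

text \<open>Iterating \<open>D_step\<close> to the left expresses \<open>D z\<close> by a product of
  values of \<open>S\<close>. Far to the left each of these is at most
  \<open>1 / (2 * (T + 1))\<close>, while \<open>D\<close> itself grows at most like
  \<open>T ^ m\<close>, so the product tends to 0 like \<open>(1 / 2) ^ m\<close>. Genericity keeps
  the whole progression off the poles.\<close>

lemma D_generic:
  assumes gen: "\<And>n. z - real n * g \<notin> range l"
  shows "D z = 0"
proof -
  define E where "E n = D (z - real n * g)" for n
  have step: "E n = S (z - real n * g) * E (Suc n)" for n
    using D_step[of "z - real n * g"] gen[of n] gen[of "Suc n"] by (simp add: E_def algebra_simps)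
  obtain C T where CT: "T \<ge> 0" "\<And>n. \<bar>\<phi> (z - real n * g)\<bar> \<le> C * T ^ n" using growth[of z] by blast
  have C0: "C \<ge> 0" using CT(2)[of 0] by simp
  obtain N :: nat where N: "real N \<ge> (2 * (T + 1) + \<bar>l 0\<bar> + \<bar>z\<bar>) / g" using real_arch_simple by blast
  have small: "0 \<le> S (z - real n * g)" "S (z - real n * g) \<le> 1 / (2 * (T + 1))" if "n \<ge> N" for n
  proof -
    have "2 * (T + 1) + \<bar>l 0\<bar> + \<bar>z\<bar> \<le> real N * g" using N g by (simp add: pos_divide_le_eq)
    also have "\<dots> \<le> real n * g" using that g by (intro mult_right_mono) auto
    finally have b: "l 0 - (z - real n * g) \<ge> 2 * (T + 1)" by linarith
    moreover have "2 * (T + 1) > 0" using CT(1) by simp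
    ultimately have "z - real n * g < l 0" by argo
    note S = S_le[OF this]
    show "0 \<le> S (z - real n * g)" by (rule S(1))
    have "1 / (l 0 - (z - real n * g)) \<le> 1 / (2 * (T + 1))" using b CT(1) by (intro divide_left_mono mult_pos_pos) auto
    then show "S (z - real n * g) \<le> 1 / (2 * (T + 1))" using S(2) by linarith
  qed
  have small1: "S (z - real n * g) \<le> 1" if "n \<ge> N" for n
    using small(2)[OF that] CT(1) by (smt (verit) divide_le_eq_1_pos)
  define K where "K = C * T ^ N * (1 + T)"
  have K0: "K \<ge> 0" using C0 CT(1) by (simp add: K_def)
  have Eb: "\<bar>E (N + m)\<bar> \<le> K * T ^ m" for m
  proof -
    let ?w = "z - real (N + m) * g"
    have w: "?w - g = z - real (Suc (N + m)) * g" by (simp add: algebra_simps)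
    have "\<bar>S ?w\<bar> \<le> 1" using small(1)[of "N + m"] small1[of "N + m"] by simp
    then have "\<bar>\<phi> ?w\<bar> * \<bar>S ?w\<bar> \<le> (C * T ^ (N + m)) * 1"
      using CT(1) C0 CT(2)[of "N + m"] by (intro mult_mono) auto
    moreover have "\<bar>\<phi> (?w - g)\<bar> \<le> C * T ^ Suc (N + m)" unfolding w by (rule CT(2))
    ultimately have "\<bar>E (N + m)\<bar> \<le> C * T ^ (N + m) + C * T ^ Suc (N + m)"
      unfolding E_def D_def using abs_triangle_ineq4[of "\<phi> ?w * S ?w" "\<phi> (?w - g)"] by (simp only: abs_mult)
    also have "\<dots> = K * T ^ m" by (simp add: K_def power_add algebra_simps)
    finally show ?thesis .
  qed
  have EN: "\<bar>E N\<bar> \<le> (1 / (2 * (T + 1))) ^ m * \<bar>E (N + m)\<bar>" for m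
  proof (induction m)
    case (Suc m)
    have "\<bar>E (N + m)\<bar> = S (z - real (N + m) * g) * \<bar>E (N + Suc m)\<bar>"
      using step[of "N + m"] small(1)[of "N + m"] by (simp add: abs_mult)
    also have "\<dots> \<le> 1 / (2 * (T + 1)) * \<bar>E (N + Suc m)\<bar>" using small(2)[of "N + m"] by (intro mult_right_mono) auto
    finally have "(1 / (2 * (T + 1))) ^ m * \<bar>E (N + m)\<bar> \<le> (1 / (2 * (T + 1))) ^ m * (1 / (2 * (T + 1)) * \<bar>E (N + Suc m)\<bar>)"
      using CT(1) by (intro mult_left_mono) auto
    with Suc show ?case by (simp add: mult_ac)
  qed simp
  have "\<bar>E N\<bar> \<le> K * (1 / 2) ^ m" for m
  proof -
    have "\<bar>E N\<bar> \<le> (1 / (2 * (T + 1))) ^ m * (K * T ^ m)"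
      by (rule order_trans[OF EN[of m] mult_left_mono[OF Eb[of m]]]) (use CT(1) in simp)
    also have "\<dots> = K * (1 / (2 * (T + 1)) * T) ^ m" by (simp only: power_mult_distrib mult_ac)
    also have "\<dots> \<le> K * (1 / 2) ^ m"
      using K0 CT(1) by (intro mult_left_mono power_mono) (auto simp: field_simps)
    finally show ?thesis .
  qed
  moreover have "(\<lambda>m. K * (1 / 2) ^ m) \<longlonglongrightarrow> K * 0"
    by (intro tendsto_intros LIMSEQ_power_zero) auto
  ultimately have "\<bar>E N\<bar> \<le> 0" using LIMSEQ_le_const by fastforce
  then have EN0: "E N = 0" by simp
  \<comment> \<open>The vanishing at index \<open>N\<close>, where the smallness of \<open>S\<close>
    sets in, is carried back to index 0 by \<open>step\<close>.\<close>
  have "E (N - k) = 0" for k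
  proof (induction k)
    case (Suc k)
    show ?case
    proof (cases "N - k = 0")
      case False
      then have "Suc (N - Suc k) = N - k" by auto
      then show ?thesis using step[of "N - Suc k"] Suc by simp
    qed (use Suc in simp)
  qed (use EN0 in simp)
  from this[of N] show ?thesis by (simp add: E_def)
qed

text \<open>Only countably many points have a pole on the progression to their left, so every point
  is approached by generic ones, here from the right.\<close>

lemma generic_sequence:
  obtains z where "z \<longlonglongrightarrow> \<zeta>" "\<And>k. D (z k) = 0" "\<And>k. z k \<notin> range l" "\<And>k. z k > \<zeta>"
proof -
  define B where "B = (\<Union>n. \<Union>j. {l j + real n * g})"
  have cB: "countable B" unfolding B_def by (intro countable_UN) auto
  obtain z where lim: "z \<longlonglongrightarrow> \<zeta>" and z: "\<And>k. z k \<notin> B" "\<And>k. z k > \<zeta>"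
    by (rule avoiding_sequence[OF cB, of \<zeta>]) (rule that)
  have gen: "z k - real n * g \<notin> range l" for k n
  proof
    assume "z k - real n * g \<in> range l"
    then obtain j where "z k = l j + real n * g" by (auto simp: algebra_simps)
    then show False using z(1)[of k] by (auto simp: B_def)
  qed
  show thesis
  proof (rule that[OF lim])
    show "D (z k) = 0" for k by (rule D_generic[OF gen])
    show "z k \<notin> range l" for k using gen[of k 0] by simp
    show "z k > \<zeta>" for k by (rule z(2))
  qed
qed

text \<open>Off the poles \<open>D = 0\<close> passes to the limit and gives
  \<open>\<phi> (\<zeta> - g) = \<phi> \<zeta> * S \<zeta> = 0\<close>. Two neighbouring zeros
  propagate along the recurrence to all \<open>\<zeta> - n * g\<close>, against
  \<open>nonzero\<close>.\<close>

lemma zero_in_spectrum: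
  assumes 0: "\<phi> \<zeta> = 0"
  shows "\<zeta> \<in> range l"
proof (rule ccontr)
  assume nl: "\<zeta> \<notin> range l"
  obtain z where z: "z \<longlonglongrightarrow> \<zeta>" "\<And>k. D (z k) = 0" "\<And>k. z k \<notin> range l" "\<And>k. z k > \<zeta>"
    by (rule generic_sequence[of \<zeta>]) (rule that)
  have lim1: "(\<lambda>k. \<phi> (z k) * S (z k)) \<longlonglongrightarrow> \<phi> \<zeta> * S \<zeta>"
    by (rule tendsto_mult[OF isCont_tendsto_compose[OF cont z(1)] S_tendsto[OF z(1) nl]])
  have lim2: "(\<lambda>k. \<phi> (z k - g)) \<longlonglongrightarrow> \<phi> (\<zeta> - g)"
    by (rule isCont_tendsto_compose[OF cont tendsto_diff[OF z(1) tendsto_const]])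
  have eq: "\<phi> (z k) * S (z k) = \<phi> (z k - g)" for k using z(2)[of k] by (simp add: D_def)
  have 1: "\<phi> (\<zeta> - g) = 0" using LIMSEQ_unique[OF lim1[unfolded eq] lim2] unfolding 0 by simp
  have "\<phi> (\<zeta> - real n * g) = 0 \<and> \<phi> (\<zeta> - real (Suc n) * g) = 0" for n
  proof (induction n)
    case (Suc n)
    have e: "\<zeta> - real (Suc n) * g + g = \<zeta> - real n * g"
      "\<zeta> - real (Suc n) * g - g = \<zeta> - real (Suc (Suc n)) * g" by (simp_all add: algebra_simps)
    have "\<phi> (\<zeta> - real n * g) + \<phi> (\<zeta> - real (Suc (Suc n)) * g)
        = - (\<zeta> - real (Suc n) * g) * \<phi> (\<zeta> - real (Suc n) * g)"
      using rec[of "\<zeta> - real (Suc n) * g"] unfolding e .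
    then have "\<phi> (\<zeta> - real (Suc (Suc n)) * g) = 0"
      unfolding Suc.IH[THEN conjunct1] Suc.IH[THEN conjunct2] by simp
    then show ?case using Suc.IH[THEN conjunct2] by (rule conjI[rotated])
  next
    case 0
    then show ?case using assms 1 by (simp only: of_nat_0 of_nat_Suc mult_zero_left add_0 add_0_right mult_1 diff_0_right)
  qed
  then show False using nonzero[of \<zeta>] by blast
qed

text \<open>Multiplying \<open>\<phi> z * S z = \<phi> (z - g)\<close> by \<open>l i - z\<close> and
  letting \<open>z\<close> tend to \<open>l i\<close> leaves \<open>\<phi> (l i) * q i = 0\<close>;
  this is where positive mass at every atom is essential.\<close>

lemma spectrum_zero: "\<phi> (l i) = 0"
proof -
  define \<zeta> where i: "\<zeta> = l i"
  obtain z where z: "z \<longlonglongrightarrow> \<zeta>" "\<And>k. D (z k) = 0" "\<And>k. z k \<notin> range l" "\<And>k. z k > \<zeta>"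
    by (rule generic_sequence[of \<zeta>]) (rule that)
  define R where "R k = S (z k) - q i * (1 / (l i - z k))" for k
  have "\<forall>\<^sub>F k in sequentially. z k < \<zeta> + g / 2" using z(1) g by (intro order_tendstoD) auto
  then have R: "\<forall>\<^sub>F k in sequentially. norm (R k) \<le> 2 / g"
  proof eventually_elim
    case (elim k)
    then show ?case unfolding R_def using S_pole_split[of "z k" i] z(4)[of k] by (simp add: i)
  qed
  have lz: "(\<lambda>k. l i - z k) \<longlonglongrightarrow> l i - l i" by (intro tendsto_intros) (use z(1) i in simp)
  have RR: "(\<lambda>k. (l i - z k) * R k) \<longlonglongrightarrow> 0"
    by (rule lim_null_mult_right_bounded[OF _ R]) (use lz in simp)
  have eq: "(l i - z k) * \<phi> (z k - g) = \<phi> (z k) * (q i + (l i - z k) * R k)" for k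
  proof -
    have "l i - z k \<noteq> 0" using z(4)[of k] i by simp
    then have "(l i - z k) * (q i * (1 / (l i - z k))) = q i" by simp
    then have "q i + (l i - z k) * R k = (l i - z k) * S (z k)" unfolding R_def right_diff_distrib by simp
    moreover have "\<phi> (z k) * S (z k) = \<phi> (z k - g)" using z(2)[of k] by (simp add: D_def)
    ultimately show ?thesis by (metis mult.left_commute)
  qed
  have lim1: "(\<lambda>k. (l i - z k) * \<phi> (z k - g)) \<longlonglongrightarrow> (l i - l i) * \<phi> (\<zeta> - g)"
    by (rule tendsto_mult[OF lz isCont_tendsto_compose[OF cont tendsto_diff[OF z(1) tendsto_const]]])
  have lim2: "(\<lambda>k. \<phi> (z k) * (q i + (l i - z k) * R k)) \<longlonglongrightarrow> \<phi> \<zeta> * (q i + 0)"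
    by (rule tendsto_mult[OF isCont_tendsto_compose[OF cont z(1)] tendsto_add[OF tendsto_const RR]])
  have "\<phi> \<zeta> * q i = 0" using LIMSEQ_unique[OF lim1[unfolded eq] lim2] by simp
  moreover have "q i \<noteq> 0" using q_pos[of i] by linarith
  ultimately have "\<phi> \<zeta> = 0" by (simp only: mult_eq_0_iff) blast
  then show ?thesis unfolding i .
qed

lemma zeros: "{z. \<phi> z = 0} = range l"
proof (rule set_eqI, rule iffI)
  fix \<zeta> assume "\<zeta> \<in> {z. \<phi> z = 0}"
  then show "\<zeta> \<in> range l" unfolding mem_Collect_eq by (rule zero_in_spectrum)
next
  fix \<zeta> assume "\<zeta> \<in> range l"
  then obtain i where i: "\<zeta> = l i" by (rule rangeE)
  show "\<zeta> \<in> {z. \<phi> z = 0}" unfolding i mem_Collect_eq by (rule spectrum_zero)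
qed

end

section \<open>Recovering the weights of a discrete measure from its resolvent\<close>

lemma resolvent_power_series:
  fixes w l :: "nat \<Rightarrow> real"
  assumes w: "\<And>j. w j \<ge> 0" "\<And>m. (\<Sum>j<m. w j) \<le> 1" and l: "\<And>j. l j \<ge> l 0" and z: "\<zeta> < l 0"
    and h: "\<bar>h\<bar> \<le> (l 0 - \<zeta>) / 2"
  shows "(\<lambda>m. (\<Sum>j. w j * (1 / (l j - \<zeta>)) ^ Suc m) * h ^ m) sums (\<Sum>j. w j * (1 / (l j - (\<zeta> + h))))"
proof -
  define t where "t j = 1 / (l j - \<zeta>)" for j
  define t0 where "t0 = t 0"
  have t0: "t0 > 0" using z by (simp add: t0_def t_def)
  have t: "0 < t j" "t j \<le> t0" for j
    using l[of j] z by (auto simp: t_def t0_def intro!: divide_left_mono mult_pos_pos)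
  have ht0: "\<bar>h\<bar> * t0 \<le> 1 / 2" using h z by (simp add: t0_def t_def field_simps)
  have ht: "\<bar>h * t j\<bar> \<le> 1 / 2" for j
    using mult_left_mono[OF t(2)[of j], of "\<bar>h\<bar>"] t(1)[of j] ht0 by (simp add: abs_mult)
  have ex: "1 / (l j - (\<zeta> + h)) - (\<Sum>m<M. h ^ m * t j ^ Suc m) = t j * (h * t j) ^ M / (1 - h * t j)" for j M
  proof -
    have lj: "l j - \<zeta> \<noteq> 0" using l[of j] z by auto
    have ne: "1 - h * t j \<noteq> 0" using ht[of j] by auto
    have "l j - (\<zeta> + h) = (1 - h * t j) / t j" using lj by (simp add: t_def field_simps)
    then have 1: "1 / (l j - (\<zeta> + h)) = t j / (1 - h * t j)" by simp
    have "(\<Sum>m<M. h ^ m * t j ^ Suc m) = t j * (\<Sum>m<M. (h * t j) ^ m)"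
      by (simp add: sum_distrib_left power_mult_distrib mult_ac)
    also have "(\<Sum>m<M. (h * t j) ^ m) = (1 - (h * t j) ^ M) / (1 - h * t j)"
      using ne by (simp add: sum_gp_strict)
    finally have 2: "(\<Sum>m<M. h ^ m * t j ^ Suc m) = t j * ((1 - (h * t j) ^ M) / (1 - h * t j))" .
    have "T / d - T * ((1 - X) / d) = T * X / d" for T d X :: real
      by (simp add: diff_divide_distrib right_diff_distrib)
    then show ?thesis unfolding 1 2 .
  qed
  have bound: "\<bar>1 / (l j - (\<zeta> + h)) - (\<Sum>m<M. h ^ m * t j ^ Suc m)\<bar> \<le> 2 * t0 * (1 / 2) ^ M" for j M
  proof -
    have p: "\<bar>h * t j\<bar> ^ M \<le> (1 / 2) ^ M" using ht[of j] by (intro power_mono) auto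
    have d: "1 - h * t j \<ge> 1 / 2" using ht[of j] by (auto simp: abs_le_iff)
    have "\<bar>t j * (h * t j) ^ M / (1 - h * t j)\<bar> = t j * \<bar>h * t j\<bar> ^ M / (1 - h * t j)"
      using t(1)[of j] d by (simp add: abs_mult power_abs)
    also have "\<dots> \<le> t0 * (1 / 2) ^ M / (1 / 2)"
      using t[of j] t0 p d by (intro frac_le mult_mono) (auto intro: less_imp_le)
    finally show ?thesis unfolding ex by simp
  qed
  have sm: "summable (\<lambda>j. w j * t j ^ Suc m)" for m
  proof (rule weighted_tail(1)[OF w, of 0 _ "t0 ^ Suc m"])
    show "\<bar>t j ^ Suc m\<bar> \<le> t0 ^ Suc m" for j
      unfolding power_abs using t[of j] by (intro power_mono) auto
  qed
  have smw: "summable (\<lambda>j. w j * (1 / (l j - (\<zeta> + h))))"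
  proof (rule weighted_tail(1)[OF w, of 0 _ "2 * t0 * (1 / 2) ^ 0"])
    show "\<bar>1 / (l j - (\<zeta> + h))\<bar> \<le> 2 * t0 * (1 / 2) ^ 0" for j
      using bound[of j 0] by simp
  qed
  have part: "(\<Sum>m<M. (\<Sum>j. w j * t j ^ Suc m) * h ^ m) = (\<Sum>j. w j * (\<Sum>m<M. h ^ m * t j ^ Suc m))" for M
  proof -
    have "(\<Sum>m<M. (\<Sum>j. w j * t j ^ Suc m) * h ^ m) = (\<Sum>m<M. (\<Sum>j. w j * t j ^ Suc m * h ^ m))"
      by (intro sum.cong refl suminf_mult2 sm)
    also have "\<dots> = (\<Sum>j. \<Sum>m<M. w j * t j ^ Suc m * h ^ m)"
      by (rule suminf_sum[symmetric]) (intro summable_mult2 sm)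
    finally show ?thesis by (simp add: sum_distrib_left mult_ac)
  qed
  have smp: "summable (\<lambda>j. w j * (\<Sum>m<M. h ^ m * t j ^ Suc m))" for M
  proof -
    have "summable (\<lambda>j. \<Sum>m<M. w j * t j ^ Suc m * h ^ m)" by (intro summable_sum summable_mult2 sm)
    then show ?thesis by (simp add: sum_distrib_left mult_ac)
  qed
  define F where "F = (\<Sum>j. w j * (1 / (l j - (\<zeta> + h))))"
  have "\<bar>(\<Sum>j. w j * (1 / (l j - (\<zeta> + h)))) - (\<Sum>m<M. (\<Sum>j. w j * t j ^ Suc m) * h ^ m)\<bar> \<le> 2 * t0 * (1 / 2) ^ M" for M
  proof -
    have "(\<Sum>j. w j * (1 / (l j - (\<zeta> + h)))) - (\<Sum>m<M. (\<Sum>j. w j * t j ^ Suc m) * h ^ m)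
      = (\<Sum>j. w j * (1 / (l j - (\<zeta> + h)) - (\<Sum>m<M. h ^ m * t j ^ Suc m)))"
      unfolding part right_diff_distrib by (rule suminf_diff[OF smw smp])
    moreover have "\<bar>(\<Sum>j. w j * (1 / (l j - (\<zeta> + h)) - (\<Sum>m<M. h ^ m * t j ^ Suc m)))
        - (\<Sum>j<0. w j * (1 / (l j - (\<zeta> + h)) - (\<Sum>m<M. h ^ m * t j ^ Suc m)))\<bar> \<le> 2 * t0 * (1 / 2) ^ M"
      by (rule weighted_tail(2)[OF w bound])
    ultimately show ?thesis by simp
  qed
  moreover have "(\<lambda>M. 2 * t0 * (1 / 2) ^ M) \<longlonglongrightarrow> 0"
    using tendsto_mult[OF tendsto_const[of "2 * t0"] LIMSEQ_power_zero[of "1 / 2 :: real"]] by simp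
  ultimately have "(\<lambda>M. F - (\<Sum>m<M. (\<Sum>j. w j * t j ^ Suc m) * h ^ m)) \<longlonglongrightarrow> 0"
    unfolding F_def[symmetric] real_norm_def[symmetric] by (rule Lim_null_comparison[OF always_eventually[OF allI]])
  from tendsto_diff[OF tendsto_const[of F] this]
  have "(\<lambda>M. (\<Sum>m<M. (\<Sum>j. w j * t j ^ Suc m) * h ^ m)) \<longlonglongrightarrow> F" by simp
  then show ?thesis unfolding sums_def t_def F_def .
qed


text \<open>The difference of the two resolvents is analytic near \<open>\<zeta>\<close> and
  vanishes on a sequence accumulating there, so all its Taylor coefficients, the moments in
  \<open>t j = 1 / (l j - \<zeta>)\<close>, vanish. As \<open>t\<close> decreases, high moments
  isolate the leading weight, and the weights follow one after the other.\<close>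

lemma resolvent_weights_unique:
  fixes q p l :: "nat \<Rightarrow> real"
  assumes q: "\<And>j. q j \<ge> 0" "\<And>m. (\<Sum>j<m. q j) \<le> 1" and p: "\<And>j. p j \<ge> 0" "\<And>m. (\<Sum>j<m. p j) \<le> 1"
    and l: "\<And>i j. i < j \<Longrightarrow> l i < l j" and linf: "\<And>B. \<exists>J. \<forall>j\<ge>J. l j \<ge> B" and z: "\<zeta> < l 0"
    and eq: "\<And>\<xi>. \<xi> \<in> insert \<zeta> (range (\<lambda>r. \<zeta> - 1 / real (Suc r))) \<Longrightarrow>
      (\<Sum>j. q j * (1 / (l j - \<xi>))) = (\<Sum>j. p j * (1 / (l j - \<xi>)))"
  shows "q j = p j"
proof -
  define t where "t j = 1 / (l j - \<zeta>)" for j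
  define b where "b m = (\<Sum>j. q j * t j ^ Suc m) - (\<Sum>j. p j * t j ^ Suc m)" for m
  define f where "f h = (\<Sum>j. q j * (1 / (l j - (\<zeta> + h)))) - (\<Sum>j. p j * (1 / (l j - (\<zeta> + h))))" for h
  have l0: "l 0 \<le> l j" for j using l[of 0 j] by (cases j) auto
  have pos: "l j - \<zeta> > 0" for j using l0[of j] z by simp
  have sums: "(\<lambda>m. b m * h ^ m) sums f h" if "\<bar>h\<bar> \<le> (l 0 - \<zeta>) / 2" for h
    using sums_diff[OF resolvent_power_series[of q l \<zeta> h, OF q l0 z that] resolvent_power_series[of p l \<zeta> h, OF p l0 z that]]
    by (simp add: b_def f_def t_def left_diff_distrib)
  have f0: "f 0 = 0" using eq[of \<zeta>] by (simp add: f_def)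
  have fr: "f (- 1 / real (Suc r)) = 0" for r using eq[of "\<zeta> - 1 / real (Suc r)"] by (simp add: f_def)
  have b0: "b m = 0" for m
  proof (rule ccontr)
    assume m: "b m \<noteq> 0"
    \<comment> \<open>The isolation of zeros is available for a power series that vanishes at 0 and
      has a nonzero coefficient of positive index, so the constant term is treated
      separately.\<close>
    have "b 0 = 0"
    proof -
      have "(\<lambda>m. b m * 0 ^ m) sums f 0" using z by (intro sums) simp
      moreover have "(\<lambda>m. b m * 0 ^ m) sums b 0" by (rule powser_sums_zero)
      ultimately have "f 0 = b 0" by (rule sums_unique2)
      then show ?thesis using f0 by simp
    qed
    then have "m > 0" using m by (cases m) auto
    define r where "r = (l 0 - \<zeta>) / 2"
    have r: "r > 0" using z by (simp add: r_def)
    have sm: "norm (x - 0) < r \<Longrightarrow> (\<lambda>n. b n * (x - 0) ^ n) sums (f x)" for x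
      using sums[of x] by (simp add: r_def)
    obtain s where s: "s > 0" "\<And>z. z \<in> cball 0 s - {0} \<Longrightarrow> f z \<noteq> 0"
      by (rule powser_0_nonzero[OF r sm f0 m \<open>m > 0\<close>]) (assumption, rule that)
    obtain k where k: "1 / real (Suc k) < s" by (rule nat_approx_posE[OF s(1)]) (rule that)
    have "- 1 / real (Suc k) \<in> cball 0 s - {0}" using k by (simp add: dist_norm)
    then show False using s(2) fr by blast
  qed
  show "q j = p j"
  proof (induction j rule: less_induct)
    case (less j)
    \<comment> \<open>The moments are divided by \<open>t j ^ Suc m\<close>. Indices below
      \<open>j\<close> are deleted because by induction they contribute equally to both sides; as
      \<open>m\<close> grows, only the index \<open>j\<close> survives.\<close>
    define T where "T m i = (if i < j then 0 else (t i / t j) ^ Suc m)" for m i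
    have tp: "t i > 0" for i using pos[of i] by (simp add: t_def)
    have tl: "t i < t j" if "j < i" for i
      using l[OF that] pos[of i] pos[of j] by (simp add: t_def divide_strict_left_mono)
    have T_le: "\<bar>T m i\<bar> \<le> t i / t j" if "i \<ge> j" for m i
    proof -
      have "t i / t j \<le> 1" using tl[of i] that tp[of j] by (cases "i = j") auto
      then have "(t i / t j) ^ Suc m \<le> (t i / t j) ^ 1"
        using tp[of i] tp[of j] by (intro power_decreasing) auto
      then show ?thesis using that tp[of i] tp[of j] by (simp add: T_def abs_mult)
    qed
    have lim: "(\<lambda>m. \<Sum>i. w i * T m i) \<longlonglongrightarrow> w j" if w: "\<And>i. w i \<ge> 0" "\<And>m. (\<Sum>i<m. w i) \<le> 1" for w
    proof -
      have lim: "(\<lambda>m. \<Sum>i. w i * T m i) \<longlonglongrightarrow> (\<Sum>i. w i * (if i = j then 1 else 0))"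
      proof (rule weighted_limit[OF w])
        show "(\<lambda>k. w i) \<longlonglongrightarrow> w i" for i by simp
        show "(\<lambda>m. T m i) \<longlonglongrightarrow> (if i = j then 1 else 0)" for i
        proof (cases i j rule: linorder_cases)
          case greater
          have "(\<lambda>m. (t i / t j) ^ Suc m) \<longlonglongrightarrow> 0"
            using tl[OF greater] tp[of i] tp[of j] by (intro LIMSEQ_Suc LIMSEQ_power_zero) auto
          then show ?thesis using greater by (simp add: T_def)
        qed (use tp[of j] in \<open>auto simp: T_def\<close>)
        fix e :: real assume e: "e > 0"
        obtain J where J: "\<forall>i\<ge>J. l i \<ge> \<zeta> + 1 / (e * t j)" using linf by blast
        have "\<bar>T m i\<bar> \<le> e" if "i \<ge> max j J" for m i
        proof -
          have et: "e * t j > 0" using e tp[of j] by simp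
          have "l i - \<zeta> \<ge> 1 / (e * t j)" using J that by (simp add: algebra_simps)
          then have "t i \<le> 1 / (1 / (e * t j))"
            unfolding t_def[of i] using et pos[of i] by (intro divide_left_mono mult_pos_pos) simp_all
          then have "t i / t j \<le> e" using tp[of j] by (simp add: pos_divide_le_eq)
          then show ?thesis using T_le[of i m] that by simp
        qed
        then show "\<exists>J. \<forall>\<^sub>F k in sequentially. \<forall>i\<ge>J. \<bar>T k i\<bar> \<le> e" by (intro exI[of _ "max j J"]) simp
      qed
      have "(\<lambda>i. w i * (if i = j then 1 else 0)) = (\<lambda>i. if i = j then w i else 0)" by auto
      then have "(\<lambda>i. w i * (if i = j then 1 else 0)) sums w j" using sums_single[of j w] by simp
      then have "(\<Sum>i. w i * (if i = j then 1 else 0)) = w j" by (rule sums_unique[symmetric])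
      with lim show ?thesis by simp
    qed
    have smT: "summable (\<lambda>i. w i * T m i)" if w: "\<And>i. w i \<ge> 0" "\<And>m. (\<Sum>i<m. w i) \<le> 1" for w m
    proof (rule weighted_tail(1)[OF w, of j _ 1])
      fix i assume i: "i \<ge> j"
      have "t i / t j \<le> 1" using tl[of i] i tp[of j] by (cases "i = j") auto
      then show "\<bar>T m i\<bar> \<le> 1" using T_le[OF i, of m] by simp
    qed
    have smt: "summable (\<lambda>i. w i * t i ^ Suc m)" if w: "\<And>i. w i \<ge> 0" "\<And>m. (\<Sum>i<m. w i) \<le> 1" for w m
    proof (rule weighted_tail(1)[OF w, of 0 _ "t 0 ^ Suc m"])
      show "\<bar>t i ^ Suc m\<bar> \<le> t 0 ^ Suc m" for i unfolding power_abs
        using tp[of i] l0[of i] pos[of 0] by (intro power_mono) (auto simp: t_def intro!: divide_left_mono)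
    qed
    have eqT: "(\<Sum>i. q i * T m i) = (\<Sum>i. p i * T m i)" for m
    proof -
      have "(\<Sum>i. q i * T m i) - (\<Sum>i. p i * T m i) = (\<Sum>i. q i * T m i - p i * T m i)"
        by (rule suminf_diff[OF smT smT]) (use q p in auto)
      also have "\<dots> = (\<Sum>i. (q i * t i ^ Suc m - p i * t i ^ Suc m) / t j ^ Suc m)"
        using less.IH by (intro suminf_cong) (auto simp: T_def power_divide diff_divide_distrib simp del: power_Suc)
      also have "\<dots> = (\<Sum>i. q i * t i ^ Suc m - p i * t i ^ Suc m) / t j ^ Suc m"
        by (rule suminf_divide[OF summable_diff[OF smt smt]]) (use q p in auto)
      also have "(\<Sum>i. q i * t i ^ Suc m - p i * t i ^ Suc m) = b m"
        unfolding b_def by (rule suminf_diff[OF smt smt, symmetric]) (use q p in auto)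
      finally show ?thesis using b0 by simp
    qed
    have "(\<lambda>m. \<Sum>i. q i * T m i) \<longlonglongrightarrow> p j" unfolding eqT by (rule lim[OF p])
    then show ?case by (rule LIMSEQ_unique[OF lim[OF q]])
  qed
qed

section \<open>Limits of column lengths\<close>

definition scale :: "real \<Rightarrow> nat \<Rightarrow> real" where
  "scale \<alpha> d = sqrt (\<alpha> * real d)"

text \<open>The points at which the defect is tested; they accumulate at the first of them.\<close>

definition test_points :: "real \<Rightarrow> real set" where
  "test_points g = insert (- 2 / g - 2) (range (\<lambda>r. - 2 / g - 2 - 1 / real (Suc r)))"

lemma suminf_if_less:
  "(\<Sum>j. (if j < n then f j else (0::real)) * t j) = (\<Sum>j<n. f j * t j)"
  by (subst suminf_finite[of "{..<n}"]) auto

lemma average_abs_le: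
  fixes w t :: "nat \<Rightarrow> real"
  assumes "\<And>i. i \<in> A \<Longrightarrow> 0 \<le> w i" "(\<Sum>i\<in>A. w i) \<le> 1" "\<And>i. i \<in> A \<Longrightarrow> \<bar>t i\<bar> \<le> C" "C \<ge> 0"
  shows "\<bar>\<Sum>i\<in>A. w i * t i\<bar> \<le> C"
proof -
  have "\<bar>\<Sum>i\<in>A. w i * t i\<bar> \<le> (\<Sum>i\<in>A. \<bar>w i * t i\<bar>)" by (rule sum_abs)
  also have "\<dots> \<le> (\<Sum>i\<in>A. w i * C)"
    using assms by (intro sum_mono) (simp add: abs_mult mult_left_mono)
  also have "\<dots> = (\<Sum>i\<in>A. w i) * C" by (rule sum_distrib_right[symmetric])
  also have "\<dots> \<le> C" using assms(2,4) mult_right_mono[of "\<Sum>i\<in>A. w i" 1 C] by simp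
  finally show ?thesis .
qed

text \<open>A sequence along which every scaled column and every up and down probability converges.
  The index \<open>k\<close> runs along a subsequence of sizes \<open>N k\<close>; nothing random is
  left.\<close>

locale column_sequence =
  fixes g :: real and N :: "nat \<Rightarrow> nat" and a :: "nat \<Rightarrow> real" and c :: "nat \<Rightarrow> nat \<Rightarrow> nat"
    and y Q P :: "nat \<Rightarrow> real"
  assumes g: "g > 0" and N_pos: "\<And>k. N k > 0" and a: "\<And>k. a k \<ge> 1"
    and c: "\<And>k. c k \<in> columns (N k)"
    and N_lim: "filterlim N at_top sequentially"
    and \<gamma>_lim: "(\<lambda>k. sqrt (a k) / sqrt (real (N k))) \<longlonglongrightarrow> g"
    and y_lim: "\<And>j. (\<lambda>k. real (c k j) / scale (a k) (N k)) \<longlonglongrightarrow> y j"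
    and Q_lim: "\<And>j. (\<lambda>k. if j < Suc (N k) then down_prob (a k) (Suc (N k)) (c k) j else 0) \<longlonglongrightarrow> Q j"
    and P_lim: "\<And>j. (\<lambda>k. if j < Suc (N k) then up_prob (a k) (Suc (N k)) (c k) j else 0) \<longlonglongrightarrow> P j"
    and defect_lim: "\<And>\<zeta>. \<zeta> \<in> test_points g \<Longrightarrow>
      (\<lambda>k. defect (a k) (Suc (N k)) (scale (a k) (N k)) (scale (a k) (N k) * \<zeta>) (c k)) \<longlonglongrightarrow> 0"
begin

definition s where "s k = scale (a k) (N k)"
definition \<gamma> where "\<gamma> k = a k / s k"
definition n where "n k = Suc (N k)"
definition q where "q k j = (if j < n k then down_prob (a k) (n k) (c k) j else 0)"
definition p where "p k j = (if j < n k then up_prob (a k) (n k) (c k) j else 0)"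
text \<open>The scaled poles of the cotransition transform, \<open>(content + a k) / s k\<close>.
  Those of the transition transform are \<open>L k j - \<gamma> k\<close>.\<close>

definition L where "L k j = \<gamma> k * (real j + 1) - real (c k j) / s k"
definition l where "l j = g * (real j + 1) - y j"

lemma s_pos: "s k > 0"
  using a[of k] N_pos[of k] by (simp add: s_def scale_def)

lemma s_sq: "a k * real (N k) = (s k)\<^sup>2"
  using a[of k] by (simp add: s_def scale_def)

lemma \<gamma>_eq: "\<gamma> k = sqrt (a k) / sqrt (real (N k))"
  using a[of k] N_pos[of k] by (simp add: \<gamma>_def s_def scale_def real_sqrt_mult field_simps)

lemma \<gamma>_pos: "\<gamma> k > 0"
  using a[of k] s_pos[of k] by (simp add: \<gamma>_def)

lemma a_eq: "a k = \<gamma> k * s k"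
  using s_pos[of k] by (simp add: \<gamma>_def)

lemma \<gamma>_tendsto: "\<gamma> \<longlonglongrightarrow> g"
  using \<gamma>_lim unfolding \<gamma>_eq[symmetric] .

lemma N_eq: "real (N k) = s k / \<gamma> k"
  using s_sq[of k] a_eq[of k] s_pos[of k] \<gamma>_pos[of k] by (simp add: field_simps power2_eq_square)

lemma s_inverse_tendsto: "(\<lambda>k. 1 / s k) \<longlonglongrightarrow> 0"
proof -
  have "(\<lambda>k. inverse (real (N k)) * (1 / \<gamma> k)) \<longlonglongrightarrow> 0 * (1 / g)"
    using g by (intro tendsto_intros \<gamma>_tendsto tendsto_inverse_0_at_top
        filterlim_compose[OF filterlim_real_sequentially N_lim]) auto
  moreover have "inverse (real (N k)) * (1 / \<gamma> k) = 1 / s k" for k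
    using s_pos[of k] \<gamma>_pos[of k] by (simp add: N_eq)
  ultimately show ?thesis by simp
qed

sublocale shape: column_shape "a k" "n k" "c k" for k
  using columns_column_shape[OF c] a[of k] by auto

lemma content_eq: "content (a k) (c k) j = s k * (L k j - \<gamma> k)"
  using s_pos[of k] by (simp add: content_def L_def a_eq[of k] algebra_simps)

lemma content_shift_eq: "content (a k) (c k) j + a k = s k * L k j"
  using s_pos[of k] by (simp add: content_def L_def a_eq[of k] algebra_simps)

lemma L_tendsto: "(\<lambda>k. L k j) \<longlonglongrightarrow> l j"
  unfolding L_def l_def s_def by (intro tendsto_intros \<gamma>_tendsto y_lim)

lemma L_gap: "i < j \<Longrightarrow> L k i + \<gamma> k \<le> L k j"
proof -
  assume ij: "i < j"
  have "s k * (L k i + \<gamma> k) \<le> s k * L k j"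
    using shape.content_gap[OF ij, of k] unfolding content_eq a_eq[of k, symmetric]
    using a_eq[of k] by (simp add: algebra_simps)
  then show ?thesis using s_pos[of k] by simp
qed

lemma c_le: "real (c k j) / s k \<le> 1 / \<gamma> k"
proof -
  have "c k 0 \<le> N k" using columns_area[OF c, of 0 k] by simp
  then have "c k j \<le> N k" using columns_antimono[OF c, of 0 j k] by simp
  then have "real (c k j) \<le> s k / \<gamma> k" using N_eq[of k] by (metis of_nat_le_iff)
  then show ?thesis using s_pos[of k] \<gamma>_pos[of k] by (simp add: field_simps)
qed

lemma L_lower: "L k j \<ge> \<gamma> k * (real j + 1) - 1 / \<gamma> k"
  using c_le[of k j] by (simp add: L_def)

lemma \<gamma>_large: "\<forall>\<^sub>F k in sequentially. \<gamma> k > g / 2"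
  using \<gamma>_tendsto g by (intro order_tendstoD) auto

lemma inv_\<gamma>: "\<gamma> k > g / 2 \<Longrightarrow> 1 / \<gamma> k < 2 / g"
proof -
  assume "\<gamma> k > g / 2"
  then have "1 / \<gamma> k < 1 / (g / 2)" using g \<gamma>_pos[of k] by (intro divide_strict_left_mono mult_pos_pos) auto
  then show ?thesis by simp
qed

lemma L_lower_eventually: "\<forall>\<^sub>F k in sequentially. \<forall>j. L k j \<ge> g / 2 * real j - 2 / g"
  using \<gamma>_large
proof eventually_elim
  case (elim k)
  show ?case
  proof
    fix j
    have "g / 2 * real j \<le> \<gamma> k * (real j + 1)" using elim \<gamma>_pos[of k] g by (intro mult_mono) auto
    then show "L k j \<ge> g / 2 * real j - 2 / g" using L_lower[of k j] inv_\<gamma>[OF elim] by linarith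
  qed
qed

lemma q_props: "q k j \<ge> 0" "(\<Sum>j<m. q k j) \<le> 1"
  and p_props: "p k j \<ge> 0" "(\<Sum>j<m. p k j) \<le> 1"
proof -
  have a0: "a k > 0" using a[of k] by simp
  show q0: "q k j \<ge> 0" for j by (simp add: q_def shape.down_prob_nonneg)
  show p0: "p k j \<ge> 0" for j by (simp add: p_def shape.up_prob_nonneg)
  obtain d where d: "N k = Suc d" using N_pos[of k] gr0_implies_Suc by blast
  have "(\<Sum>j<m. q k j) \<le> (\<Sum>j<max m (n k). q k j)" using q0 by (intro sum_mono2) auto
  also have "\<dots> = (\<Sum>j<n k. q k j)" by (intro sum.mono_neutral_right) (auto simp: q_def)
  also have "\<dots> = (\<Sum>j<n k. down_prob (a k) (n k) (c k) j)" by (simp add: q_def)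
  also have "\<dots> = 1" using c[of k] d by (intro sum_down_columns[OF a0, where d = d]) (auto simp: n_def)
  finally show "(\<Sum>j<m. q k j) \<le> 1" .
  have "(\<Sum>j<m. p k j) \<le> (\<Sum>j<max m (n k). p k j)" using p0 by (intro sum_mono2) auto
  also have "\<dots> = (\<Sum>j<n k. p k j)" by (intro sum.mono_neutral_right) (auto simp: p_def)
  also have "\<dots> = (\<Sum>j<n k. up_prob (a k) (n k) (c k) j)" by (simp add: p_def)
  also have "\<dots> = 1" by (intro sum_up_columns[OF a0 c]) (auto simp: n_def)
  finally show "(\<Sum>j<m. p k j) \<le> 1" .
qed

lemma q_tendsto: "(\<lambda>k. q k j) \<longlonglongrightarrow> Q j"
  using Q_lim[of j] unfolding q_def n_def .

lemma p_tendsto: "(\<lambda>k. p k j) \<longlonglongrightarrow> P j"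
  using P_lim[of j] unfolding p_def n_def .

lemma Q_props: "Q j \<ge> 0" "(\<Sum>j<m. Q j) \<le> 1"
proof -
  show "Q j \<ge> 0" using LIMSEQ_le_const[OF q_tendsto] q_props(1) by blast
  show "(\<Sum>j<m. Q j) \<le> 1"
    using LIMSEQ_le_const2[OF tendsto_sum[of "{..<m}" "\<lambda>j k. q k j", OF q_tendsto]] q_props(2) by blast
qed

lemma P_props: "P j \<ge> 0" "(\<Sum>j<m. P j) \<le> 1"
proof -
  show "P j \<ge> 0" using LIMSEQ_le_const[OF p_tendsto] p_props(1) by blast
  show "(\<Sum>j<m. P j) \<le> 1"
    using LIMSEQ_le_const2[OF tendsto_sum[of "{..<m}" "\<lambda>j k. p k j", OF p_tendsto]] p_props(2) by blast
qed

lemma l_gap: "i < j \<Longrightarrow> l i + g \<le> l j"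
  by (rule LIMSEQ_le[OF tendsto_add[OF L_tendsto \<gamma>_tendsto] L_tendsto]) (use L_gap in blast)

lemma y_le: "y j \<le> 1 / g"
proof (rule LIMSEQ_le[OF y_lim])
  show "(\<lambda>k. 1 / \<gamma> k) \<longlonglongrightarrow> 1 / g" using g by (intro tendsto_intros \<gamma>_tendsto) auto
qed (use c_le in \<open>auto simp: s_def\<close>)

sublocale SQ: spectrum g l Q
  by unfold_locales (use g l_gap Q_props in auto)

sublocale SP: spectrum g l P
  by unfold_locales (use g l_gap P_props in auto)

section \<open>Equations for the limits of the two transforms\<close>

lemma q_transform_tendsto:
  assumes "z \<longlonglongrightarrow> \<zeta>" "\<zeta> \<notin> range l"
  shows "(\<lambda>k. \<Sum>j. q k j * (1 / (L k j - z k))) \<longlonglongrightarrow> SQ.S \<zeta>"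
  unfolding SQ.S_def
proof (rule weighted_limit[OF q_props q_tendsto])
  show "(\<lambda>k. 1 / (L k j - z k)) \<longlonglongrightarrow> 1 / (l j - \<zeta>)" for j
    using assms by (intro tendsto_intros L_tendsto) auto
  show "\<exists>J. \<forall>\<^sub>F k in sequentially. \<forall>j\<ge>J. \<bar>1 / (L k j - z k)\<bar> \<le> e" if "e > 0" for e
    by (rule resolvent_tail[OF _ L_lower_eventually assms(1) that]) (use g in simp)
qed

lemma p_transform_tendsto:
  assumes "z \<longlonglongrightarrow> \<zeta>" "\<zeta> \<notin> range l"
  shows "(\<lambda>k. \<Sum>j. p k j * (1 / (L k j - z k))) \<longlonglongrightarrow> SP.S \<zeta>"
  unfolding SP.S_def
proof (rule weighted_limit[OF p_props p_tendsto])
  show "(\<lambda>k. 1 / (L k j - z k)) \<longlonglongrightarrow> 1 / (l j - \<zeta>)" for j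
    using assms by (intro tendsto_intros L_tendsto) auto
  show "\<exists>J. \<forall>\<^sub>F k in sequentially. \<forall>j\<ge>J. \<bar>1 / (L k j - z k)\<bar> \<le> e" if "e > 0" for e
    by (rule resolvent_tail[OF _ L_lower_eventually assms(1) that]) (use g in simp)
qed

lemma Y_scaled:
  assumes "\<And>j. j < n k \<Longrightarrow> z \<noteq> L k j"
  shows "Ytrans (a k) (n k) (c k) (s k * z) / s k = z + (\<Sum>j. q k j * (1 / (L k j - z)))"
proof -
  have "Ytrans (a k) (n k) (c k) (s k * z) = s k * z - a k * real (\<Sum>j<n k. c k j) *
      (\<Sum>j<n k. down_prob (a k) (n k) (c k) j / (s k * z - (content (a k) (c k) j + a k)))"
    by (rule shape.Ytrans_down) (use assms s_pos[of k] in \<open>auto simp: content_shift_eq\<close>)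
  also have "real (\<Sum>j<n k. c k j) = real (N k)" using columns_sum[OF c, of k "n k"] by (simp add: n_def)
  also have "(\<Sum>j<n k. down_prob (a k) (n k) (c k) j / (s k * z - (content (a k) (c k) j + a k)))
     = - (\<Sum>j<n k. down_prob (a k) (n k) (c k) j * (1 / (L k j - z))) / s k"
    unfolding sum_negf[symmetric] sum_divide_distrib
  proof (rule sum.cong)
    fix j assume "j \<in> {..<n k}"
    then have "L k j - z \<noteq> 0" "z - L k j \<noteq> 0" using assms[of j] by auto
    then show "down_prob (a k) (n k) (c k) j / (s k * z - (content (a k) (c k) j + a k)) =
        - (down_prob (a k) (n k) (c k) j * (1 / (L k j - z))) / s k"
      unfolding content_shift_eq right_diff_distrib[symmetric] using s_pos[of k]
      by (simp add: divide_simps) (simp add: algebra_simps)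
  qed simp
  finally show ?thesis
    unfolding s_sq q_def suminf_if_less using s_pos[of k] by (simp add: field_simps power2_eq_square)
qed

text \<open>The exact inversion of \<open>Y\<close> in scaled coordinates. The transition poles lie
  lower by \<open>\<gamma> k\<close>, which is why the second resolvent is evaluated at
  \<open>z + \<gamma> k\<close>.\<close>

lemma Y_up_scaled:
  assumes "\<And>j. j < n k \<Longrightarrow> z \<noteq> L k j" "\<And>j. j < n k \<Longrightarrow> z + \<gamma> k \<noteq> L k j"
  shows "(- z - (\<Sum>j. q k j * (1 / (L k j - z)))) * (\<Sum>j. p k j * (1 / (L k j - (z + \<gamma> k)))) = 1"
proof -
  have z: "c k (n k - 1) = 0" using columns_zero[OF c, of k "N k"] by (simp add: n_def)
  have ne: "s k * z \<noteq> content (a k) (c k) j" if "j < n k" for j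
    using assms(2)[OF that] s_pos[of k] unfolding content_eq by auto
  have ne': "s k * z \<noteq> content (a k) (c k) j + a k" if "j < n k" for j
    using assms(1)[OF that] s_pos[of k] unfolding content_shift_eq by auto
  have "Ytrans (a k) (n k) (c k) (s k * z) * (\<Sum>j<n k. up_prob (a k) (n k) (c k) j / (s k * z - content (a k) (c k) j)) = 1"
    by (rule shape.Ytrans_up) (use z ne ne' in \<open>auto simp: n_def\<close>)
  moreover have "(\<Sum>j<n k. up_prob (a k) (n k) (c k) j / (s k * z - content (a k) (c k) j))
     = - (\<Sum>j<n k. up_prob (a k) (n k) (c k) j * (1 / (L k j - (z + \<gamma> k)))) / s k"
    unfolding sum_negf[symmetric] sum_divide_distrib
  proof (rule sum.cong)
    fix j assume "j \<in> {..<n k}"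
    then have ne: "L k j - (z + \<gamma> k) \<noteq> 0" using assms(2)[of j] by auto
    have e: "s k * z - content (a k) (c k) j = - (s k * (L k j - (z + \<gamma> k)))"
      unfolding content_eq by (simp add: algebra_simps)
    show "up_prob (a k) (n k) (c k) j / (s k * z - content (a k) (c k) j) =
        - (up_prob (a k) (n k) (c k) j * (1 / (L k j - (z + \<gamma> k)))) / s k"
      unfolding e using s_pos[of k] ne by (simp add: divide_simps)
  qed simp
  ultimately have "- (Ytrans (a k) (n k) (c k) (s k * z) / s k) * (\<Sum>j. p k j * (1 / (L k j - (z + \<gamma> k)))) = 1"
    unfolding p_def suminf_if_less by simp
  moreover have "- (Ytrans (a k) (n k) (c k) (s k * z) / s k) = - z - (\<Sum>j. q k j * (1 / (L k j - z)))"
    using Y_scaled[OF assms(1)] by simp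
  ultimately show ?thesis by simp
qed

text \<open>Finitely many columns are handled by convergence, all others by the linear lower bound
  on \<open>L\<close>.\<close>

lemma L_avoid: "\<forall>\<^sub>F k in sequentially. \<forall>j. L k j \<noteq> z k" if "z \<longlonglongrightarrow> \<zeta>" "\<zeta> \<notin> range l"
proof -
  obtain J :: nat where J: "real J \<ge> (\<zeta> + 1 + 2 / g) / (g / 2)" using real_arch_simple by blast
  have "\<forall>\<^sub>F k in sequentially. L k j \<noteq> z k" for j
  proof -
    have "(\<lambda>k. L k j - z k) \<longlonglongrightarrow> l j - \<zeta>" by (intro tendsto_intros L_tendsto that(1))
    moreover have "l j - \<zeta> \<noteq> 0" using that(2) by auto
    ultimately have "\<forall>\<^sub>F k in sequentially. L k j - z k \<noteq> 0" by (rule tendsto_imp_eventually_ne)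
    then show ?thesis by simp
  qed
  then have "\<forall>\<^sub>F k in sequentially. \<forall>j\<in>{..<J}. L k j \<noteq> z k" by (intro eventually_ball_finite) auto
  moreover have "\<forall>\<^sub>F k in sequentially. z k < \<zeta> + 1" using that(1) by (rule order_tendstoD) simp
  ultimately show ?thesis using L_lower_eventually
  proof eventually_elim
    case (elim k)
    show ?case
    proof
      fix j show "L k j \<noteq> z k"
      proof (cases "j < J")
        case True then show ?thesis using elim by auto
      next
        case False
        then have "(\<zeta> + 1 + 2 / g) / (g / 2) \<le> real j" using J by linarith
        then have "\<zeta> + 1 + 2 / g \<le> real j * (g / 2)" using g by (simp only: pos_divide_le_eq half_gt_zero_iff)
        then show ?thesis using elim(2) elim(3)[rule_format, of j] by (simp add: mult.commute)
      qed
    qed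
  qed
qed

lemma S_equation:
  assumes "\<zeta> \<notin> range l" "\<zeta> + g \<notin> range l"
  shows "(- \<zeta> - SQ.S \<zeta>) * SP.S (\<zeta> + g) = 1"
proof -
  have z': "(\<lambda>k. \<zeta> + \<gamma> k) \<longlonglongrightarrow> \<zeta> + g" by (intro tendsto_intros \<gamma>_tendsto)
  have "(\<lambda>k. (- \<zeta> - (\<Sum>j. q k j * (1 / (L k j - \<zeta>)))) * (\<Sum>j. p k j * (1 / (L k j - (\<zeta> + \<gamma> k)))))
      \<longlonglongrightarrow> (- \<zeta> - SQ.S \<zeta>) * SP.S (\<zeta> + g)"
    by (intro tendsto_mult tendsto_diff tendsto_const q_transform_tendsto[OF tendsto_const assms(1)]
        p_transform_tendsto[OF z' assms(2)])
  moreover have "\<forall>\<^sub>F k in sequentially. (- \<zeta> - (\<Sum>j. q k j * (1 / (L k j - \<zeta>)))) * (\<Sum>j. p k j * (1 / (L k j - (\<zeta> + \<gamma> k)))) = 1"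
    using L_avoid[OF tendsto_const[of \<zeta>] assms(1)] L_avoid[OF z' assms(2)]
    by eventually_elim (intro Y_up_scaled; metis)
  then have "(\<lambda>k. (- \<zeta> - (\<Sum>j. q k j * (1 / (L k j - \<zeta>)))) * (\<Sum>j. p k j * (1 / (L k j - (\<zeta> + \<gamma> k))))) \<longlonglongrightarrow> 1"
    by (rule tendsto_eventually)
  ultimately show ?thesis by (rule LIMSEQ_unique)
qed

lemma test_points_le: "\<zeta> \<in> test_points g \<Longrightarrow> \<zeta> \<le> - 2 / g - 2"
  by (auto simp: test_points_def)

lemma test_point_less: "\<zeta> \<in> test_points g \<Longrightarrow> \<zeta> < l j"
proof -
  assume z: "\<zeta> \<in> test_points g"
  have "l 0 \<le> l j" using SQ.l_strict[of 0 j] by (cases j) auto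
  moreover have "l 0 \<ge> g - 1 / g" using y_le[of 0] by (simp add: l_def)
  moreover have "1 / g > 0" using g by simp
  moreover have "- 2 / g = - (2 * (1 / g))" by simp
  ultimately show "\<zeta> < l j" using test_points_le[OF z] g by linarith
qed

text \<open>The shift by \<open>- \<alpha>\<close> in the defect moves the transition poles onto the
  cotransition poles. What remains of \<open>- \<alpha> + 1\<close> is \<open>1 / s k\<close>, which
  disappears in the limit, so that both resolvents are compared at the same point.\<close>

lemma defect_scaled:
  assumes k: "\<gamma> k > g / 2" and z: "\<zeta> \<in> test_points g"
  shows "defect (a k) (n k) (s k) (s k * \<zeta>) (c k) =
    (\<Sum>j. q k j * (1 / (L k j - \<zeta>))) - (\<Sum>j. p k j * (1 / (L k j - (\<zeta> + 1 / s k))))"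
proof -
  have "- 2 / g = - (2 / g)" by simp
  \<comment> \<open>Scaled columns are at most \<open>1 / \<gamma> k < 2 / g\<close>, so
    \<open>- 2 / g\<close> clears the diagram. The distance \<open>s k\<close> demanded by
    \<open>left_point\<close> is one more unit in scaled coordinates.\<close>
  then have "\<zeta> \<le> - (1 / \<gamma> k) - 1" using inv_\<gamma>[OF k] test_points_le[OF z] by linarith
  then have "s k * \<zeta> \<le> s k * (- (1 / \<gamma> k) - 1)" using s_pos[of k] by (intro mult_left_mono) auto
  then have zs: "s k * \<zeta> \<le> - real (N k) - s k" by (simp add: N_eq right_diff_distrib)
  interpret lp: left_point "a k" "s k" "s k * \<zeta>" "n k" "N k" "c k"
  proof
    show "content (a k) (c k) j - s k * \<zeta> \<ge> s k" for j
      using a[of k] by (intro content_far[OF c order_refl _ zs]) simp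
    show "a k * real (N k) \<le> (s k)\<^sup>2" unfolding s_sq by simp
  qed (use a s_pos c in \<open>auto simp: n_def\<close>)
  have ne: "\<zeta> \<noteq> L k j" for j
  proof
    assume "\<zeta> = L k j"
    then have "content (a k) (c k) j - s k * \<zeta> = - (s k * \<gamma> k)" unfolding content_eq by (simp add: algebra_simps)
    then show False using lp.far[of j] s_pos[of k] mult_pos_pos[OF s_pos[of k] \<gamma>_pos[of k]] by linarith
  qed
  have "(Ytrans (a k) (n k) (c k) (s k * \<zeta>) - s k * \<zeta>) / s k = (\<Sum>j. q k j * (1 / (L k j - \<zeta>)))"
    using Y_scaled[of k \<zeta>, OF ne] s_pos[of k] by (simp add: diff_divide_distrib)
  moreover have "lp.v = - (\<Sum>j. p k j * (1 / (L k j - (\<zeta> + 1 / s k))))"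
  proof -
    have "s k / (content (a k) (c k) j - (s k * \<zeta> - a k + 1)) = 1 / (L k j - (\<zeta> + 1 / s k))" for j
    proof -
      have "content (a k) (c k) j - (s k * \<zeta> - a k + 1) = s k * (L k j - (\<zeta> + 1 / s k))"
        using content_shift_eq[of k j] s_pos[of k] by (simp add: algebra_simps)
      then show ?thesis using s_pos[of k] by simp
    qed
    then show ?thesis unfolding lp.v_eq p_def suminf_if_less by simp
  qed
  ultimately show ?thesis unfolding lp.defect_eq by simp
qed

lemma S_eq_test:
  assumes z: "\<zeta> \<in> test_points g"
  shows "SQ.S \<zeta> = SP.S \<zeta>"
proof -
  have nl: "\<zeta> \<notin> range l" using test_point_less[OF z] by (auto simp: less_le)
  have z': "(\<lambda>k. \<zeta> + 1 / s k) \<longlonglongrightarrow> \<zeta>"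
    using tendsto_add[OF tendsto_const s_inverse_tendsto, of \<zeta>] by simp
  have "(\<lambda>k. (\<Sum>j. q k j * (1 / (L k j - \<zeta>))) - (\<Sum>j. p k j * (1 / (L k j - (\<zeta> + 1 / s k))))) \<longlonglongrightarrow> SQ.S \<zeta> - SP.S \<zeta>"
    by (intro tendsto_diff q_transform_tendsto[OF tendsto_const nl] p_transform_tendsto[OF z' nl])
  moreover have "(\<lambda>k. defect (a k) (n k) (s k) (s k * \<zeta>) (c k)) \<longlonglongrightarrow> 0"
    using defect_lim[OF z] unfolding n_def s_def .
  then have "(\<lambda>k. (\<Sum>j. q k j * (1 / (L k j - \<zeta>))) - (\<Sum>j. p k j * (1 / (L k j - (\<zeta> + 1 / s k))))) \<longlonglongrightarrow> 0"
    by (rule Lim_transform_eventually) (use \<gamma>_large defect_scaled[OF _ z] in \<open>auto elim: eventually_mono\<close>)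
  ultimately have "SQ.S \<zeta> - SP.S \<zeta> = 0" by (rule LIMSEQ_unique)
  then show ?thesis by simp
qed

lemma Q_eq_P: "Q j = P j"
proof (rule resolvent_weights_unique[of Q P l "- 2 / g - 2"])
  show "\<exists>J. \<forall>j\<ge>J. l j \<ge> B" for B
  proof -
    obtain J :: nat where J: "real J \<ge> (B - l 0) / g" using real_arch_simple by blast
    have "l j \<ge> B" if "j \<ge> J" for j
    proof -
      have "(B - l 0) / g \<le> real j" using J that by linarith
      then have "B - l 0 \<le> g * real j" using g by (simp only: pos_divide_le_eq mult.commute)
      then show ?thesis using SQ.l_lower[of j] by linarith
    qed
    then show ?thesis by blast
  qed
  show "- 2 / g - 2 < l 0" by (rule test_point_less) (simp add: test_points_def)
  show "(\<Sum>j. Q j * (1 / (l j - \<xi>))) = (\<Sum>j. P j * (1 / (l j - \<xi>)))"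
    if "\<xi> \<in> insert (- 2 / g - 2) (range (\<lambda>r. - 2 / g - 2 - 1 / real (Suc r)))" for \<xi>
    using S_eq_test[of \<xi>] that unfolding test_points_def SQ.S_def SP.S_def by blast
qed (use Q_props P_props SQ.l_strict in auto)

text \<open>Near \<open>\<xi> = l j - g\<close> the factor \<open>- z - S z\<close> tends to 0,
  because \<open>Y\<close> vanishes at the content of column \<open>j\<close>. Without mass at
  \<open>j\<close> the other factor stays bounded at \<open>z + g\<close>, so the product could not
  be 1.\<close>

lemma P_pos:
  assumes j: "j = 0 \<or> y j < y (j - 1)"
  shows "P j > 0"
proof (rule ccontr)
  assume "\<not> P j > 0"
  then have Pj: "P j = 0" using P_props(1)[of j] by simp
  define \<xi> where "\<xi> = l j - g"
  \<comment> \<open>A pole at \<open>l j - g\<close> could only be \<open>l (j - 1)\<close>, and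
    this means that columns \<open>j - 1\<close> and \<open>j\<close> have the same limit.\<close>
  have nl: "\<xi> \<notin> range l"
  proof
    assume "\<xi> \<in> range l"
    then obtain i where i: "l i = l j - g" unfolding \<xi>_def by (metis rangeE)
    then have "i < j" using SQ.l_strict[of j i] g by (cases i j rule: linorder_cases) auto
    have "i = j - 1"
    proof (rule ccontr)
      assume "i \<noteq> j - 1"
      then have "i < j - 1" using \<open>i < j\<close> by auto
      then show False using SQ.l_strict[of i "j - 1"] SQ.l_gap[of "j - 1" j] i \<open>i < j\<close> by auto
    qed
    then have "y j = y (j - 1)" using i \<open>i < j\<close> by (simp add: l_def of_nat_diff algebra_simps)
    then show False using j \<open>i < j\<close> by auto
  qed
  define X where "X k = L k j - \<gamma> k" for k
  have X: "X \<longlonglongrightarrow> \<xi>" unfolding X_def \<xi>_def by (intro tendsto_diff L_tendsto \<gamma>_tendsto)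
  have "\<forall>\<^sub>F k in sequentially. N k \<ge> j" using N_lim by (simp add: filterlim_at_top)
  with L_avoid[OF X nl] have "\<forall>\<^sub>F k in sequentially. X k + (\<Sum>i. q k i * (1 / (L k i - X k))) = 0"
  proof eventually_elim
    case (elim k)
    have x: "content (a k) (c k) j = s k * X k" by (simp add: content_eq X_def)
    have "Ytrans (a k) (n k) (c k) (s k * X k) = 0" unfolding x[symmetric]
    proof (rule shape.Ytrans_zero)
      show "content (a k) (c k) j \<noteq> content (a k) (c k) i + a k" for i
        unfolding x content_shift_eq using elim(1) s_pos[of k] by (metis mult_cancel_left less_irrefl)
    qed (use elim in \<open>simp add: n_def\<close>)
    then show ?case using Y_scaled[of k "X k"] elim(1) by (metis div_0)
  qed
  then have "(\<lambda>k. X k + (\<Sum>i. q k i * (1 / (L k i - X k)))) \<longlonglongrightarrow> 0" by (rule tendsto_eventually)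
  moreover have "(\<lambda>k. X k + (\<Sum>i. q k i * (1 / (L k i - X k)))) \<longlonglongrightarrow> \<xi> + SQ.S \<xi>"
    by (intro tendsto_add X q_transform_tendsto[OF X nl])
  ultimately have root: "0 = \<xi> + SQ.S \<xi>" by (rule LIMSEQ_unique)
  have "countable (range l \<union> range (\<lambda>i. l i - g))" by auto
  then obtain z where z: "z \<longlonglongrightarrow> \<xi>" "\<And>r. z r \<notin> range l \<union> range (\<lambda>i. l i - g)"
    by (rule avoiding_sequence[of _ \<xi>]) (rule that)
  have "(\<lambda>r. - z r - SQ.S (z r)) \<longlonglongrightarrow> - \<xi> - SQ.S \<xi>"
    by (intro tendsto_diff tendsto_minus z(1) SQ.S_tendsto nl)
  also have "- \<xi> - SQ.S \<xi> = 0" using root by simp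
  finally have A: "(\<lambda>r. - z r - SQ.S (z r)) \<longlonglongrightarrow> 0" .
  have "(\<lambda>r. dist (z r) \<xi>) \<longlonglongrightarrow> 0" using z(1) tendsto_dist_iff by blast
  then have "\<forall>\<^sub>F r in sequentially. dist (z r) \<xi> < g / 2" using g by (intro order_tendstoD) auto
  then have B: "\<forall>\<^sub>F r in sequentially. norm (SP.S (z r + g)) \<le> 2 / g"
  proof eventually_elim
    case (elim r)
    then have "\<bar>z r + g - l j\<bar> \<le> g / 2" by (simp add: dist_real_def \<xi>_def algebra_simps)
    from SP.S_pole_split[OF this] show ?case by (simp add: Pj)
  qed
  have "(\<lambda>r. (- z r - SQ.S (z r)) * SP.S (z r + g)) \<longlonglongrightarrow> 0"
    by (rule lim_null_mult_right_bounded[OF A B])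
  moreover have "(- z r - SQ.S (z r)) * SP.S (z r + g) = 1" for r
  proof (rule S_equation)
    show "z r \<notin> range l" using z(2)[of r] by blast
    show "z r + g \<notin> range l"
    proof
      assume "z r + g \<in> range l"
      then obtain i where "z r + g = l i" by (rule rangeE)
      then have "z r = l i - g" by simp
      then show False using z(2)[of r] by blast
    qed
  qed
  ultimately show False using LIMSEQ_const_iff[of "1 :: real" 0] by simp
qed

text \<open>At the content of column \<open>j + 1\<close> one has \<open>Y = 0\<close>. The pole of
  column \<open>j\<close> lies only a step height away, all others at least
  \<open>\<gamma> k\<close>, so \<open>q k j\<close> divided by the step height stays bounded. A
  bound is needed because the step may vanish only in the limit.\<close>

lemma q_gap_bound:
  assumes j: "Suc j < n k"
  shows "q k j \<le> (real (c k j) / s k - real (c k (Suc j)) / s k) * (\<bar>L k (Suc j) - \<gamma> k\<bar> + 1 / \<gamma> k)"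
proof (cases "c k (Suc j) = c k j")
  case True
  have "down_prob (a k) (n k) (c k) j = 0"
    using j True columns_zero[OF c, of k "n k"] by (intro shape.down_prob_zero) (auto simp: n_def)
  then show ?thesis using True by (simp add: q_def)
next
  case False
  define \<delta> where "\<delta> = real (c k j) / s k - real (c k (Suc j)) / s k"
  define X where "X = L k (Suc j) - \<gamma> k"
  have "c k (Suc j) < c k j" using False shape.anti[of k j] by auto
  then have \<delta>: "\<delta> > 0" unfolding \<delta>_def using s_pos[of k] by (simp add: divide_strict_right_mono)
  have LX: "L k j - X = - \<delta>" by (simp add: L_def X_def \<delta>_def algebra_simps)
  have far: "\<bar>L k i - X\<bar> \<ge> \<gamma> k" if "i \<noteq> j" for i
  proof (cases "i < j")
    case True
    then have "L k i + \<gamma> k \<le> X" using L_gap[OF True, of k] LX \<delta> by linarith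
    then show ?thesis by linarith
  next
    case False
    then have "L k (Suc j) \<le> L k i" using that L_gap[of "Suc j" i k] \<gamma>_pos[of k] by (cases "Suc j = i") auto
    then show ?thesis unfolding X_def by linarith
  qed
  have ne: "X \<noteq> L k i" for i using far[of i] \<gamma>_pos[of k] LX \<delta> by (cases "i = j") auto
  have x: "content (a k) (c k) (Suc j) = s k * X" by (simp add: content_eq X_def)
  have "Ytrans (a k) (n k) (c k) (s k * X) = 0" unfolding x[symmetric]
  proof (rule shape.Ytrans_zero[OF j])
    show "content (a k) (c k) (Suc j) \<noteq> content (a k) (c k) i + a k" for i
      unfolding x content_shift_eq using ne s_pos[of k] by (metis mult_cancel_left less_irrefl)
  qed
  then have "0 = X + (\<Sum>i. q k i * (1 / (L k i - X)))" using Y_scaled[of k X, OF ne] by simp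
  also have "(\<Sum>i. q k i * (1 / (L k i - X))) = (\<Sum>i<n k. q k i * (1 / (L k i - X)))"
    by (rule suminf_finite) (auto simp: q_def)
  also have "\<dots> = q k j * (1 / (L k j - X)) + (\<Sum>i\<in>{..<n k} - {j}. q k i * (1 / (L k i - X)))"
    using j by (intro sum.remove) auto
  finally have eq: "q k j / \<delta> = X + (\<Sum>i\<in>{..<n k} - {j}. q k i * (1 / (L k i - X)))"
    unfolding LX by simp
  have "\<bar>\<Sum>i\<in>{..<n k} - {j}. q k i * (1 / (L k i - X))\<bar> \<le> 1 / \<gamma> k"
  proof (rule average_abs_le)
    have "(\<Sum>i\<in>{..<n k} - {j}. q k i) \<le> (\<Sum>i<n k. q k i)" using q_props(1) by (intro sum_mono2) auto
    then show "(\<Sum>i\<in>{..<n k} - {j}. q k i) \<le> 1" using q_props(2)[of k "n k"] by linarith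
    show "\<bar>1 / (L k i - X)\<bar> \<le> 1 / \<gamma> k" if "i \<in> {..<n k} - {j}" for i
    proof -
      have f: "\<gamma> k \<le> \<bar>L k i - X\<bar>" using that far by auto
      then have "1 / \<bar>L k i - X\<bar> \<le> 1 / \<gamma> k"
        by (rule divide_left_mono[OF _ zero_le_one mult_pos_pos[OF less_le_trans[OF \<gamma>_pos f] \<gamma>_pos]])
      then show ?thesis by simp
    qed
  qed (use q_props \<gamma>_pos[of k] in auto)
  then have "q k j / \<delta> \<le> \<bar>X\<bar> + 1 / \<gamma> k" using eq by linarith
  then have "q k j \<le> \<delta> * (\<bar>X\<bar> + 1 / \<gamma> k)" using \<delta> by (simp only: pos_divide_le_eq mult.commute)
  then show ?thesis unfolding \<delta>_def X_def .
qed

lemma Q_zero: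
  assumes "y (Suc j) = y j"
  shows "Q j = 0"
proof -
  have "(\<lambda>k. (real (c k j) / s k - real (c k (Suc j)) / s k) * (\<bar>L k (Suc j) - \<gamma> k\<bar> + 1 / \<gamma> k))
      \<longlonglongrightarrow> (y j - y (Suc j)) * (\<bar>l (Suc j) - g\<bar> + 1 / g)"
    unfolding s_def using g by (intro tendsto_intros y_lim L_tendsto \<gamma>_tendsto) auto
  moreover have "\<forall>\<^sub>F k in sequentially. N k \<ge> Suc j" using N_lim by (simp add: filterlim_at_top)
  then have "\<forall>\<^sub>F k in sequentially. q k j \<le> (real (c k j) / s k - real (c k (Suc j)) / s k) * (\<bar>L k (Suc j) - \<gamma> k\<bar> + 1 / \<gamma> k)"
    by eventually_elim (rule q_gap_bound, simp add: n_def)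
  ultimately have "Q j \<le> (y j - y (Suc j)) * (\<bar>l (Suc j) - g\<bar> + 1 / g)"
    by (intro tendsto_le[OF _ _ q_tendsto]) auto
  then show ?thesis using Q_props(1)[of j] assms by simp
qed

lemma y_antimono: "y (Suc j) \<le> y j"
  using l_gap[of j "Suc j"] by (simp add: l_def algebra_simps)

text \<open>Induction alternating between the measures: mass at \<open>j\<close> excludes
  \<open>y (Suc j) = y j\<close> by \<open>Q_zero\<close>, and the resulting drop gives
  \<open>P (Suc j) > 0\<close>, which is \<open>Q (Suc j) > 0\<close>.\<close>

lemma Q_pos: "Q j > 0"
proof (induction j)
  case 0
  then show ?case using P_pos[of 0] Q_eq_P by simp
next
  case (Suc j)
  then have "y (Suc j) \<noteq> y j" using Q_zero[of j] by auto
  then have "y (Suc j) < y j" using y_antimono[of j] by simp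
  then show ?case using P_pos[of "Suc j"] Q_eq_P by simp
qed

lemma phi_zeros: "{z. phi g z = 0} = range l"
proof -
  have "Q = P" using Q_eq_P by blast
  then have SS: "SP.S = SQ.S" by (simp add: SP.S_def SQ.S_def fun_eq_iff)
  interpret spectrum_equation g l Q "phi g"
  proof
    show "(- z - SQ.S z) * SQ.S (z + g) = 1" if "z \<notin> range l" "z + g \<notin> range l" for z
      using S_equation[OF that] unfolding SS .
    show "\<exists>C T. T \<ge> 0 \<and> (\<forall>n. \<bar>phi g (z - real n * g)\<bar> \<le> C * T ^ n)" for z
      using phi_growth[OF g, of z] g by (metis inverse_nonnegative_iff_nonnegative less_imp_le)
  qed (rule Q_pos phi_recurrence[OF g] isCont_phi[OF g] phi_nonzero[OF g])+
  show ?thesis by (rule zeros)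
qed

lemma l_strict_mono: "strict_mono l"
  by (rule strict_monoI) (rule SQ.l_strict)

end

section \<open>Partitions and column lengths\<close>

lemma prod_column_split:
  fixes c :: "nat \<Rightarrow> nat" and f :: "nat \<Rightarrow> 'a::comm_monoid_mult"
  assumes "\<And>j. c (Suc j) \<le> c j" "j \<le> m"
  shows "(\<Prod>k\<in>{j..<m}. \<Prod>i\<in>{c (Suc k)..<c k}. f i) = (\<Prod>i\<in>{c m..<c j}. f i)"
  using assms(2)
proof (induction m rule: dec_induct)
  case (step m)
  have "c m \<le> c j" using lift_Suc_antimono_le[of c, OF assms(1)] step by blast
  then have u: "{c (Suc m)..<c j} = {c (Suc m)..<c m} \<union> {c m..<c j}" using assms(1)[of m] by auto
  have "{j..<Suc m} = insert m {j..<m}" using step by auto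
  then have "(\<Prod>k\<in>{j..<Suc m}. \<Prod>i\<in>{c (Suc k)..<c k}. f i) = (\<Prod>i\<in>{c (Suc m)..<c m}. f i) * (\<Prod>i\<in>{c m..<c j}. f i)"
    using step.IH by simp
  also have "\<dots> = (\<Prod>i\<in>{c (Suc m)..<c j}. f i)" unfolding u by (rule prod.union_disjoint[symmetric]) auto
  finally show ?case .
qed simp

text \<open>The hypothesis \<open>galois\<close> says that \<open>r\<close> and \<open>c\<close> are the row and column lengths of one diagram.\<close>

lemma hook_prod_boxes:
  assumes galois: "\<And>i j. i < c j \<longleftrightarrow> j < r i" and anti: "\<And>j. c (Suc j) \<le> c j" and z: "\<And>j. n \<le> j \<Longrightarrow> c j = 0"
  shows "(\<Prod>(i, j)\<in>{(i, j). i < c j}.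
      (\<alpha> * (real (r i) - real (Suc j)) + (real (c j) - real (Suc i)) + 1) *
      (\<alpha> * (real (r i) - real (Suc j)) + (real (c j) - real (Suc i)) + \<alpha>)) = hook_prod \<alpha> n c"
proof -
  define F where "F i j = (\<alpha> * (real (r i) - real (Suc j)) + (real (c j) - real (Suc i)) + 1) *
      (\<alpha> * (real (r i) - real (Suc j)) + (real (c j) - real (Suc i)) + \<alpha>)" for i j
  have lt: "j < n" if "i < c j" for i j using z[of j] that by (cases "n \<le> j") auto
  have "(\<Prod>(i, j)\<in>{(i, j). i < c j}. F i j) = (\<Prod>(j, i)\<in>Sigma {..<n} (\<lambda>j. {..<c j}). F i j)"
    by (rule prod.reindex_bij_witness[where i = "\<lambda>(j, i). (i, j)" and j = "\<lambda>(i, j). (j, i)"])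
      (auto intro: lt)
  also have "\<dots> = (\<Prod>j<n. \<Prod>i<c j. F i j)" by (rule prod.Sigma[symmetric]) auto
  also have "\<dots> = hook_prod \<alpha> n c" unfolding hook_prod_def
  proof (rule prod.cong)
    fix j assume j: "j \<in> {..<n}"
    have "(\<Prod>i<c j. F i j) = (\<Prod>k\<in>{j..<n}. \<Prod>i\<in>{c (Suc k)..<c k}. F i j)"
      using prod_column_split[of c j n "\<lambda>i. F i j", OF anti] j z[of n] by (simp add: atLeast0LessThan)
    also have "\<dots> = column_hook_prod \<alpha> c n j" unfolding column_hook_prod_def
    proof (intro prod.cong refl)
      fix k i assume i: "i \<in> {c (Suc k)..<c k}"
      \<comment> \<open>A row between the heights of columns \<open>k + 1\<close> and
        \<open>k\<close> ends exactly in column \<open>k\<close>, so its box in column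
        \<open>j\<close> has arm length \<open>k - j\<close>.\<close>
      have "r i = Suc k" using galois[of i k] galois[of i "Suc k"] i by auto
      then show "F i j = (\<alpha> * (real k - real j) + (real (c j) - real i)) *
          (\<alpha> * (real k - real j) + (real (c j) - real i - 1) + \<alpha>)" by (simp add: F_def algebra_simps)
    qed
    finally show "(\<Prod>i<c j. F i j) = column_hook_prod \<alpha> c n j" .
  qed simp
  finally show ?thesis by (simp add: F_def)
qed

section \<open>Rows, columns and conjugation\<close>

definition col_lengths :: "nat list \<Rightarrow> nat \<Rightarrow> nat" where
  "col_lengths p j = conj_part p (Suc j)"

definition row_lengths :: "nat list \<Rightarrow> nat \<Rightarrow> nat" where
  "row_lengths p i = nth_part p (Suc i)"

lemma diagram_iff: "(i, j) \<in> diagram p \<longleftrightarrow> 1 \<le> i \<and> 1 \<le> j \<and> j \<le> nth_part p i"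
  by (simp add: diagram_def)

context
  fixes p :: "nat list" and d :: nat
  assumes p: "p \<in> partitions d"
begin

text \<open>The rows that reach a given column form an initial segment, so counting them is the same
  as locating the last one. All facts on conjugation below rest on this symmetric relation.\<close>

lemma galois: "i < col_lengths p j \<longleftrightarrow> j < row_lengths p i"
proof -
  define A where "A = {i. (i, Suc j) \<in> diagram p}"
  have fin: "finite A" unfolding A_def
    by (rule finite_subset[of _ "fst ` diagram p"]) (auto intro: rev_image_eqI finite_imageI finite_diagram)
  have down: "i' \<in> A" if "i \<in> A" "1 \<le> i'" "i' \<le> i" for i i'
    using that nth_part_antimono[OF p, of i' i] by (auto simp: A_def diagram_iff)
  have pos: "i \<in> A \<Longrightarrow> 1 \<le> i" for i by (auto simp: A_def diagram_iff)
  have "A = {1..card A}"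
  proof (cases "A = {}")
    case False
    have "A = {1..Max A}"
    proof (intro equalityI subsetI)
      fix i assume "i \<in> A"
      then show "i \<in> {1..Max A}" using pos[of i] Max_ge[OF fin, of i] by simp
    next
      fix i assume "i \<in> {1..Max A}"
      then show "i \<in> A" using down[OF Max_in[OF fin False], of i] by simp
    qed
    then show ?thesis by (metis card_atLeastAtMost diff_Suc_1 One_nat_def)
  qed simp
  then have "Suc i \<in> A \<longleftrightarrow> Suc i \<le> card A" by (metis atLeastAtMost_iff le_add1 plus_1_eq_Suc)
  then show ?thesis by (auto simp: A_def col_lengths_def conj_part_def row_lengths_def diagram_iff)
qed

lemma row_lengths_columns: "row_lengths p \<in> columns d"
proof (rule columnsI[where n = "length p"])
  show "row_lengths p (Suc j) \<le> row_lengths p j" for j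
    unfolding row_lengths_def by (rule nth_part_antimono[OF p]) auto
  show "row_lengths p j = 0" if "length p \<le> j" for j using that by (simp add: row_lengths_def nth_part_def)
  have "(\<Sum>j<length p. row_lengths p j) = (\<Sum>j<length p. p ! j)"
    by (intro sum.cong) (auto simp: row_lengths_def nth_part_def)
  also have "\<dots> = sum_list p" by (simp add: sum_list_sum_nth atLeast0LessThan)
  finally show "(\<Sum>j<length p. row_lengths p j) = d" using p by (simp add: partitions_def)
qed

lemma boxes_eq: "{(i, j). i < col_lengths p j} = Sigma {..<d} (\<lambda>i. {..<row_lengths p i})"
proof -
  have "i < d" if "j < row_lengths p i" for i j
    using columns_zero[OF row_lengths_columns, of i] that by (cases "d \<le> i") auto
  then show ?thesis by (auto simp: galois)
qed

lemma card_boxes: "card {(i, j). i < col_lengths p j} = d"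
  unfolding boxes_eq using columns_sum[OF row_lengths_columns, of d] by simp

lemma col_lengths_columns: "col_lengths p \<in> columns d"
proof (rule columnsI[where n = d])
  show "col_lengths p (Suc j) \<le> col_lengths p j" for j
  proof (rule ccontr)
    assume "\<not> ?thesis"
    then have "col_lengths p j < col_lengths p (Suc j)" by simp
    then have "Suc j < row_lengths p (col_lengths p j)" by (simp add: galois)
    then have "col_lengths p j < col_lengths p j" unfolding galois by simp
    then show False by simp
  qed
  have le: "row_lengths p i \<le> d" for i using columns_area[OF row_lengths_columns, of i] by simp
  show z: "col_lengths p j = 0" if "d \<le> j" for j
    using galois[of 0 j] le[of 0] that by (cases "col_lengths p j") auto
  have "j < d" if "i < col_lengths p j" for i j using z[of j] that by (cases "d \<le> j") auto
  then have "{(i, j). i < col_lengths p j} = (\<lambda>(j, i). (i, j)) ` Sigma {..<d} (\<lambda>j. {..<col_lengths p j})"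
    by force
  then have "card {(i, j). i < col_lengths p j} = card (Sigma {..<d} (\<lambda>j. {..<col_lengths p j}))"
    by (simp only:) (rule card_image, auto simp: inj_on_def)
  then show "(\<Sum>j<d. col_lengths p j) = d" using card_boxes by simp
qed

lemma diagram_eq: "diagram p = (\<lambda>(i, j). (Suc i, Suc j)) ` {(i, j). i < col_lengths p j}"
proof -
  have "(i, j) \<in> diagram p \<longleftrightarrow> (\<exists>i' j'. i = Suc i' \<and> j = Suc j' \<and> i' < col_lengths p j')" for i j
    by (cases i; cases j) (auto simp: galois diagram_iff row_lengths_def Suc_le_eq)
  then show ?thesis by (auto simp: image_iff)
qed

lemma prod_diagram: "(\<Prod>(i, j)\<in>diagram p. f i j) = (\<Prod>(i, j)\<in>{(i, j). i < col_lengths p j}. f (Suc i) (Suc j))"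
  for f :: "nat \<Rightarrow> nat \<Rightarrow> real"
  by (rule prod.reindex_bij_witness[where i = "\<lambda>(i, j). (Suc i, Suc j)" and j = "\<lambda>(i, j). (i - 1, j - 1)"])
    (auto simp: diagram_eq)

lemma jack_weight_cols: "jack_weight \<alpha> d p = col_weight \<alpha> d (col_lengths p)"
  unfolding jack_weight_def col_weight_def prod_diagram
  using hook_prod_boxes[of "col_lengths p" "row_lengths p" d \<alpha>, OF galois]
    col_lengths_columns columns_zero[OF col_lengths_columns]
  by (simp add: columns_def row_lengths_def col_lengths_def)

text \<open>Conjugation exchanges arms and legs. Pulling \<open>\<alpha>\<close> out of each hook
  factor turns it into the other one for \<open>1 / \<alpha>\<close>; the resulting
  \<open>\<alpha> ^ (2 * d)\<close> turns the numerator \<open>\<alpha> ^ d\<close> into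
  \<open>(1 / \<alpha>) ^ d\<close>.\<close>

lemma jack_weight_rows:
  assumes alpha: "\<alpha> > 0"
  shows "jack_weight \<alpha> d p = col_weight (1 / \<alpha>) d (row_lengths p)"
proof -
  define \<beta> where "\<beta> = 1 / \<alpha>"
  define r c where "r = row_lengths p" and "c = col_lengths p"
  have "(\<Prod>(i, j)\<in>diagram p.
        (\<alpha> * (real (nth_part p i) - real j) + (real (conj_part p j) - real i) + 1) *
        (\<alpha> * (real (nth_part p i) - real j) + (real (conj_part p j) - real i) + \<alpha>))
     = (\<Prod>(i, j)\<in>{(i, j). i < c j}. \<alpha>\<^sup>2 *
        ((\<beta> * (real (c j) - real (Suc i)) + (real (r i) - real (Suc j)) + 1) *
        (\<beta> * (real (c j) - real (Suc i)) + (real (r i) - real (Suc j)) + \<beta>)))"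
    unfolding prod_diagram c_def[symmetric] using alpha
    by (intro prod.cong refl)
      (auto simp: \<beta>_def r_def c_def row_lengths_def col_lengths_def power2_eq_square field_simps)
  also have "\<dots> = (\<alpha>\<^sup>2) ^ d * (\<Prod>(i, j)\<in>{(i, j). i < c j}.
        (\<beta> * (real (c j) - real (Suc i)) + (real (r i) - real (Suc j)) + 1) *
        (\<beta> * (real (c j) - real (Suc i)) + (real (r i) - real (Suc j)) + \<beta>))"
    using card_boxes by (simp add: case_prod_unfold prod.distrib c_def)
  also have "(\<Prod>(i, j)\<in>{(i, j). i < c j}.
        (\<beta> * (real (c j) - real (Suc i)) + (real (r i) - real (Suc j)) + 1) *
        (\<beta> * (real (c j) - real (Suc i)) + (real (r i) - real (Suc j)) + \<beta>))
      = (\<Prod>(j, i)\<in>{(j, i). j < r i}.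
        (\<beta> * (real (c j) - real (Suc i)) + (real (r i) - real (Suc j)) + 1) *
        (\<beta> * (real (c j) - real (Suc i)) + (real (r i) - real (Suc j)) + \<beta>))"
    by (rule prod.reindex_bij_witness[where i = "\<lambda>(j, i). (i, j)" and j = "\<lambda>(i, j). (j, i)"])
      (auto simp: r_def c_def galois)
  also have "\<dots> = hook_prod \<beta> d r"
  proof (rule hook_prod_boxes)
    show "j < r i \<longleftrightarrow> i < c j" for i j using galois by (simp add: r_def c_def)
    show "r (Suc j) \<le> r j" for j using row_lengths_columns by (simp add: r_def columns_def)
    show "r j = 0" if "d \<le> j" for j using columns_zero[OF row_lengths_columns that] by (simp add: r_def)
  qed
  finally show ?thesis using alpha
    unfolding jack_weight_def col_weight_def \<beta>_def r_def
    by (simp add: power_divide power_mult_distrib power2_eq_square field_simps)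
qed

end

lemma row_lengths_inj: "inj_on row_lengths (partitions d)"
proof (rule inj_onI)
  fix p p' assume pp: "p \<in> partitions d" "p' \<in> partitions d" and eq: "row_lengths p = row_lengths p'"
  have pos: "i < length q \<longleftrightarrow> row_lengths q i > 0" if "q \<in> partitions d" for q i
  proof (cases "i < length q")
    case True
    have "0 \<notin> set q" using that by (simp add: partitions_def)
    then have "q ! i \<noteq> 0" using nth_mem[OF True] by metis
    then show ?thesis using True by (simp add: row_lengths_def nth_part_def)
  qed (simp add: row_lengths_def nth_part_def)
  have "i < length p \<longleftrightarrow> i < length p'" for i using pos[OF pp(1)] pos[OF pp(2)] eq by simp
  then have len: "length p = length p'" by (metis less_irrefl linorder_neqE_nat)
  have "p ! i = p' ! i" if "i < length p" for i
    using fun_cong[OF eq, of i] that len by (simp add: row_lengths_def nth_part_def)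
  then show "p = p'" using len by (intro nth_equalityI) auto
qed

lemma col_lengths_inj: "inj_on col_lengths (partitions d)"
proof (rule inj_onI)
  fix p p' assume pp: "p \<in> partitions d" "p' \<in> partitions d" and eq: "col_lengths p = col_lengths p'"
  have iff: "j < row_lengths p i \<longleftrightarrow> j < row_lengths p' i" for i j
    using galois[OF pp(1)] galois[OF pp(2)] eq by metis
  have "row_lengths p i = row_lengths p' i" for i
    using iff[of "row_lengths p i" i] iff[of "row_lengths p' i" i] by auto
  then show "p = p'" using row_lengths_inj pp by (auto simp: inj_on_def fun_eq_iff)
qed

lemma finite_partitions: "finite (partitions d)"
  using finite_subset[of "row_lengths ` partitions d" "columns d"] row_lengths_columns finite_columns
    finite_imageD[OF _ row_lengths_inj] by blast

section \<open>Profiles\<close>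

text \<open>Everything below the staircase, with the complement of the open quadrant. The heights
  \<open>y\<close> may be positive for all \<open>j\<close>, as happens for the limit shape.\<close>

definition region :: "real \<Rightarrow> (nat \<Rightarrow> real) \<Rightarrow> (real \<times> real) set" where
  "region w y = {(a, b). a \<le> 0 \<or> b \<le> 0 \<or> (\<exists>j. a \<le> real (Suc j) * w \<and> b \<le> y j)}"

text \<open>The point \<open>(x, y)\<close> with \<open>x - y = u\<close> and
  \<open>x + y = v\<close>.\<close>

definition pt :: "real \<Rightarrow> real \<Rightarrow> real \<times> real" where
  "pt u v = ((v + u) / 2, (v - u) / 2)"

lemma region_down: "(a, b) \<in> region w y \<Longrightarrow> a' \<le> a \<Longrightarrow> b' \<le> b \<Longrightarrow> (a', b') \<in> region w y"
  unfolding region_def by (auto intro: order_trans)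

text \<open>A diagonal shift by \<open>\<epsilon>\<close> absorbs errors in width and height alike,
  and pushes columns of height at most \<open>\<epsilon>\<close> into the half-plane. So only the
  first \<open>J\<close> columns have to be compared.\<close>

lemma region_shift:
  assumes ab: "(a, b) \<in> region w y" and small: "\<And>j. J \<le> j \<Longrightarrow> y j \<le> \<epsilon>"
    and close: "\<And>j. j < J \<Longrightarrow> real (Suc j) * w \<le> real (Suc j) * w' + \<epsilon> \<and> y j \<le> y' j + \<epsilon>" and e: "\<epsilon> \<ge> 0"
  shows "(a - \<epsilon>, b - \<epsilon>) \<in> region w' y'"
proof (cases "a \<le> \<epsilon> \<or> b \<le> \<epsilon>")
  case True
  then show ?thesis by (auto simp: region_def)
next
  case False
  then obtain j where j: "a \<le> real (Suc j) * w" "b \<le> y j" using ab e by (auto simp: region_def)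
  then have "j < J" using small[of j] False by (cases "J \<le> j") auto
  then have "a - \<epsilon> \<le> real (Suc j) * w'" "b - \<epsilon> \<le> y' j" using close[of j] j by auto
  then show ?thesis unfolding region_def by blast
qed

lemma unit_interval_cover:
  assumes "0 < t" "t \<le> real n * c" "c > 0"
  shows "\<exists>k. 1 \<le> k \<and> k \<le> n \<and> (real k - 1) * c \<le> t \<and> t \<le> real k * c"
proof (intro exI conjI)
  let ?k = "nat \<lceil>t / c\<rceil>"
  have tc: "0 < t / c" "t / c \<le> real n" using assms by (auto simp: divide_simps)
  show "1 \<le> ?k" "?k \<le> n" using tc by linarith+
  have k: "real ?k - 1 \<le> t / c" "t / c \<le> real ?k" using tc by linarith+
  show "(real ?k - 1) * c \<le> t" using k(1) assms(3) by (simp only: pos_le_divide_eq)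
  show "t \<le> real ?k * c" using k(2) assms(3) by (simp only: pos_divide_le_eq)
qed

context
  fixes p :: "nat list" and d :: nat and w h :: real
  assumes p: "p \<in> partitions d" and w: "w > 0" and h: "h > 0"
begin

lemma scaled_diagram_region:
  "scaled_diagram w h p \<union> {(x, y). x \<le> 0 \<or> y \<le> 0} = region w (\<lambda>j. h * real (col_lengths p j))" (is "?S = ?R")
proof -
  have "(x, y) \<in> ?S \<longleftrightarrow> (x, y) \<in> ?R" for x y
  proof (cases "x \<le> 0 \<or> y \<le> 0")
    case False
    then have pos: "x > 0" "y > 0" by auto
    show ?thesis
    proof
      assume "(x, y) \<in> ?S"
      then obtain i j where ij: "(i, j) \<in> diagram p" "x \<le> real j * w" "y \<le> real i * h"
        using pos by (auto simp: scaled_diagram_def)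
      then obtain i' j' where ij': "i = Suc i'" "j = Suc j'" "i' < col_lengths p j'"
        by (auto simp: diagram_eq[OF p])
      have "real i * h \<le> h * real (col_lengths p j')"
        using ij' h by (simp add: mult.commute)
      then show "(x, y) \<in> ?R" using ij ij' by (force simp: region_def)
    next
      assume "(x, y) \<in> ?R"
      then obtain j where j: "x \<le> real (Suc j) * w" "y \<le> real (col_lengths p j) * h"
        using pos by (auto simp: region_def mult.commute)
      obtain j' where j': "1 \<le> j'" "j' \<le> Suc j" "(real j' - 1) * w \<le> x" "x \<le> real j' * w"
        using unit_interval_cover[OF pos(1) j(1) w] by blast
      obtain i' where i': "1 \<le> i'" "i' \<le> col_lengths p j" "(real i' - 1) * h \<le> y" "y \<le> real i' * h"
        using unit_interval_cover[OF pos(2) j(2) h] by blast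
      have "col_lengths p j \<le> col_lengths p (j' - 1)"
        using j' by (intro columns_antimono[OF col_lengths_columns[OF p]]) auto
      then have "(i', j') = (Suc (i' - 1), Suc (j' - 1)) \<and> i' - 1 < col_lengths p (j' - 1)" using i' j' by auto
      then have "(i', j') \<in> diagram p" unfolding diagram_eq[OF p] by (intro rev_image_eqI[of "(i' - 1, j' - 1)"]) auto
      moreover have "(x, y) \<in> {(real j' - 1) * w..real j' * w} \<times> {(real i' - 1) * h..real i' * h}" using i' j' by simp
      ultimately show "(x, y) \<in> ?S" unfolding scaled_diagram_def by blast
    qed
  qed (auto simp: region_def)
  then show ?thesis by auto
qed

lemma region_swap:
  "(x, y) \<in> region w (\<lambda>j. h * real (col_lengths p j)) \<longleftrightarrow> (y, x) \<in> region h (\<lambda>i. w * real (row_lengths p i))"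
proof (cases "x \<le> 0 \<or> y \<le> 0")
  case False
  then have pos: "x > 0" "y > 0" by auto
  show ?thesis
  proof
    assume "(x, y) \<in> region w (\<lambda>j. h * real (col_lengths p j))"
    then obtain j where j: "x \<le> real (Suc j) * w" "y \<le> h * real (col_lengths p j)" using pos by (auto simp: region_def)
    then obtain i where i: "col_lengths p j = Suc i" using pos by (cases "col_lengths p j") auto
    then have "j < row_lengths p i" using galois[OF p, of i j] by simp
    then have "real (Suc j) * w \<le> real (row_lengths p i) * w" using w by (intro mult_right_mono) auto
    then have "x \<le> w * real (row_lengths p i)" using j(1) by (simp only: mult.commute order_trans)
    moreover have "y \<le> real (Suc i) * h" using j(2) unfolding i by (simp only: mult.commute)
    ultimately show "(y, x) \<in> region h (\<lambda>i. w * real (row_lengths p i))" unfolding region_def by blast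
  next
    assume "(y, x) \<in> region h (\<lambda>i. w * real (row_lengths p i))"
    then obtain i where i: "y \<le> real (Suc i) * h" "x \<le> w * real (row_lengths p i)" using pos by (auto simp: region_def)
    then obtain j where j: "row_lengths p i = Suc j" using pos by (cases "row_lengths p i") auto
    then have "i < col_lengths p j" using galois[OF p, of i j] by simp
    then have "real (Suc i) * h \<le> real (col_lengths p j) * h" using h by (intro mult_right_mono) auto
    then have "y \<le> h * real (col_lengths p j)" using i(1) by (simp only: mult.commute order_trans)
    moreover have "x \<le> real (Suc j) * w" using i(2) unfolding j by (simp only: mult.commute)
    ultimately show "(x, y) \<in> region w (\<lambda>j. h * real (col_lengths p j))" unfolding region_def by blast
  qed
qed (auto simp: region_def)

text \<open>The region is closed and closed downwards, so anything strictly below one of its points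
  is interior and the boundary point over \<open>u\<close> is the highest one. Profiles can then be
  compared through inclusions of regions.\<close>

lemma profile_iff: "pt u v \<in> region w (\<lambda>j. h * real (col_lengths p j)) \<longleftrightarrow> v \<le> profile w h p u"
proof -
  define S where "S = region w (\<lambda>j. h * real (col_lengths p j))"
  have quad: "{(x::real, y::real). x \<le> 0 \<or> y \<le> 0} = {..0} \<times> UNIV \<union> UNIV \<times> {..0}" by auto
  have cp: "compact (scaled_diagram w h p)" unfolding scaled_diagram_def
    by (rule compact_UN[OF finite_diagram]) (auto intro!: compact_Times)
  have "closed S" unfolding S_def scaled_diagram_region[symmetric] quad
    by (intro closed_Un closed_Times compact_imp_closed[OF cp]) auto
  have eb: "extended_boundary w h p = frontier S"
    by (simp add: extended_boundary_def scaled_diagram_region S_def)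
  let ?f = "profile w h p u"
  have "(u, ?f) \<in> (\<lambda>(x, y). (x - y, x + y)) ` frontier S"
    using profile_graph[OF p w h] unfolding eb by blast
  then obtain x y where xy: "(x, y) \<in> frontier S" "u = x - y" "?f = x + y" by auto
  then have "pt u ?f = (x, y)" by (simp add: pt_def)
  then have fr: "pt u ?f \<in> frontier S" using xy(1) by simp
  then have inS: "pt u ?f \<in> S" using frontier_subset_closed[OF \<open>closed S\<close>] by blast
  show ?thesis unfolding S_def[symmetric]
  proof
    assume v: "pt u v \<in> S"
    show "v \<le> ?f"
    proof (rule ccontr)
      assume "\<not> v \<le> ?f"
      let ?U = "{..<(v + u) / 2} \<times> {..<(v - u) / 2}"
      have "open ?U" by (intro open_Times) auto
      moreover have "?U \<subseteq> S" using v region_down[of "(v + u) / 2" "(v - u) / 2"]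
        unfolding S_def pt_def by auto
      moreover have "pt u ?f \<in> ?U" using \<open>\<not> v \<le> ?f\<close> by (simp add: pt_def)
      ultimately have "pt u ?f \<in> interior S" by (meson interiorI)
      then show False using fr by (simp add: frontier_def)
    qed
  next
    assume "v \<le> ?f"
    then have "(v + u) / 2 \<le> (?f + u) / 2" "(v - u) / 2 \<le> (?f - u) / 2" by auto
    then show "pt u v \<in> S" using inS region_down unfolding S_def pt_def by blast
  qed
qed

lemma profile_swap_iff: "pt (- u) v \<in> region h (\<lambda>i. w * real (row_lengths p i)) \<longleftrightarrow> v \<le> profile w h p u"
proof -
  have "pt (- u) v = ((v - u) / 2, (v + u) / 2)" by (simp add: pt_def)
  then show ?thesis unfolding profile_iff[symmetric] using region_swap[of "(v + u) / 2" "(v - u) / 2"]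
    by (simp add: pt_def)
qed

end

text \<open>The profile of a general region; \<open>profile\<close> itself applies only to finite
  diagrams, not to their limit.\<close>

definition roof :: "(real \<times> real) set \<Rightarrow> real \<Rightarrow> real" where
  "roof R u = Sup {v. pt u v \<in> R}"

lemma pt_shift: "pt u v = (a, b) \<Longrightarrow> pt u (v - 2 * \<epsilon>) = (a - \<epsilon>, b - \<epsilon>)"
  by (auto simp: pt_def field_simps)

text \<open>The top of column \<open>j\<close> runs over \<open>x\<close> from \<open>g * j\<close>
  to \<open>g * (j + 1)\<close> at height \<open>y j\<close>. In the coordinate \<open>x - y\<close>
  this is the interval from \<open>l j - g\<close> to \<open>l j\<close>.\<close>

locale limit_staircase =
  fixes g :: real and l y :: "nat \<Rightarrow> real"
  assumes g: "g > 0" and y_eq: "\<And>j. y j = g * real (Suc j) - l j"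
    and y_anti: "\<And>i j. i \<le> j \<Longrightarrow> y j \<le> y i" and y_nonneg: "\<And>j. y j \<ge> 0"
begin

lemma l_eq: "l j = g * real (Suc j) - y j"
  using y_eq by simp

definition R where "R = region g y"

lemma R_bounded:
  assumes "pt u v \<in> R"
  shows "v \<le> \<bar>u\<bar> + 2 * y 0"
proof -
  consider "(v + u) / 2 \<le> 0" | "(v - u) / 2 \<le> 0" | j where "(v - u) / 2 \<le> y j"
    using assms unfolding R_def region_def pt_def by auto
  then show ?thesis
  proof cases
    case (3 j)
    then show ?thesis using y_anti[of 0 j] by simp
  qed (use y_nonneg[of 0] in auto)
qed

lemma roof_upper: "pt u v \<in> R \<Longrightarrow> v \<le> roof R u"
  unfolding roof_def by (rule cSup_upper) (auto intro!: bdd_aboveI R_bounded)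

lemma roof_least:
  assumes "\<And>v. pt u v \<in> R \<Longrightarrow> v \<le> B"
  shows "roof R u \<le> B"
  unfolding roof_def
proof (rule cSup_least)
  have "pt u (- \<bar>u\<bar>) \<in> R" by (auto simp: R_def region_def pt_def)
  then show "{v. pt u v \<in> R} \<noteq> {}" by blast
qed (use assms in auto)

lemma roof_eqI:
  assumes "pt u v \<in> R" "\<And>v'. v' > v \<Longrightarrow> pt u v' \<notin> R"
  shows "roof R u = v"
  using roof_upper[OF assms(1)] roof_least[of u v] assms(2) by (meson antisym not_le)

lemma roof_left:
  assumes "u < l 0 - g"
  shows "roof R u = - u"
proof (rule roof_eqI)
  show "pt u (- u) \<in> R" by (simp add: R_def region_def pt_def)
  fix v assume v: "v > - u"
  have "u < - y 0" using assms by (simp add: l_eq)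
  then have "(v - u) / 2 > y j" for j using v y_anti[of 0 j] by simp
  then show "pt u v \<notin> R" using v \<open>u < - y 0\<close> y_nonneg[of 0] by (auto simp: R_def region_def pt_def not_le)
qed

lemma roof_horizontal:
  assumes "u \<in> {l j - g..l j}"
  shows "roof R u = 2 * y j + u"
proof (rule roof_eqI)
  have u: "y j + u \<le> g * real (Suc j)" "y j + u \<ge> g * real j"
    using assms by (auto simp: l_eq algebra_simps)
  have p: "pt u (2 * y j + u) = (y j + u, y j)" by (simp add: pt_def)
  show "pt u (2 * y j + u) \<in> R" unfolding p R_def region_def using u(1) by (auto simp: mult.commute)
  fix v assume v: "v > 2 * y j + u"
  have x: "(v + u) / 2 > g * real j" "(v - u) / 2 > y j" using v u(2) by auto
  show "pt u v \<notin> R"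
  proof
    assume "pt u v \<in> R"
    moreover have "g * real j \<ge> 0" using g by simp
    ultimately obtain k where k: "(v + u) / 2 \<le> real (Suc k) * g" "(v - u) / 2 \<le> y k"
      using x y_nonneg[of j] unfolding R_def region_def pt_def by auto
    have "g * real j < g * real (Suc k)" using x(1) k(1) by (simp only: mult.commute)
    then have "j \<le> k" using g by simp
    then show False using y_anti[of j k] k(2) x(2) by linarith
  qed
qed

lemma roof_vertical:
  assumes "u \<in> {l j..l (Suc j) - g}"
  shows "roof R u = - u + 2 * real (Suc j) * g"
proof (rule roof_eqI)
  have u: "g * real (Suc j) - u \<le> y j" "g * real (Suc j) - u \<ge> y (Suc j)"
    using assms by (auto simp: l_eq algebra_simps)
  have p: "pt u (- u + 2 * real (Suc j) * g) = (real (Suc j) * g, g * real (Suc j) - u)"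
    by (simp add: pt_def field_simps)
  show "pt u (- u + 2 * real (Suc j) * g) \<in> R" unfolding p R_def region_def using u(1) by blast
  fix v assume v: "v > - u + 2 * real (Suc j) * g"
  define t where "t = g * real (Suc j)"
  have v': "v > - u + 2 * t" unfolding t_def using v by (simp only: mult_ac)
  have "2 * t < v + u" using v' by simp
  then have x: "(v + u) / 2 > g * real (Suc j)" unfolding t_def[symmetric] by simp
  have "2 * t - 2 * u < v - u" using v' by simp
  then have "t - u < (v - u) / 2" by simp
  then have y: "(v - u) / 2 > y (Suc j)" using u(2) unfolding t_def[symmetric] by (rule le_less_trans[rotated])
  show "pt u v \<notin> R"
  proof
    assume "pt u v \<in> R"
    moreover have "g * real (Suc j) \<ge> 0" using g by simp
    ultimately obtain k where k: "(v + u) / 2 \<le> real (Suc k) * g" "(v - u) / 2 \<le> y k"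
      using x y y_nonneg[of "Suc j"] unfolding R_def region_def pt_def by auto
    have "g * real (Suc j) < g * real (Suc k)" using x k(1) by (simp only: mult.commute)
    then have "Suc j \<le> k" using g by (simp only: mult_less_cancel_left_pos of_nat_less_iff Suc_less_eq less_eq_Suc_le)
    then show False using y_anti[of "Suc j" k] k(2) y by linarith
  qed
qed

text \<open>Each region, shifted diagonally by \<open>\<epsilon>\<close>, lies in the other. Such a
  shift lowers \<open>x + y\<close> by \<open>2 * \<epsilon>\<close>.\<close>

lemma roof_close:
  assumes f: "\<And>v. pt u v \<in> region w y' \<longleftrightarrow> v \<le> f" and e: "\<epsilon> \<ge> 0"
    and small: "\<And>j. J \<le> j \<Longrightarrow> y j \<le> \<epsilon>" "\<And>j. J \<le> j \<Longrightarrow> y' j \<le> \<epsilon>"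
    and close: "\<And>j. j < J \<Longrightarrow> \<bar>y' j - y j\<bar> \<le> \<epsilon>" and w: "real J * \<bar>w - g\<bar> \<le> \<epsilon>"
  shows "\<bar>f - roof R u\<bar> \<le> 2 * \<epsilon>"
proof -
  have wc: "\<bar>real (Suc j) * w - real (Suc j) * g\<bar> \<le> \<epsilon>" if "j < J" for j
  proof -
    have "\<bar>real (Suc j) * w - real (Suc j) * g\<bar> = real (Suc j) * \<bar>w - g\<bar>"
      by (simp add: abs_mult flip: right_diff_distrib)
    also have "\<dots> \<le> real J * \<bar>w - g\<bar>" using that by (intro mult_right_mono) auto
    finally show ?thesis using w by simp
  qed
  have "roof R u \<le> f + 2 * \<epsilon>"
  proof (rule roof_least)
    fix v assume v: "pt u v \<in> R"
    obtain a b where ab: "pt u v = (a, b)" by force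
    have "(a - \<epsilon>, b - \<epsilon>) \<in> region w y'"
    proof (rule region_shift[OF _ small(1) _ e])
      show "(a, b) \<in> region g y" using v ab by (simp add: R_def)
      show "real (Suc j) * g \<le> real (Suc j) * w + \<epsilon> \<and> y j \<le> y' j + \<epsilon>" if "j < J" for j
        using wc[OF that] close[OF that] by linarith
    qed
    then have "v - 2 * \<epsilon> \<le> f" using f[of "v - 2 * \<epsilon>"] pt_shift[OF ab] by simp
    then show "v \<le> f + 2 * \<epsilon>" by simp
  qed
  moreover have "f - 2 * \<epsilon> \<le> roof R u"
  proof (rule roof_upper)
    obtain a b where ab: "pt u f = (a, b)" by force
    have "(a - \<epsilon>, b - \<epsilon>) \<in> region g y"
    proof (rule region_shift[OF _ small(2) _ e])
      show "(a, b) \<in> region w y'" using f[of f] ab by simp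
      show "real (Suc j) * w \<le> real (Suc j) * g + \<epsilon> \<and> y' j \<le> y j + \<epsilon>" if "j < J" for j
        using wc[OF that] close[OF that] by linarith
    qed
    then show "pt u (f - 2 * \<epsilon>) \<in> R" using pt_shift[OF ab] by (simp add: R_def)
  qed
  ultimately show ?thesis by linarith
qed

end

section \<open>The law of large numbers\<close>

lemma compactness:
  assumes g: "g > 0" and N: "\<And>k. N k > 0" "\<And>k. \<beta> (N k) \<ge> 1" and c: "\<And>k. c k \<in> columns (N k)"
    and Nlim: "filterlim N at_top sequentially"
    and lim: "(\<lambda>d. sqrt (\<beta> d) / sqrt (real d)) \<longlonglongrightarrow> g"
    and defect_at: "\<And>\<zeta>. \<zeta> \<in> test_points g \<Longrightarrow>
      (\<lambda>k. defect (\<beta> (N k)) (Suc (N k)) (scale (\<beta> (N k)) (N k)) (scale (\<beta> (N k)) (N k) * \<zeta>) (c k)) \<longlonglongrightarrow> 0"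
  obtains r l where "strict_mono r" "strict_mono l" "{z. phi g z = 0} = range l"
    "\<And>j. (\<lambda>k. real (c (r k) j) / scale (\<beta> (N (r k))) (N (r k))) \<longlonglongrightarrow> g * (real j + 1) - l j"
proof -
  define \<gamma> where "\<gamma> k = sqrt (\<beta> (N k)) / sqrt (real (N k))" for k
  have \<gamma>: "\<gamma> \<longlonglongrightarrow> g" unfolding \<gamma>_def using filterlim_compose[OF lim Nlim] by simp
  then have "(\<lambda>k. 1 / \<gamma> k) \<longlonglongrightarrow> 1 / g" using g by (intro tendsto_intros) auto
  then have "Bseq (\<lambda>k. 1 / \<gamma> k)" by (intro convergent_imp_Bseq convergentI)
  then obtain B where B: "\<And>k. \<bar>1 / \<gamma> k\<bar> \<le> B" unfolding Bseq_def by auto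
  \<comment> \<open>Columns and both families of probabilities are bundled into one bounded sequence
    of triples, so that a single diagonal extraction makes all of them converge.\<close>
  define F where "F k j = (real (c k j) / scale (\<beta> (N k)) (N k),
      (if j < Suc (N k) then down_prob (\<beta> (N k)) (Suc (N k)) (c k) j else 0),
      (if j < Suc (N k) then up_prob (\<beta> (N k)) (Suc (N k)) (c k) j else 0))" for k j
  have bound: "norm (F k j) \<le> B + (1 + 1)" for k j
  proof -
    have b0: "\<beta> (N k) > 0" using N(2)[of k] by simp
    interpret column_shape "\<beta> (N k)" "Suc (N k)" "c k" using columns_column_shape[OF c b0] .
    have s: "scale (\<beta> (N k)) (N k) > 0" using b0 N(1)[of k] by (simp add: scale_def)
    have "c k j \<le> c k 0" using columns_antimono[OF c, of 0 j k] by simp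
    also have "c k 0 \<le> N k" using columns_area[OF c, of 0 k] by simp
    finally have "real (c k j) / scale (\<beta> (N k)) (N k) \<le> real (N k) / scale (\<beta> (N k)) (N k)"
      using s by (intro divide_right_mono) auto
    also have "\<dots> = 1 / \<gamma> k" using b0 N(1)[of k]
      by (simp add: \<gamma>_def scale_def real_sqrt_mult real_div_sqrt field_simps)
    also have "\<dots> \<le> B" by (rule order_trans[OF abs_ge_self B])
    finally have 1: "norm (real (c k j) / scale (\<beta> (N k)) (N k)) \<le> B" using s by simp
    obtain d where d: "N k = Suc d" using N(1)[of k] gr0_implies_Suc by blast
    have q: "norm (if j < Suc (N k) then down_prob (\<beta> (N k)) (Suc (N k)) (c k) j else 0) \<le> 1"
    proof (cases "j < Suc (N k)")
      case True
      have "down_prob (\<beta> (N k)) (Suc (N k)) (c k) j \<le> (\<Sum>i<Suc (N k). down_prob (\<beta> (N k)) (Suc (N k)) (c k) i)"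
        using True by (intro member_le_sum down_prob_nonneg) auto
      also have "\<dots> = 1" using c[of k] d by (intro sum_down_columns[OF b0, where d = d]) auto
      finally show ?thesis using True down_prob_nonneg[OF True] by simp
    qed simp
    have p: "norm (if j < Suc (N k) then up_prob (\<beta> (N k)) (Suc (N k)) (c k) j else 0) \<le> 1"
    proof (cases "j < Suc (N k)")
      case True
      have "up_prob (\<beta> (N k)) (Suc (N k)) (c k) j \<le> (\<Sum>i<Suc (N k). up_prob (\<beta> (N k)) (Suc (N k)) (c k) i)"
        using True by (intro member_le_sum up_prob_nonneg) auto
      also have "\<dots> = 1" by (intro sum_up_columns[OF b0 c]) auto
      finally show ?thesis using True up_prob_nonneg[OF True] by simp
    qed simp
    show ?thesis unfolding F_def by (intro norm_Pair_le[THEN order_trans] add_mono 1 q p)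
  qed
  obtain r where r: "strict_mono r" "\<And>j. \<exists>L. (\<lambda>k. F (r k) j) \<longlonglongrightarrow> L"
  proof (rule function_convergent_subsequence[of "UNIV :: nat set" F "B + (1 + 1)"])
    fix k :: "nat \<Rightarrow> nat"
    assume k: "strict_mono k" "\<And>x. x \<in> UNIV \<Longrightarrow> \<exists>L. (\<lambda>n. F (k n) x) \<longlonglongrightarrow> L"
    show thesis by (rule that[OF k(1) k(2)[OF UNIV_I]])
  qed (use bound in auto)
  then obtain L where L: "\<And>j. (\<lambda>k. F (r k) j) \<longlonglongrightarrow> L j" by metis
  have rlim: "filterlim r at_top sequentially" using r(1) by (rule filterlim_subseq)
  have 1: "(\<lambda>k. real (c (r k) j) / scale (\<beta> (N (r k))) (N (r k))) \<longlonglongrightarrow> fst (L j)" for j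
    using tendsto_fst[OF L[of j]] by (simp add: F_def)
  interpret column_sequence g "\<lambda>k. N (r k)" "\<lambda>k. \<beta> (N (r k))" "\<lambda>k. c (r k)"
    "\<lambda>j. fst (L j)" "\<lambda>j. fst (snd (L j))" "\<lambda>j. snd (snd (L j))"
  proof
    show "filterlim (\<lambda>k. N (r k)) at_top sequentially" by (rule filterlim_compose[OF Nlim rlim])
    show "(\<lambda>k. sqrt (\<beta> (N (r k))) / sqrt (real (N (r k)))) \<longlonglongrightarrow> g"
      using filterlim_compose[OF \<gamma> rlim] by (simp add: \<gamma>_def)
    show "(\<lambda>k. if j < Suc (N (r k)) then down_prob (\<beta> (N (r k))) (Suc (N (r k))) (c (r k)) j else 0) \<longlonglongrightarrow> fst (snd (L j))" for j
      using tendsto_fst[OF tendsto_snd[OF L[of j]]] by (simp add: F_def)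
    show "(\<lambda>k. if j < Suc (N (r k)) then up_prob (\<beta> (N (r k))) (Suc (N (r k))) (c (r k)) j else 0) \<longlonglongrightarrow> snd (snd (L j))" for j
      using tendsto_snd[OF tendsto_snd[OF L[of j]]] by (simp add: F_def)
    show "(\<lambda>k. defect (\<beta> (N (r k))) (Suc (N (r k))) (scale (\<beta> (N (r k))) (N (r k)))
       (scale (\<beta> (N (r k))) (N (r k)) * \<zeta>) (c (r k))) \<longlonglongrightarrow> 0" if "\<zeta> \<in> test_points g" for \<zeta>
      using filterlim_compose[OF defect_at[OF that] rlim] by simp
  qed (use g N c 1 in auto)
  show thesis
  proof (rule that[OF r(1) l_strict_mono phi_zeros])
    show "(\<lambda>k. real (c (r k) j) / scale (\<beta> (N (r k))) (N (r k))) \<longlonglongrightarrow> g * (real j + 1) - l j" for j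
      using 1[of j] by (simp add: l_def)
  qed
qed

lemma strict_mono_range_unique:
  fixes l l' :: "nat \<Rightarrow> 'a::linorder"
  assumes "strict_mono l" "strict_mono l'" "range l = range l'"
  shows "l = l'"
proof
  fix n show "l n = l' n"
  proof (induction n rule: less_induct)
    case (less n)
    have le: "b n \<le> a n" if ab: "strict_mono a" "strict_mono b" "range a = range b" "\<And>m. m < n \<Longrightarrow> a m = b m"
      for a b :: "nat \<Rightarrow> 'a"
    proof -
      obtain k where k: "a n = b k" using ab(3) by (metis rangeE rangeI)
      have "k \<ge> n"
      proof (rule ccontr)
        assume "\<not> k \<ge> n"
        then have "k < n" by simp
        then have "a k = a n" using ab(4)[of k] k by simp
        then show False using \<open>k < n\<close> ab(1) by (metis less_irrefl strict_monoD)
      qed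
      then show ?thesis unfolding k using ab(2) by (simp add: strict_mono_less_eq)
    qed
    show ?case using le[OF assms] le[OF assms(2,1) assms(3)[symmetric]] less.IH by (metis antisym)
  qed
qed

text \<open>\<open>\<beta>\<close> is the Jack parameter itself when columns are studied, and its
  inverse when rows are.\<close>

locale jack_regime =
  fixes g :: real and \<beta> :: "nat \<Rightarrow> real"
  assumes g: "g > 0" and \<beta>_pos: "\<And>d. d \<ge> 1 \<Longrightarrow> \<beta> d > 0"
    and \<beta>_lim: "filterlim \<beta> at_top sequentially"
    and \<gamma>_lim: "(\<lambda>d. sqrt (\<beta> d) / sqrt (real d)) \<longlonglongrightarrow> g"
begin

definition s where "s d = scale (\<beta> d) d"
definition \<gamma> where "\<gamma> d = sqrt (\<beta> d) / sqrt (real d)"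
definition defect_at where "defect_at d \<zeta> c = defect (\<beta> d) (Suc d) (s d) (s d * \<zeta>) c"
definition prob where "prob d A = (\<Sum>c\<in>{c \<in> columns d. A c}. col_weight (\<beta> d) d c)"

lemma prob_nonneg: "d \<ge> 1 \<Longrightarrow> prob d A \<ge> 0"
  unfolding prob_def using \<beta>_pos by (intro sum_nonneg) (auto intro: col_weight_nonneg)

lemma prob_mono: "d \<ge> 1 \<Longrightarrow> (\<And>c. c \<in> columns d \<Longrightarrow> A c \<Longrightarrow> B c) \<Longrightarrow> prob d A \<le> prob d B"
  unfolding prob_def using \<beta>_pos finite_columns by (intro sum_mono2) (auto intro: col_weight_nonneg)

lemma prob_UN:
  fixes n :: nat
  assumes "d \<ge> 1"
  shows "prob d (\<lambda>c. \<exists>r<n. A r c) \<le> (\<Sum>r<n. prob d (A r))"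
proof (induction n)
  case 0
  then show ?case by (simp add: prob_def)
next
  case (Suc n)
  have w: "c \<in> columns d \<Longrightarrow> col_weight (\<beta> d) d c \<ge> 0" for c
    using \<beta>_pos[OF assms] by (rule col_weight_nonneg)
  have "{c \<in> columns d. \<exists>r<Suc n. A r c} = {c \<in> columns d. \<exists>r<n. A r c} \<union> {c \<in> columns d. A n c}"
    by (auto simp: less_Suc_eq)
  then have "prob d (\<lambda>c. \<exists>r<Suc n. A r c) \<le> prob d (\<lambda>c. \<exists>r<n. A r c) + prob d (A n)"
    unfolding prob_def using finite_columns[of d] w
    by (simp add: sum_Un) (intro sum_nonneg, auto)
  then show ?case using Suc.IH by simp
qed

lemma prob_UN_tendsto:
  fixes n :: nat
  assumes "\<And>r. r < n \<Longrightarrow> (\<lambda>d. prob d (A d r)) \<longlonglongrightarrow> 0"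
  shows "(\<lambda>d. prob d (\<lambda>c. \<exists>r<n. A d r c)) \<longlonglongrightarrow> 0"
proof (rule tendsto_sandwich[OF _ _ tendsto_const])
  show "(\<lambda>d. \<Sum>r<n. prob d (A d r)) \<longlonglongrightarrow> 0"
    using tendsto_sum[of "{..<n}" "\<lambda>r d. prob d (A d r)" "\<lambda>_. 0"] assms by simp
  show "\<forall>\<^sub>F d in sequentially. 0 \<le> prob d (\<lambda>c. \<exists>r<n. A d r c)"
    using eventually_ge_at_top[of 1] by eventually_elim (rule prob_nonneg)
  show "\<forall>\<^sub>F d in sequentially. prob d (\<lambda>c. \<exists>r<n. A d r c) \<le> (\<Sum>r<n. prob d (A d r))"
    using eventually_ge_at_top[of 1] by eventually_elim (rule prob_UN)
qed

lemma prob_tendsto_mono: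
  assumes "(\<lambda>d. prob d (B d)) \<longlonglongrightarrow> 0"
    and "\<forall>\<^sub>F d in sequentially. \<forall>c\<in>columns d. A d c \<longrightarrow> B d c"
  shows "(\<lambda>d. prob d (A d)) \<longlonglongrightarrow> 0"
proof (rule tendsto_sandwich[OF _ _ tendsto_const assms(1)])
  show "\<forall>\<^sub>F d in sequentially. 0 \<le> prob d (A d)"
    using eventually_ge_at_top[of 1] by eventually_elim (rule prob_nonneg)
  show "\<forall>\<^sub>F d in sequentially. prob d (A d) \<le> prob d (B d)"
    using eventually_ge_at_top[of 1] assms(2) by eventually_elim (rule prob_mono, auto)
qed

lemma \<gamma>_large: "\<forall>\<^sub>F d in sequentially. \<gamma> d > g / 2"
  using \<gamma>_lim g unfolding \<gamma>_def by (intro order_tendstoD) auto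

lemma s_pos: "d \<ge> 1 \<Longrightarrow> s d > 0"
  using \<beta>_pos[of d] by (simp add: s_def scale_def)

lemma \<gamma>_pos: "d \<ge> 1 \<Longrightarrow> \<gamma> d > 0"
  using \<beta>_pos[of d] by (simp add: \<gamma>_def)

lemma s_eq: "d \<ge> 1 \<Longrightarrow> s d = \<gamma> d * real d"
proof -
  have "\<gamma> d * real d = sqrt (\<beta> d) * (real d / sqrt (real d))" by (simp add: \<gamma>_def)
  also have "real d / sqrt (real d) = sqrt (real d)" by (simp add: real_div_sqrt)
  finally show "s d = \<gamma> d * real d" by (simp add: s_def scale_def real_sqrt_mult)
qed

text \<open>Chebyshev's inequality for the second moment. After scaling, the numerator is
  \<open>2 * \<bar>\<zeta>\<bar> + 5\<close>, independent of \<open>d\<close>.\<close>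

lemma defect_at_small:
  assumes z: "\<zeta> \<in> test_points g" and e: "\<delta> > 0"
  shows "(\<lambda>d. prob d (\<lambda>c. \<bar>defect_at d \<zeta> c\<bar> > \<delta>)) \<longlonglongrightarrow> 0"
proof (rule tendsto_sandwich[OF _ _ tendsto_const])
  show "\<forall>\<^sub>F d in sequentially. 0 \<le> prob d (\<lambda>c. \<bar>defect_at d \<zeta> c\<bar> > \<delta>)"
    using eventually_ge_at_top[of 1] by eventually_elim (rule prob_nonneg)
  have "(\<lambda>d. (2 * \<bar>\<zeta>\<bar> + 5) / \<delta>\<^sup>2 * (1 / real d)) \<longlonglongrightarrow> (2 * \<bar>\<zeta>\<bar> + 5) / \<delta>\<^sup>2 * 0"
    by (intro tendsto_intros lim_1_over_n)
  then show "(\<lambda>d. (2 * \<bar>\<zeta>\<bar> + 5) / \<delta>\<^sup>2 * (1 / real d)) \<longlonglongrightarrow> 0" by simp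
  have "\<forall>\<^sub>F d in sequentially. \<beta> d \<ge> 2" using \<beta>_lim by (simp add: filterlim_at_top)
  then show "\<forall>\<^sub>F d in sequentially. prob d (\<lambda>c. \<bar>defect_at d \<zeta> c\<bar> > \<delta>) \<le> (2 * \<bar>\<zeta>\<bar> + 5) / \<delta>\<^sup>2 * (1 / real d)"
    using \<gamma>_large eventually_ge_at_top[of 1]
  proof eventually_elim
    case (elim d)
    obtain d' where d': "d = Suc d'" using elim(3) by (cases d) auto
    have w: "c \<in> columns d \<Longrightarrow> col_weight (\<beta> d) d c \<ge> 0" for c
      using \<beta>_pos[OF elim(3)] by (rule col_weight_nonneg)
    note sp = s_pos[OF elim(3)] and gp = \<gamma>_pos[OF elim(3)]
    have "1 / \<gamma> d \<le> 1 / (g / 2)" using elim(2) g gp by (intro divide_left_mono) auto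
    then have "1 / \<gamma> d \<le> 2 / g" by simp
    moreover have "\<zeta> \<le> - (2 / g) - 2" using z by (auto simp: test_points_def)
    ultimately have "\<zeta> \<le> - (1 / \<gamma> d) - 1" by linarith
    then have "s d * \<zeta> \<le> s d * (- (1 / \<gamma> d) - 1)" using sp by (intro mult_left_mono) auto
    also have "\<dots> = - real d - s d" using s_eq[OF elim(3)] gp by (simp add: algebra_simps)
    finally have zs: "s d * \<zeta> \<le> - real (Suc d') - sqrt (\<beta> d * real (Suc d'))"
      by (simp add: s_def scale_def d')
    have "\<beta> d * real (Suc d') \<ge> 2 * 1" using elim(1) by (intro mult_mono) auto
    then have s1: "s d > 1" by (simp add: s_def scale_def d' real_less_rsqrt)
    have "\<delta>\<^sup>2 * prob d (\<lambda>c. \<bar>defect_at d \<zeta> c\<bar> > \<delta>) = (\<Sum>c\<in>{c \<in> columns d. \<bar>defect_at d \<zeta> c\<bar> > \<delta>}. col_weight (\<beta> d) d c * \<delta>\<^sup>2)"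
      unfolding prob_def by (simp add: sum_distrib_left mult.commute)
    also have "\<dots> \<le> (\<Sum>c\<in>{c \<in> columns d. \<bar>defect_at d \<zeta> c\<bar> > \<delta>}. col_weight (\<beta> d) d c * (defect_at d \<zeta> c)\<^sup>2)"
      using e w by (intro sum_mono mult_left_mono) (auto simp: abs_le_square_iff[symmetric])
    also have "\<dots> \<le> (\<Sum>c\<in>columns d. col_weight (\<beta> d) d c * (defect_at d \<zeta> c)\<^sup>2)"
      using w finite_columns by (intro sum_mono2) auto
    also have "\<dots> \<le> (2 * \<bar>s d * \<zeta>\<bar> / s d + 5) / real d"
      using defect_second_moment[OF _ zs, of "s d" "Suc d"] elim(1) s1
      by (simp add: d' defect_at_def s_def scale_def)
    also have "2 * \<bar>s d * \<zeta>\<bar> / s d = 2 * \<bar>\<zeta>\<bar>" using sp by (simp add: abs_mult)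
    finally have "\<delta>\<^sup>2 * prob d (\<lambda>c. \<bar>defect_at d \<zeta> c\<bar> > \<delta>) \<le> (2 * \<bar>\<zeta>\<bar> + 5) / real d" .
    moreover have "\<delta>\<^sup>2 > 0" using e by simp
    ultimately have "prob d (\<lambda>c. \<bar>defect_at d \<zeta> c\<bar> > \<delta>) \<le> (2 * \<bar>\<zeta>\<bar> + 5) / real d / \<delta>\<^sup>2"
      by (simp only: pos_le_divide_eq mult.commute)
    then show ?case by (simp add: mult.commute)
  qed
qed

section \<open>Typical diagrams and their limits\<close>

definition tp where "tp r = (case r of 0 \<Rightarrow> - 2 / g - 2 | Suc m \<Rightarrow> - 2 / g - 2 - 1 / real (Suc m))"

lemma tp_in: "tp r \<in> test_points g"
  by (cases r) (auto simp: tp_def test_points_def)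

lemma tp_range: "test_points g = range tp"
proof (intro equalityI subsetI)
  fix x assume "x \<in> test_points g"
  then consider "x = - 2 / g - 2" | m where "x = - 2 / g - 2 - 1 / real (Suc m)"
    by (auto simp: test_points_def)
  then show "x \<in> range tp"
  proof cases
    case 1
    then have "x = tp 0" by (simp add: tp_def)
    then show ?thesis by simp
  next
    case (2 m)
    then have "x = tp (Suc m)" by (simp add: tp_def)
    then show ?thesis by simp
  qed
qed (use tp_in in auto)

text \<open>One parameter \<open>K\<close> sets both the number of test points and the precision. A
  sequence of diagrams good for \<open>K = 0, 1, 2, ...\<close> therefore has vanishing defect at
  every test point.\<close>

definition good where "good d K c \<longleftrightarrow> c \<in> columns d \<and> (\<forall>r<K. \<bar>defect_at d (tp r) c\<bar> \<le> 1 / real (Suc K))"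

lemma bad_small: "(\<lambda>d. prob d (\<lambda>c. \<not> good d K c)) \<longlonglongrightarrow> 0"
proof (rule prob_tendsto_mono)
  show "(\<lambda>d. prob d (\<lambda>c. \<exists>r<K. \<bar>defect_at d (tp r) c\<bar> > 1 / real (Suc K))) \<longlonglongrightarrow> 0"
    by (intro prob_UN_tendsto defect_at_small tp_in) simp
qed (auto simp: good_def intro!: always_eventually)

lemma good_exists: "\<forall>\<^sub>F d in sequentially. \<exists>c. good d K c"
proof -
  have "\<forall>\<^sub>F d in sequentially. prob d (\<lambda>c. \<not> good d K c) < 1" using bad_small by (rule order_tendstoD) simp
  then show ?thesis using eventually_ge_at_top[of 1]
  proof eventually_elim
    case (elim d)
    show ?case
    proof (rule ccontr)
      assume "\<not> ?case"
      then have "{c \<in> columns d. \<not> good d K c} = columns d" by auto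
      then have "prob d (\<lambda>c. \<not> good d K c) = 1" using sum_col_weight[OF \<beta>_pos[OF elim(2)]] by (simp add: prob_def)
      then show False using elim by simp
    qed
  qed
qed

lemma good_limit:
  assumes N: "\<And>k. N k \<ge> Suc k" "\<And>k. \<beta> (N k) \<ge> 1" and c: "\<And>k. good (N k) k (c k)"
  obtains r l where "strict_mono (r :: nat \<Rightarrow> nat)" "strict_mono l" "{z. phi g z = 0} = range l"
    "\<And>j. (\<lambda>k. real (c (r k) j) / s (N (r k))) \<longlonglongrightarrow> g * (real j + 1) - l j"
proof (rule compactness[OF g, of N \<beta> c])
  show "N k > 0" for k using N(1)[of k] by simp
  show "c k \<in> columns (N k)" for k using c[of k] by (simp add: good_def)
  show "filterlim N at_top sequentially"
    by (rule filterlim_at_top_mono[OF filterlim_Suc always_eventually[OF allI]]) (rule N(1))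
  show "(\<lambda>k. defect (\<beta> (N k)) (Suc (N k)) (scale (\<beta> (N k)) (N k)) (scale (\<beta> (N k)) (N k) * \<zeta>) (c k)) \<longlonglongrightarrow> 0"
    if "\<zeta> \<in> test_points g" for \<zeta>
  proof -
    have "\<zeta> \<in> range tp" using that unfolding tp_range .
    then obtain r where r: "\<zeta> = tp r" by (rule rangeE)
    have "\<forall>\<^sub>F k in sequentially. norm (defect_at (N k) \<zeta> (c k)) \<le> 1 / real (Suc k)"
      using eventually_gt_at_top[of r]
    proof eventually_elim
      case (elim k)
      then show ?case using c[of k] r by (simp add: good_def)
    qed
    then have "(\<lambda>k. defect_at (N k) \<zeta> (c k)) \<longlonglongrightarrow> 0"
      by (rule Lim_null_comparison[OF _ LIMSEQ_Suc[OF lim_1_over_n]])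
    then show ?thesis by (simp add: defect_at_def s_def)
  qed
  show "(\<lambda>d. sqrt (\<beta> d) / sqrt (real d)) \<longlonglongrightarrow> g" by (rule \<gamma>_lim)
  show "\<beta> (N k) \<ge> 1" for k by (rule N(2))
  fix r l
  assume "strict_mono (r :: nat \<Rightarrow> nat)" "strict_mono l" "{z. phi g z = 0} = range l"
    "\<And>j. (\<lambda>k. real (c (r k) j) / scale (\<beta> (N (r k))) (N (r k))) \<longlonglongrightarrow> g * (real j + 1) - l j"
  then show thesis by (rule that[unfolded s_def])
qed

text \<open>Good diagrams exist because bad ones have probability below 1. A limit point of them
  supplies the enumeration of the zeros.\<close>

lemma spectrum_ex: "\<exists>l :: nat \<Rightarrow> real. strict_mono l \<and> {z. phi g z = 0} = range l"
proof -
  have "\<exists>N c. N \<ge> Suc k \<and> \<beta> N \<ge> 1 \<and> good N k c" for k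
  proof -
    have "\<forall>\<^sub>F d in sequentially. \<beta> d \<ge> 1" using \<beta>_lim by (simp add: filterlim_at_top)
    then have "\<forall>\<^sub>F N in sequentially. N \<ge> Suc k \<and> \<beta> N \<ge> 1 \<and> (\<exists>c. good N k c)"
      using good_exists[of k] eventually_ge_at_top[of "Suc k"] by eventually_elim auto
    from eventually_happens'[OF sequentially_bot this] show ?thesis by blast
  qed
  then obtain N c where Nc: "\<And>k. N k \<ge> Suc k" "\<And>k. \<beta> (N k) \<ge> 1" "\<And>k. good (N k) k (c k)" by metis
  show ?thesis
  proof (rule good_limit[OF Nc])
    fix l :: "nat \<Rightarrow> real" assume "strict_mono l" "{z. phi g z = 0} = range l"
    then show ?thesis by blast
  qed
qed

text \<open>Otherwise there are ever better diagrams with a wrong column \<open>i\<close>. They have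
  a limit point whose poles again enumerate the zeros of \<open>phi\<close> increasingly; this
  enumeration is unique, so column \<open>i\<close> was right.\<close>

lemma good_stable:
  assumes l: "strict_mono l" "{z. phi g z = 0} = range l" and e: "\<epsilon> > 0"
  shows "\<exists>K. \<forall>\<^sub>F d in sequentially. \<forall>c. good d K c \<longrightarrow> \<bar>real (c i) / s d - (g * (real i + 1) - l i)\<bar> \<le> \<epsilon>"
proof (rule ccontr)
  assume neg: "\<not> ?thesis"
  have "\<exists>N c. N \<ge> Suc k \<and> \<beta> N \<ge> 1 \<and> good N k c \<and> \<bar>real (c i) / s N - (g * (real i + 1) - l i)\<bar> > \<epsilon>" for k
  proof -
    have ev: "\<forall>\<^sub>F d in sequentially. d \<ge> Suc k \<and> \<beta> d \<ge> 1"
      using \<beta>_lim eventually_ge_at_top[of "Suc k"] by (auto simp: filterlim_at_top eventually_conj_iff)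
    have "\<exists>\<^sub>F d in sequentially. \<exists>c. good d k c \<and> \<bar>real (c i) / s d - (g * (real i + 1) - l i)\<bar> > \<epsilon>"
      using neg by (simp add: frequently_def not_less)
    from frequently_eventually_conj[OF this ev] show ?thesis
      by (auto dest!: frequently_ex)
  qed
  then obtain N c where Nc: "\<And>k. N k \<ge> Suc k" "\<And>k. \<beta> (N k) \<ge> 1" "\<And>k. good (N k) k (c k)"
    and far: "\<And>k. \<bar>real (c k i) / s (N k) - (g * (real i + 1) - l i)\<bar> > \<epsilon>" by metis
  obtain r :: "nat \<Rightarrow> nat" and l' where r: "strict_mono l'" "{z. phi g z = 0} = range l'"
    "\<And>j. (\<lambda>k. real (c (r k) j) / s (N (r k))) \<longlonglongrightarrow> g * (real j + 1) - l' j"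
  proof (rule good_limit[OF Nc])
    fix r :: "nat \<Rightarrow> nat" and l' assume "strict_mono l'" "{z. phi g z = 0} = range l'"
      "\<And>j. (\<lambda>k. real (c (r k) j) / s (N (r k))) \<longlonglongrightarrow> g * (real j + 1) - l' j"
    then show thesis by (rule that)
  qed
  have "range l' = range l" unfolding r(2)[symmetric] by (rule l(2))
  with r(1) l(1) have "l' = l" by (rule strict_mono_range_unique)
  then have "(\<lambda>k. real (c (r k) i) / s (N (r k))) \<longlonglongrightarrow> g * (real i + 1) - l i" using r(3)[of i] by simp
  then have "\<forall>\<^sub>F k in sequentially. dist (real (c (r k) i) / s (N (r k))) (g * (real i + 1) - l i) < \<epsilon>"
    using e by (rule tendstoD)
  from eventually_happens'[OF sequentially_bot this]
  obtain k where "dist (real (c (r k) i) / s (N (r k))) (g * (real i + 1) - l i) < \<epsilon>" by blast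
  then show False using far[of "r k"] by (simp add: dist_real_def)
qed

lemma column_lln:
  assumes l: "strict_mono l" "{z. phi g z = 0} = range l" and e: "\<epsilon> > 0"
  shows "(\<lambda>d. prob d (\<lambda>c. \<bar>real (c i) / s d - (g * (real i + 1) - l i)\<bar> > \<epsilon>)) \<longlonglongrightarrow> 0"
proof -
  obtain K where K: "\<forall>\<^sub>F d in sequentially. \<forall>c. good d K c \<longrightarrow> \<bar>real (c i) / s d - (g * (real i + 1) - l i)\<bar> \<le> \<epsilon>"
    using good_stable[OF assms] by blast
  show ?thesis
    by (rule prob_tendsto_mono[OF bad_small[of K]]) (use K in \<open>eventually_elim, auto simp: not_less\<close>)
qed

lemma column_bound:
  assumes "d \<ge> 1" "c \<in> columns d"
  shows "real (c j) / s d \<le> 1 / (\<gamma> d * real (Suc j))"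
proof -
  have "real (Suc j) * real (c j) \<le> real d" using columns_area[OF assms(2), of j] by (metis of_nat_le_iff of_nat_mult)
  then show ?thesis using \<gamma>_pos[OF assms(1)] assms(1) unfolding s_eq[OF assms(1)]
    by (simp add: divide_simps mult_ac)
qed

text \<open>Monotonicity and nonnegativity hold for the columns of every diagram and are inherited
  from good diagrams close to the limit.\<close>

lemma staircase:
  assumes l: "strict_mono l" "{z. phi g z = 0} = range l"
  shows "limit_staircase g l (\<lambda>j. g * real (Suc j) - l j)"
proof
  have "\<forall>\<^sub>F d in sequentially. \<exists>c\<in>columns d. (\<bar>real (c i) / s d - (g * (real i + 1) - l i)\<bar> \<le> \<epsilon>)
     \<and> (\<bar>real (c j) / s d - (g * (real j + 1) - l j)\<bar> \<le> \<epsilon>)" if e: "\<epsilon> > 0" for \<epsilon> i j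
  proof -
    obtain K where K: "\<forall>\<^sub>F d in sequentially. \<forall>c. good d K c \<longrightarrow> \<bar>real (c i) / s d - (g * (real i + 1) - l i)\<bar> \<le> \<epsilon>"
      using good_stable[OF l e] by blast
    obtain K' where K': "\<forall>\<^sub>F d in sequentially. \<forall>c. good d K' c \<longrightarrow> \<bar>real (c j) / s d - (g * (real j + 1) - l j)\<bar> \<le> \<epsilon>"
      using good_stable[OF l e] by blast
    \<comment> \<open>The two columns may need different values of \<open>K\<close>. A union bound
      over the two bad events, indexed by \<open>r < 2\<close>, yields one diagram good for
      both.\<close>
    have "(\<lambda>d. prob d (\<lambda>c. \<exists>r<2. \<not> good d (if r = (0::nat) then K else K') c)) \<longlonglongrightarrow> 0"
      by (rule prob_UN_tendsto) (rule bad_small)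
    then have "\<forall>\<^sub>F d in sequentially. prob d (\<lambda>c. \<exists>r<2. \<not> good d (if r = (0::nat) then K else K') c) < 1"
      by (rule order_tendstoD) simp
    then show ?thesis using K K' eventually_ge_at_top[of 1]
    proof eventually_elim
      case (elim d)
      have "\<exists>c\<in>columns d. \<forall>r<2. good d (if r = (0::nat) then K else K') c"
      proof (rule ccontr)
        assume "\<not> ?thesis"
        then have "{c \<in> columns d. \<exists>r<2. \<not> good d (if r = (0::nat) then K else K') c} = columns d" by blast
        then have "prob d (\<lambda>c. \<exists>r<2. \<not> good d (if r = (0::nat) then K else K') c) = 1"
          unfolding prob_def using sum_col_weight[OF \<beta>_pos[OF elim(4)]] by metis
        then show False using elim(1) by linarith
      qed
      then obtain c where c: "c \<in> columns d" "\<forall>r<2. good d (if r = (0::nat) then K else K') c" by blast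
      have "good d K c" "good d K' c" using c(2)[rule_format, of 0] c(2)[rule_format, of 1] by simp_all
      then show ?case using elim(2,3) c(1) by blast
    qed
  qed
  note ev = this
  have ex: "\<exists>d c. d \<ge> 1 \<and> c \<in> columns d \<and> (\<bar>real (c i) / s d - (g * (real i + 1) - l i)\<bar> \<le> \<epsilon>)
     \<and> (\<bar>real (c j) / s d - (g * (real j + 1) - l j)\<bar> \<le> \<epsilon>)" if "\<epsilon> > 0" for \<epsilon> i j
    using eventually_happens'[OF sequentially_bot eventually_conj[OF ev[OF that, of i j] eventually_ge_at_top[of 1]]]
    by blast
  have Suc: "real k + 1 = real (Suc k)" for k by simp
  show "g * real (Suc j) - l j \<le> g * real (Suc i) - l i" if ij: "i \<le> j" for i j
  proof (rule field_le_epsilon)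
    fix e :: real assume "e > 0"
    then obtain d c where dc: "d \<ge> 1" "c \<in> columns d" "\<bar>real (c i) / s d - (g * (real i + 1) - l i)\<bar> \<le> e / 2"
      "\<bar>real (c j) / s d - (g * (real j + 1) - l j)\<bar> \<le> e / 2" using ex[of "e / 2" i j] by auto
    have "real (c j) / s d \<le> real (c i) / s d"
      using columns_antimono[OF dc(2) ij] s_pos[OF dc(1)] by (intro divide_right_mono) auto
    moreover have "\<bar>a - A\<bar> \<le> e / 2 \<Longrightarrow> \<bar>b - B\<bar> \<le> e / 2 \<Longrightarrow> b \<le> a \<Longrightarrow> B \<le> A + e" for a A b B :: real
      by linarith
    ultimately show "g * real (Suc j) - l j \<le> g * real (Suc i) - l i + e"
      using dc(3,4) unfolding Suc by blast
  qed
  show "g * real (Suc j) - l j \<ge> 0" for j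
  proof (rule field_le_epsilon)
    fix e :: real assume "e > 0"
    then obtain d c where dc: "d \<ge> 1" "\<bar>real (c j) / s d - (g * (real j + 1) - l j)\<bar> \<le> e" using ex[of e j j] by auto
    have "real (c j) / s d \<ge> 0" using s_pos[OF dc(1)] by simp
    moreover have "\<bar>b - B\<bar> \<le> e \<Longrightarrow> 0 \<le> b \<Longrightarrow> 0 \<le> B + e" for b B :: real
      by linarith
    ultimately show "0 \<le> g * real (Suc j) - l j + e" using dc(2) unfolding Suc by blast
  qed
qed (rule g, simp)

text \<open>The area bound survives the limit; the factor 2 comes from
  \<open>\<gamma> d > g / 2\<close>.\<close>

lemma staircase_small:
  assumes l: "strict_mono l" "{z. phi g z = 0} = range l"
  shows "g * real (Suc j) - l j \<le> 2 / (g * real (Suc j))"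
proof (rule field_le_epsilon)
  fix e :: real assume e: "e > 0"
  obtain K where K: "\<forall>\<^sub>F d in sequentially. \<forall>c. good d K c \<longrightarrow> \<bar>real (c j) / s d - (g * (real j + 1) - l j)\<bar> \<le> e"
    using good_stable[OF l e] by blast
  have "\<forall>\<^sub>F d in sequentially. g * real (Suc j) - l j \<le> 2 / (g * real (Suc j)) + e"
    using K good_exists[of K] \<gamma>_large eventually_ge_at_top[of 1]
  proof eventually_elim
    case (elim d)
    then obtain c where c: "good d K c" "\<bar>real (c j) / s d - (g * (real j + 1) - l j)\<bar> \<le> e" by blast
    have "real (c j) / s d \<le> 1 / (\<gamma> d * real (Suc j))"
      using c(1) by (intro column_bound elim) (simp add: good_def)
    also have "\<dots> \<le> 1 / (g / 2 * real (Suc j))"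
      using elim(3) g \<gamma>_pos[OF elim(4)] by (intro divide_left_mono mult_right_mono mult_pos_pos) auto
    finally have "real (c j) / s d \<le> 2 / (g * real (Suc j))" by simp
    moreover have "\<bar>b - B\<bar> \<le> e \<Longrightarrow> b \<le> C \<Longrightarrow> B \<le> C + e" for b B C :: real by linarith
    moreover have "real j + 1 = real (Suc j)" by simp
    ultimately show ?case using c(2) by metis
  qed
  from eventually_happens'[OF sequentially_bot this]
  show "g * real (Suc j) - l j \<le> 2 / (g * real (Suc j)) + e" by blast
qed

section \<open>Laws of large numbers for columns and shape\<close>

lemma \<gamma>_tendsto: "\<gamma> \<longlonglongrightarrow> g"
  using \<gamma>_lim unfolding \<gamma>_def .

lemma column_lln_scaled:
  assumes l: "strict_mono l" "{z. phi g z = 0} = range l" and e: "\<epsilon> > 0"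
  shows "(\<lambda>d. prob d (\<lambda>c. \<bar>real (c i) / (g * real d) - (g * real (Suc i) - l i)\<bar> > \<epsilon>)) \<longlonglongrightarrow> 0"
proof -
  define y where "y = g * (real i + 1) - l i"
  have y: "g * real (Suc i) - l i = y" by (simp add: y_def add.commute)
  have \<kappa>: "(\<lambda>d. \<gamma> d / g) \<longlonglongrightarrow> g / g" using g by (intro tendsto_intros \<gamma>_tendsto) auto
  then have \<kappa>1: "(\<lambda>d. \<gamma> d / g) \<longlonglongrightarrow> 1" using g by simp
  have "(\<lambda>d. \<bar>y\<bar> * \<bar>\<gamma> d / g - 1\<bar>) \<longlonglongrightarrow> \<bar>y\<bar> * \<bar>1 - 1\<bar>" by (intro tendsto_intros \<kappa>1)
  then have "\<forall>\<^sub>F d in sequentially. \<bar>y\<bar> * \<bar>\<gamma> d / g - 1\<bar> < \<epsilon> / 4" using e by (intro order_tendstoD(2)) auto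
  moreover have "\<forall>\<^sub>F d in sequentially. \<gamma> d / g < 3 / 2" using \<kappa>1 by (rule order_tendstoD) simp
  ultimately have ev: "\<forall>\<^sub>F d in sequentially. \<forall>c\<in>columns d.
      \<bar>real (c i) / (g * real d) - y\<bar> > \<epsilon> \<longrightarrow> \<bar>real (c i) / s d - y\<bar> > \<epsilon> / 2"
    using eventually_ge_at_top[of 1]
  proof eventually_elim
    case (elim d)
    show ?case
    proof (intro ballI impI, rule ccontr)
      fix c assume far: "\<bar>real (c i) / (g * real d) - y\<bar> > \<epsilon>" and "\<not> \<bar>real (c i) / s d - y\<bar> > \<epsilon> / 2"
      then have close: "\<bar>real (c i) / s d - y\<bar> \<le> \<epsilon> / 2" by simp
      define \<kappa> where "\<kappa> = \<gamma> d / g"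
      have \<kappa>0: "\<kappa> \<ge> 0" using \<gamma>_pos[OF elim(3)] g by (simp add: \<kappa>_def)
      have "real (c i) / (g * real d) = real (c i) / s d * \<kappa>"
        using \<gamma>_pos[OF elim(3)] unfolding s_eq[OF elim(3)] \<kappa>_def by simp
      then have "real (c i) / (g * real d) - y = (real (c i) / s d - y) * \<kappa> + y * (\<kappa> - 1)"
        by (simp add: algebra_simps)
      then have "\<bar>real (c i) / (g * real d) - y\<bar> \<le> \<bar>real (c i) / s d - y\<bar> * \<kappa> + \<bar>y\<bar> * \<bar>\<kappa> - 1\<bar>"
        using \<kappa>0 by (metis abs_mult abs_of_nonneg abs_triangle_ineq)
      \<comment> \<open>The ratio \<open>\<gamma> d / g < 3 / 2\<close> turns the error
        \<open>\<epsilon> / 2\<close> into \<open>3 / 4\<close> of \<open>\<epsilon>\<close>; the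
        last quarter is left for replacing \<open>\<gamma> d\<close> by \<open>g\<close>.\<close>
      moreover have "\<bar>real (c i) / s d - y\<bar> * \<kappa> \<le> \<epsilon> / 2 * (3 / 2)"
        using close \<kappa>0 elim(2) e by (intro mult_mono) (auto simp: \<kappa>_def)
      moreover have "\<bar>y\<bar> * \<bar>\<kappa> - 1\<bar> < \<epsilon> / 4" using elim(1) by (simp add: \<kappa>_def)
      moreover have "A \<le> B + C \<Longrightarrow> B \<le> \<epsilon> / 2 * (3 / 2) \<Longrightarrow> C < \<epsilon> / 4 \<Longrightarrow> A \<le> \<epsilon>" for A B C :: real
        by simp
      ultimately show False using far by (metis not_le)
    qed
  qed
  have "\<epsilon> / 2 > 0" using e by simp
  from prob_tendsto_mono[OF column_lln[OF l this, of i, folded y_def] ev] show ?thesis unfolding y .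
qed

text \<open>Columns beyond some \<open>J\<close> are uniformly small, in the diagrams as in the
  limit, so finitely many columns decide. The event speaks of any \<open>f\<close> bounding the
  region over \<open>u\<close>, which makes it usable for profiles and for reflected
  profiles.\<close>

lemma shape_lln:
  assumes l: "strict_mono l" "{z. phi g z = 0} = range l" and e: "\<epsilon> > 0"
  shows "(\<lambda>d. prob d (\<lambda>c. \<exists>u f. (\<forall>v. pt u v \<in> region (\<gamma> d) (\<lambda>j. 1 / s d * real (c j)) \<longleftrightarrow> v \<le> f) \<and>
      \<bar>f - roof (region g (\<lambda>j. g * real (Suc j) - l j)) u\<bar> > \<epsilon>)) \<longlonglongrightarrow> 0"
proof -
  define y where "y j = g * real (Suc j) - l j" for j
  interpret limit_staircase g l y unfolding y_def by (rule staircase[OF l])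
  define e' where "e' = \<epsilon> / 2"
  have e': "e' > 0" using e by (simp add: e'_def)
  obtain J :: nat where J: "real J \<ge> 2 / (g * e')" using real_arch_simple by blast
  have tail: "2 / (g * real (Suc j)) \<le> e'" if "J \<le> j" for j
  proof -
    have "2 / (g * e') \<le> real (Suc j)" using J that by linarith
    then show ?thesis using g e' by (simp add: divide_simps mult_ac)
  qed
  have ysmall: "y j \<le> e'" if "J \<le> j" for j
    using staircase_small[OF l, of j] tail[OF that] by (simp add: y_def)
  have "(\<lambda>d. real J * \<bar>\<gamma> d - g\<bar>) \<longlonglongrightarrow> real J * \<bar>g - g\<bar>" by (intro tendsto_intros \<gamma>_tendsto)
  then have "\<forall>\<^sub>F d in sequentially. real J * \<bar>\<gamma> d - g\<bar> < e'" using e' by (intro order_tendstoD(2)) auto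
  then have ev: "\<forall>\<^sub>F d in sequentially. \<forall>c\<in>columns d.
      (\<exists>u f. (\<forall>v. pt u v \<in> region (\<gamma> d) (\<lambda>j. 1 / s d * real (c j)) \<longleftrightarrow> v \<le> f) \<and> \<bar>f - roof (region g y) u\<bar> > \<epsilon>) \<longrightarrow>
      (\<exists>j<J. \<bar>real (c j) / s d - (g * (real j + 1) - l j)\<bar> > e')"
    using \<gamma>_large eventually_ge_at_top[of 1]
  proof eventually_elim
    case (elim d)
    show ?case
    proof (intro ballI impI, rule ccontr)
      fix c assume c: "c \<in> columns d"
        and "\<exists>u f. (\<forall>v. pt u v \<in> region (\<gamma> d) (\<lambda>j. 1 / s d * real (c j)) \<longleftrightarrow> v \<le> f) \<and> \<bar>f - roof (region g y) u\<bar> > \<epsilon>"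
        and close: "\<not> (\<exists>j<J. \<bar>real (c j) / s d - (g * (real j + 1) - l j)\<bar> > e')"
      then obtain u f where f: "\<And>v. pt u v \<in> region (\<gamma> d) (\<lambda>j. 1 / s d * real (c j)) \<longleftrightarrow> v \<le> f"
        and far: "\<bar>f - roof R u\<bar> > \<epsilon>" unfolding R_def by blast
      have "\<bar>f - roof R u\<bar> \<le> 2 * e'"
      proof (rule roof_close[OF f])
        show "1 / s d * real (c j) \<le> e'" if "J \<le> j" for j
        proof -
          have "real (c j) / s d \<le> 1 / (\<gamma> d * real (Suc j))" by (intro column_bound elim c)
          also have "\<dots> \<le> 1 / (g / 2 * real (Suc j))"
            using elim(2) g \<gamma>_pos[OF elim(3)] by (intro divide_left_mono mult_right_mono mult_pos_pos) auto
          also have "\<dots> = 2 / (g * real (Suc j))" by simp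
          finally show ?thesis using tail[OF that] by simp
        qed
        show "\<bar>1 / s d * real (c j) - y j\<bar> \<le> e'" if "j < J" for j
        proof -
          have "\<bar>real (c j) / s d - (g * (real j + 1) - l j)\<bar> \<le> e'" using close that by (meson not_le)
          then show ?thesis by (simp add: y_def add.commute)
        qed
        show "real J * \<bar>\<gamma> d - g\<bar> \<le> e'" using elim(1) by simp
      qed (use e' ysmall in auto)
      then show False using far by (simp add: e'_def)
    qed
  qed
  have "(\<lambda>d. prob d (\<lambda>c. \<exists>j<J. \<bar>real (c j) / s d - (g * (real j + 1) - l j)\<bar> > e')) \<longlonglongrightarrow> 0"
    by (intro prob_UN_tendsto column_lln[OF l e'])
  from prob_tendsto_mono[OF this ev] show ?thesis unfolding y_def .
qed

end

section \<open>The limit theorem\<close>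

text \<open>Injectivity of \<open>lens\<close> transports the sum over partitions to a sum over
  columns. An inequality suffices because only bad events are estimated.\<close>

lemma measure_lengths_le:
  fixes M :: "'a measure"
  assumes X: "X \<in> M \<rightarrow>\<^sub>M count_space (partitions d)"
    and dist: "distr M (count_space (partitions d)) X = jack_plancherel \<alpha> d"
    and inj: "inj_on lens (partitions d)" and lens: "\<And>p. p \<in> partitions d \<Longrightarrow> lens p \<in> columns d"
    and weight: "\<And>p. p \<in> partitions d \<Longrightarrow> jack_weight \<alpha> d p = col_weight \<beta> d (lens p)" and \<beta>: "\<beta> > 0"
  shows "measure M {s \<in> space M. A (lens (X s))} \<le> (\<Sum>c\<in>{c \<in> columns d. A c}. col_weight \<beta> d c)"
proof -
  define S where "S = {p \<in> partitions d. A (lens p)}"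
  have w: "jack_weight \<alpha> d p \<ge> 0" if "p \<in> partitions d" for p
    unfolding weight[OF that] by (rule col_weight_nonneg[OF \<beta> lens[OF that]])
  have "{s \<in> space M. A (lens (X s))} = X -` S \<inter> space M"
    using measurable_space[OF X] by (auto simp: S_def)
  then have "measure M {s \<in> space M. A (lens (X s))} = measure (jack_plancherel \<alpha> d) S"
    using measure_distr[OF X, of S] by (simp add: dist S_def)
  also have "\<dots> = (\<Sum>p\<in>S. jack_weight \<alpha> d p)"
  proof -
    have "emeasure (jack_plancherel \<alpha> d) S = (\<Sum>p\<in>S. ennreal (jack_weight \<alpha> d p))"
      unfolding jack_plancherel_def
      by (rule emeasure_point_measure_finite[OF finite_partitions]) (auto simp: S_def)
    also have "\<dots> = ennreal (\<Sum>p\<in>S. jack_weight \<alpha> d p)" by (rule sum_ennreal) (auto simp: S_def w)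
    finally have "emeasure (jack_plancherel \<alpha> d) S = ennreal (\<Sum>p\<in>S. jack_weight \<alpha> d p)" .
    moreover have "0 \<le> (\<Sum>p\<in>S. jack_weight \<alpha> d p)" by (intro sum_nonneg) (simp add: S_def w)
    ultimately show ?thesis unfolding measure_def by (simp only: enn2real_ennreal)
  qed
  also have "\<dots> = (\<Sum>p\<in>S. col_weight \<beta> d (lens p))" by (intro sum.cong) (auto simp: S_def weight)
  also have "\<dots> = (\<Sum>c\<in>lens ` S. col_weight \<beta> d c)"
    by (subst sum.reindex) (auto intro: inj_on_subset[OF inj] simp: S_def)
  also have "\<dots> \<le> (\<Sum>c\<in>{c \<in> columns d. A c}. col_weight \<beta> d c)"
    using finite_columns by (intro sum_mono2) (auto simp: S_def intro: lens col_weight_nonneg[OF \<beta>])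
  finally show ?thesis .
qed

lemma (in jack_regime) transfer:
  fixes M :: "nat \<Rightarrow> 'a measure"
  assumes le: "\<And>d. d \<ge> 1 \<Longrightarrow> measure (M d) (E d) \<le> prob d (A d)" and lim: "(\<lambda>d. prob d (A d)) \<longlonglongrightarrow> 0"
  shows "(\<lambda>d. measure (M d) (E d)) \<longlonglongrightarrow> 0"
proof (rule tendsto_sandwich[OF _ _ tendsto_const lim])
  show "\<forall>\<^sub>F d in sequentially. measure (M d) (E d) \<le> prob d (A d)"
    using eventually_ge_at_top[of 1] by eventually_elim (rule le)
qed simp

lemma SUP_gt_imp:
  fixes f :: "'b \<Rightarrow> real"
  assumes "(SUP x. ennreal \<bar>f x\<bar>) > ennreal \<epsilon>" "\<epsilon> > 0"
  shows "\<exists>x. \<bar>f x\<bar> > \<epsilon>"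
proof -
  obtain x where "ennreal \<epsilon> < ennreal \<bar>f x\<bar>" using assms(1) by (auto simp: less_SUP_iff)
  then have "\<epsilon> < \<bar>f x\<bar>" using assms(2) by (simp add: ennreal_less_iff)
  then show ?thesis by blast
qed

text \<open>Chosen from the zero set alone, so that one family of sequences serves every regime and
  is fixed before it.\<close>

definition spectrum_seq :: "real \<Rightarrow> nat \<Rightarrow> real" where
  "spectrum_seq g = (SOME l. strict_mono l \<and> {z. phi g z = 0} = range l)"

lemma spectrum_seq:
  assumes "g > 0"
  shows "strict_mono (spectrum_seq g)" "{z. phi g z = 0} = range (spectrum_seq g)"
proof -
  \<comment> \<open>Every \<open>g > 0\<close> is realised by an auxiliary regime, whatever the
    parameters of the theorem do; hence the zeros can be enumerated for each
    \<open>g\<close>.\<close>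
  interpret jack_regime g "\<lambda>d. g\<^sup>2 * real d"
  proof
    show "filterlim (\<lambda>d. g\<^sup>2 * real d) at_top sequentially"
      using assms by (intro filterlim_tendsto_pos_mult_at_top[OF tendsto_const] filterlim_real_sequentially) simp
    have "\<forall>\<^sub>F d in sequentially. sqrt (g\<^sup>2 * real d) / sqrt (real d) = g"
      using eventually_ge_at_top[of 1] by eventually_elim (use assms in \<open>simp add: real_sqrt_mult\<close>)
    then show "(\<lambda>d. sqrt (g\<^sup>2 * real d) / sqrt (real d)) \<longlonglongrightarrow> g" by (rule tendsto_eventually)
  qed (use assms in auto)
  show "strict_mono (spectrum_seq g)" "{z. phi g z = 0} = range (spectrum_seq g)"
    unfolding spectrum_seq_def using someI_ex[OF spectrum_ex] by blast+
qed

context jack_regime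
begin

lemma roof_formulas:
  defines "\<omega> \<equiv> roof (region g (\<lambda>j. g * real (Suc j) - spectrum_seq g j))"
  shows "x < spectrum_seq g 0 - g \<Longrightarrow> \<omega> x = - x"
    and "i \<ge> 1 \<Longrightarrow> x \<in> {spectrum_seq g (i - 1) - g..spectrum_seq g (i - 1)} \<Longrightarrow>
      \<omega> x = - 2 * (spectrum_seq g (i - 1) - real i * g) + x"
    and "i \<ge> 1 \<Longrightarrow> x \<in> {spectrum_seq g (i - 1)..spectrum_seq g i - g} \<Longrightarrow> \<omega> x = - x + 2 * real i * g"
proof -
  interpret limit_staircase g "spectrum_seq g" "\<lambda>j. g * real (Suc j) - spectrum_seq g j"
    by (rule staircase[OF spectrum_seq[OF g]])
  have \<omega>: "\<omega> = roof R" by (simp only: \<omega>_def R_def)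
  show "x < spectrum_seq g 0 - g \<Longrightarrow> \<omega> x = - x" unfolding \<omega> by (rule roof_left)
  assume "i \<ge> 1"
  then obtain j where j: "i = Suc j" by (cases i) auto
  show "\<omega> x = - 2 * (spectrum_seq g (i - 1) - real i * g) + x"
    if "x \<in> {spectrum_seq g (i - 1) - g..spectrum_seq g (i - 1)}"
    using roof_horizontal[of x j] that unfolding \<omega> j by (simp add: algebra_simps)
  show "\<omega> x = - x + 2 * real i * g" if "x \<in> {spectrum_seq g (i - 1)..spectrum_seq g i - g}"
    using roof_vertical[of x j] that unfolding \<omega> j by simp
qed

lemma tendsto_in_prob_lengths:
  assumes le: "\<And>d A. d \<ge> 1 \<Longrightarrow> measure (M d) {s \<in> space (M d). A (lens (\<Lambda> d s))} \<le> prob d A"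
  shows "tendsto_in_prob M (\<lambda>d s. real (lens (\<Lambda> d s) j) / (g * real d)) (g * real (Suc j) - spectrum_seq g j)"
  unfolding tendsto_in_prob_def by (intro allI impI transfer[OF le column_lln_scaled[OF spectrum_seq[OF g]]])

text \<open>The sign \<open>\<sigma>\<close> is \<open>- 1\<close> when \<open>lens\<close> are the row lengths, which exchanges the two axes.\<close>

lemma tendsto_sup_in_prob_lengths:
  fixes M :: "nat \<Rightarrow> 'a measure" and \<sigma> :: real
  assumes le: "\<And>d A. d \<ge> 1 \<Longrightarrow> measure (M d) {s \<in> space (M d). A (lens (\<Lambda> d s))} \<le> prob d A"
    and ps: "\<And>d. d \<ge> 1 \<Longrightarrow> prob_space (M d)"
    and meas: "\<And>d. d \<ge> 1 \<Longrightarrow> \<Lambda> d \<in> M d \<rightarrow>\<^sub>M count_space (partitions d)"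
    and F: "\<And>d p u v. d \<ge> 1 \<Longrightarrow> p \<in> partitions d \<Longrightarrow>
      pt (\<sigma> * u) v \<in> region (\<gamma> d) (\<lambda>j. 1 / s d * real (lens p j)) \<longleftrightarrow> v \<le> F d p u"
  shows "tendsto_sup_in_prob M (\<lambda>d s. F d (\<Lambda> d s))
    (\<lambda>u. roof (region g (\<lambda>j. g * real (Suc j) - spectrum_seq g j)) (\<sigma> * u))"
  unfolding tendsto_sup_in_prob_def
proof (intro allI impI)
  fix \<epsilon> :: real assume e: "\<epsilon> > 0"
  define \<omega> where "\<omega> = roof (region g (\<lambda>j. g * real (Suc j) - spectrum_seq g j))"
  define A where "A d c \<longleftrightarrow> (\<exists>u f. (\<forall>v. pt u v \<in> region (\<gamma> d) (\<lambda>j. 1 / s d * real (c j)) \<longleftrightarrow> v \<le> f) \<and> \<bar>f - \<omega> u\<bar> > \<epsilon>)" for d c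
  have "measure (M d) {s \<in> space (M d). (SUP x. ennreal \<bar>F d (\<Lambda> d s) x - \<omega> (\<sigma> * x)\<bar>) > ennreal \<epsilon>} \<le> prob d (A d)"
    if d: "d \<ge> 1" for d
  proof -
    have "measure (M d) {s \<in> space (M d). (SUP x. ennreal \<bar>F d (\<Lambda> d s) x - \<omega> (\<sigma> * x)\<bar>) > ennreal \<epsilon>}
      \<le> measure (M d) {s \<in> space (M d). A d (lens (\<Lambda> d s))}"
    proof (rule finite_measure.finite_measure_mono[OF prob_space.axioms(1)[OF ps[OF d]]])
      show "{s \<in> space (M d). (SUP x. ennreal \<bar>F d (\<Lambda> d s) x - \<omega> (\<sigma> * x)\<bar>) > ennreal \<epsilon>}
        \<subseteq> {s \<in> space (M d). A d (lens (\<Lambda> d s))}"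
      proof safe
        fix t assume t: "t \<in> space (M d)" and "(SUP x. ennreal \<bar>F d (\<Lambda> d t) x - \<omega> (\<sigma> * x)\<bar>) > ennreal \<epsilon>"
        then obtain x where x: "\<bar>F d (\<Lambda> d t) x - \<omega> (\<sigma> * x)\<bar> > \<epsilon>"
          using SUP_gt_imp[OF _ e, of "\<lambda>x. F d (\<Lambda> d t) x - \<omega> (\<sigma> * x)"] by blast
        have p: "\<Lambda> d t \<in> partitions d" using measurable_space[OF meas[OF d] t] by simp
        show "A d (lens (\<Lambda> d t))" unfolding A_def using x F[OF d p] by blast
      qed
      have "{s \<in> space (M d). A d (lens (\<Lambda> d s))} = \<Lambda> d -` {p \<in> partitions d. A d (lens p)} \<inter> space (M d)"
        using measurable_space[OF meas[OF d]] by auto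
      also have "\<dots> \<in> sets (M d)" by (rule measurable_sets[OF meas[OF d]]) auto
      finally show "{s \<in> space (M d). A d (lens (\<Lambda> d s))} \<in> sets (M d)" .
    qed
    also have "\<dots> \<le> prob d (A d)" by (rule le[OF d])
    finally show ?thesis .
  qed
  moreover have "(\<lambda>d. prob d (A d)) \<longlonglongrightarrow> 0"
    unfolding A_def \<omega>_def by (rule shape_lln[OF spectrum_seq[OF g] e])
  ultimately show "(\<lambda>d. measure (M d) {s \<in> space (M d). (SUP x. ennreal
      \<bar>F d (\<Lambda> d s) x - roof (region g (\<lambda>j. g * real (Suc j) - spectrum_seq g j)) (\<sigma> * x)\<bar>) > ennreal \<epsilon>}) \<longlonglongrightarrow> 0"
    unfolding \<omega>_def by (rule transfer)
qed

end

theorem theorem6p12: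
  fixes M :: "nat \<Rightarrow> 'a measure"
    and \<Lambda> :: "nat \<Rightarrow> 'a \<Rightarrow> nat list"
    and \<alpha> :: "nat \<Rightarrow> real"
  assumes "\<And>d. d \<ge> 1 \<Longrightarrow> \<alpha> d > 0"
    and "\<And>d. d \<ge> 1 \<Longrightarrow> prob_space (M d)"
    and "\<And>d. d \<ge> 1 \<Longrightarrow> \<Lambda> d \<in> M d \<rightarrow>\<^sub>M count_space (partitions d)"
    and "\<And>d. d \<ge> 1 \<Longrightarrow>
           distr (M d) (count_space (partitions d)) (\<Lambda> d) = jack_plancherel (\<alpha> d) d"
  shows "\<exists>l :: real \<Rightarrow> nat \<Rightarrow> real.
    (\<forall>h>0. strict_mono_on {1..} (l h) \<and>
       l h ` {1..} = {z. bessel_J (- z * inverse h) (2 * inverse h) = 0}) \<and>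
    (\<forall>g>0. filterlim \<alpha> at_top sequentially \<longrightarrow>
       (\<lambda>d. sqrt (\<alpha> d) / sqrt (real d)) \<longlonglongrightarrow> g \<longrightarrow>
       (\<forall>i\<ge>1. tendsto_in_prob M (\<lambda>d s. real (conj_part (\<Lambda> d s) i) / (- g * real d))
                 (l g i - real i * g)) \<and>
       (\<exists>\<omega>. is_limit_shape M \<Lambda> \<alpha> \<omega> \<and>
          (\<forall>x. (x < l g 1 - g \<longrightarrow> \<omega> x = - x) \<and>
               (\<forall>i\<ge>1. x \<in> {l g i - g .. l g i} \<longrightarrow>
                  \<omega> x = - 2 * (l g i - real i * g) + x) \<and>
               (\<forall>i\<ge>1. x \<in> {l g i .. l g (i + 1) - g} \<longrightarrow>
                  \<omega> x = - x + 2 * real i * g)))) \<and>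
    (\<forall>g<0. \<alpha> \<longlonglongrightarrow> 0 \<longrightarrow>
       (\<lambda>d. sqrt (\<alpha> d * real d)) \<longlonglongrightarrow> - inverse g \<longrightarrow>
       (\<forall>i\<ge>1. tendsto_in_prob M (\<lambda>d s. real (nth_part (\<Lambda> d s) i) / (- g * real d))
                 (- l (- g) i - real i * g)) \<and>
       (\<exists>\<omega>. is_limit_shape M \<Lambda> \<alpha> \<omega> \<and>
          (\<forall>x. (x > - l (- g) 1 - g \<longrightarrow> \<omega> x = x) \<and>
               (\<forall>i\<ge>1. x \<in> {- l (- g) i .. - l (- g) i - g} \<longrightarrow>
                  \<omega> x = - 2 * (l (- g) i + real i * g) - x) \<and>
               (\<forall>i\<ge>1. x \<in> {- l (- g) (i + 1) - g .. - l (- g) i} \<longrightarrow>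
                  \<omega> x = x - 2 * real i * g))))"
proof -
  \<comment> \<open>The statement numbers the zeros from 1, \<open>spectrum_seq\<close> from
    0.\<close>
  define l where "l h i = spectrum_seq h (i - 1)" for h and i :: nat
  have part0: "strict_mono_on {1..} (l h) \<and>
      l h ` {1..} = {z. bessel_J (- z * inverse h) (2 * inverse h) = 0}" if h: "h > 0" for h
  proof
    show "strict_mono_on {1..} (l h)"
      by (rule strict_mono_onI) (auto simp: l_def intro!: strict_monoD[OF spectrum_seq(1)[OF h]])
    have "l h ` {1..} = range (spectrum_seq h)"
    proof (intro equalityI subsetI)
      fix z assume "z \<in> range (spectrum_seq h)"
      then obtain j where "z = spectrum_seq h j" by (rule rangeE)
      then have "z = l h (Suc j)" by (simp add: l_def)
      then show "z \<in> l h ` {1..}" by simp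
    qed (auto simp: l_def)
    then show "l h ` {1..} = {z. bessel_J (- z * inverse h) (2 * inverse h) = 0}"
      using spectrum_seq(2)[OF h] by (simp add: phi_def)
  qed
  have part1: "(\<forall>i\<ge>1. tendsto_in_prob M (\<lambda>d s. real (conj_part (\<Lambda> d s) i) / (- g * real d)) (l g i - real i * g)) \<and>
       (\<exists>\<omega>. is_limit_shape M \<Lambda> \<alpha> \<omega> \<and>
          (\<forall>x. (x < l g 1 - g \<longrightarrow> \<omega> x = - x) \<and>
               (\<forall>i\<ge>1. x \<in> {l g i - g .. l g i} \<longrightarrow> \<omega> x = - 2 * (l g i - real i * g) + x) \<and>
               (\<forall>i\<ge>1. x \<in> {l g i .. l g (i + 1) - g} \<longrightarrow> \<omega> x = - x + 2 * real i * g)))"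
    if g: "g > 0" and a: "filterlim \<alpha> at_top sequentially" and lim: "(\<lambda>d. sqrt (\<alpha> d) / sqrt (real d)) \<longlonglongrightarrow> g" for g
  proof -
    interpret jack_regime g \<alpha> by unfold_locales (use assms(1) g a lim in auto)
    have le: "measure (M d) {s \<in> space (M d). A (col_lengths (\<Lambda> d s))} \<le> prob d A" if "d \<ge> 1" for d A
      unfolding prob_def
      by (rule measure_lengths_le[OF assms(3,4)[OF that] col_lengths_inj col_lengths_columns jack_weight_cols \<beta>_pos[OF that]])
    have 1: "tendsto_in_prob M (\<lambda>d s. real (conj_part (\<Lambda> d s) i) / (- g * real d)) (l g i - real i * g)" if i: "i \<ge> 1" for i
    proof -
      obtain j where j: "i = Suc j" using i by (cases i) auto
      have eq: "\<bar>real (conj_part p i) / (- g * real d) - (l g i - real i * g)\<bar>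
          = \<bar>real (col_lengths p j) / (g * real d) - (g * real (Suc j) - spectrum_seq g j)\<bar>" for p d
      proof -
        have "real (conj_part p i) / (- g * real d) - (l g i - real i * g)
          = - (real (col_lengths p j) / (g * real d) - (g * real (Suc j) - spectrum_seq g j))"
          by (simp add: j l_def col_lengths_def algebra_simps)
        then show ?thesis by simp
      qed
      show ?thesis using tendsto_in_prob_lengths[of M col_lengths \<Lambda> j, OF le]
        unfolding tendsto_in_prob_def eq .
    qed
    define \<omega> where "\<omega> = roof (region g (\<lambda>j. g * real (Suc j) - spectrum_seq g j))"
    have 2: "is_limit_shape M \<Lambda> \<alpha> \<omega>"
    proof -
      have "tendsto_sup_in_prob M (\<lambda>d t. profile (\<gamma> d) (1 / s d) (\<Lambda> d t))
          (\<lambda>u. roof (region g (\<lambda>j. g * real (Suc j) - spectrum_seq g j)) (1 * u))"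
      proof (rule tendsto_sup_in_prob_lengths[OF le assms(2,3)])
        show "pt (1 * u) v \<in> region (\<gamma> d) (\<lambda>j. 1 / s d * real (col_lengths p j)) \<longleftrightarrow> v \<le> profile (\<gamma> d) (1 / s d) p u"
          if "d \<ge> 1" "p \<in> partitions d" for d p u v
          using profile_iff[OF that(2), of "\<gamma> d" "1 / s d" u v] s_pos[OF that(1)] \<gamma>_pos[OF that(1)] by simp
      qed
      then show ?thesis
        by (simp add: is_limit_shape_def \<omega>_def \<gamma>_def s_def scale_def real_sqrt_divide)
    qed
    show ?thesis
    proof (intro conjI exI[of _ \<omega>])
      show "\<forall>x. (x < l g 1 - g \<longrightarrow> \<omega> x = - x) \<and>
               (\<forall>i\<ge>1. x \<in> {l g i - g .. l g i} \<longrightarrow> \<omega> x = - 2 * (l g i - real i * g) + x) \<and>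
               (\<forall>i\<ge>1. x \<in> {l g i .. l g (i + 1) - g} \<longrightarrow> \<omega> x = - x + 2 * real i * g)"
        unfolding l_def \<omega>_def using roof_formulas by simp
    qed (use 1 2 in auto)
  qed
  have part2: "(\<forall>i\<ge>1. tendsto_in_prob M (\<lambda>d s. real (nth_part (\<Lambda> d s) i) / (- g * real d)) (- l (- g) i - real i * g)) \<and>
       (\<exists>\<omega>. is_limit_shape M \<Lambda> \<alpha> \<omega> \<and>
          (\<forall>x. (x > - l (- g) 1 - g \<longrightarrow> \<omega> x = x) \<and>
               (\<forall>i\<ge>1. x \<in> {- l (- g) i .. - l (- g) i - g} \<longrightarrow>
                  \<omega> x = - 2 * (l (- g) i + real i * g) - x) \<and>
               (\<forall>i\<ge>1. x \<in> {- l (- g) (i + 1) - g .. - l (- g) i} \<longrightarrow>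
                  \<omega> x = x - 2 * real i * g)))"
    if g: "g < 0" and a: "\<alpha> \<longlonglongrightarrow> 0" and lim: "(\<lambda>d. sqrt (\<alpha> d * real d)) \<longlonglongrightarrow> - inverse g" for g
  proof -
    define G where "G = - g"
    \<comment> \<open>Conjugation turns the regime of vanishing parameter into the one already
      treated, with rows in the role of columns.\<close>
    define \<beta> where "\<beta> d = 1 / \<alpha> d" for d
    have G: "G > 0" "g = - G" using g by (auto simp: G_def)
    interpret jack_regime G \<beta>
    proof
      show "\<beta> d > 0" if "d \<ge> 1" for d using assms(1)[OF that] by (simp add: \<beta>_def)
      have "\<forall>\<^sub>F d in sequentially. \<alpha> d > 0" using eventually_ge_at_top[of 1] by eventually_elim (rule assms(1))
      then have "filterlim (\<lambda>d. inverse (\<alpha> d)) at_top sequentially" by (rule filterlim_inverse_at_top[OF a])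
      then show "filterlim \<beta> at_top sequentially" unfolding \<beta>_def inverse_eq_divide .
      have "(\<lambda>d. inverse (sqrt (\<alpha> d * real d))) \<longlonglongrightarrow> inverse (- inverse g)"
        using g by (intro tendsto_inverse lim) auto
      then show "(\<lambda>d. sqrt (\<beta> d) / sqrt (real d)) \<longlonglongrightarrow> G"
        by (simp add: \<beta>_def G_def real_sqrt_divide real_sqrt_mult divide_simps)
    qed (rule G(1))
    have le: "measure (M d) {s \<in> space (M d). A (row_lengths (\<Lambda> d s))} \<le> prob d A" if "d \<ge> 1" for d A
    proof -
      have w: "jack_weight (\<alpha> d) d p = col_weight (\<beta> d) d (row_lengths p)" if "p \<in> partitions d" for p
        unfolding \<beta>_def by (rule jack_weight_rows[OF that assms(1)[OF \<open>d \<ge> 1\<close>]])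
      show ?thesis unfolding prob_def
        by (rule measure_lengths_le[OF assms(3,4)[OF that] row_lengths_inj row_lengths_columns w \<beta>_pos[OF that]])
    qed
    have 1: "tendsto_in_prob M (\<lambda>d s. real (nth_part (\<Lambda> d s) i) / (- g * real d)) (- l (- g) i - real i * g)" if i: "i \<ge> 1" for i
    proof -
      obtain j where j: "i = Suc j" using i by (cases i) auto
      have eq: "- l (- g) i - real i * g = G * real (Suc j) - spectrum_seq G j"
        by (simp add: j l_def G_def algebra_simps)
      show ?thesis using tendsto_in_prob_lengths[of M row_lengths \<Lambda> j, OF le]
        unfolding eq unfolding j row_lengths_def G_def .
    qed
    define \<omega> where "\<omega> = roof (region G (\<lambda>j. G * real (Suc j) - spectrum_seq G j))"
    \<comment> \<open>Conjugation reflects \<open>x - y\<close>, hence the argument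
      \<open>- x\<close>. For the inverse parameter the box width is \<open>1 / s d\<close> and the
      height \<open>\<gamma> d\<close>, the reverse of the first regime.\<close>
    have 2: "is_limit_shape M \<Lambda> \<alpha> (\<lambda>x. \<omega> (- x))"
    proof -
      have "tendsto_sup_in_prob M (\<lambda>d t. profile (1 / s d) (\<gamma> d) (\<Lambda> d t))
          (\<lambda>u. roof (region G (\<lambda>j. G * real (Suc j) - spectrum_seq G j)) (- 1 * u))"
      proof (rule tendsto_sup_in_prob_lengths[OF le assms(2,3)])
        show "pt (- 1 * u) v \<in> region (\<gamma> d) (\<lambda>j. 1 / s d * real (row_lengths p j)) \<longleftrightarrow> v \<le> profile (1 / s d) (\<gamma> d) p u"
          if "d \<ge> 1" "p \<in> partitions d" for d p u v
          using profile_swap_iff[OF that(2), of "1 / s d" "\<gamma> d" u v] s_pos[OF that(1)] \<gamma>_pos[OF that(1)] by simp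
      qed
      moreover have "1 / s d = sqrt (\<alpha> d / real d)" "\<gamma> d = 1 / sqrt (\<alpha> d * real d)" for d
        by (simp_all add: \<gamma>_def s_def scale_def \<beta>_def real_sqrt_divide real_sqrt_mult)
      ultimately show ?thesis by (simp add: is_limit_shape_def \<omega>_def)
    qed
    have lG: "l (- g) i = spectrum_seq G (i - 1)" "l (- g) (i + 1) = spectrum_seq G i" for i
      by (simp_all add: l_def G_def)
    have 3: "(x > - l (- g) 1 - g \<longrightarrow> \<omega> (- x) = x) \<and>
               (\<forall>i\<ge>1. x \<in> {- l (- g) i .. - l (- g) i - g} \<longrightarrow>
                  \<omega> (- x) = - 2 * (l (- g) i + real i * g) - x) \<and>
               (\<forall>i\<ge>1. x \<in> {- l (- g) (i + 1) - g .. - l (- g) i} \<longrightarrow>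
                  \<omega> (- x) = x - 2 * real i * g)" for x
      using roof_formulas(1)[of "- x"] roof_formulas(2)[of _ "- x"] roof_formulas(3)[of _ "- x"]
      unfolding \<omega>_def[symmetric] lG by (auto simp: G(2))
    show ?thesis
      by (intro conjI exI[of _ "\<lambda>x. \<omega> (- x)"] allI impI 1 2 3[THEN conjunct1, rule_format]
          3[THEN conjunct2, THEN conjunct1, rule_format] 3[THEN conjunct2, THEN conjunct2, rule_format])
  qed
  show ?thesis
    by (intro exI[of _ l] conjI allI impI part0 part1 part2)
qed

end
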